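(* Let $M\ge2$ be a constant (integer), and let $\tilde p(x|\theta)=\binom{M}{x}\theta^x(1-\theta)^{M-x}$ ($x=0,1,\ldots,M$) be the binomial distribution $\mathrm{Bin}(M,\theta)$. For $H\ge2$ consider the mixture of $H$ such distributions $$p(x|\theta_1,\ldots,\theta_H,\tau_1,\ldots,\tau_{H-1}):=\sum_{i=1}^{H-1}\tau_i\,\tilde p(x|\theta_i)+\Big(1-\sum_{i=1}^{H-1}\tau_i\Big)\tilde p(x|\theta_H),$$ where the $\tau_i$ are mixing proportions ($0\le\tau_i\le1$, $\sum_{i=1}^{H-1}\tau_i\le1$) and the parameter space is $\Theta=[0,1]^H\times[0,1]^{H-1}$. Let $H_0$ be the number of mixture components of the true distribution $q(x)$. If $H_0\le\min\{H,M/2\}$, then an upper bound for the learning coefficient of this mixture model is given by $$\frac{3H_0+H-2}{4}$$ (multiplicity is $1$).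
   Context: That the true distribution has $H_0\ge1$ mixture components means that $$q(x)=\sum_{i=1}^{H_0-1}\tau_{i*}\,\tilde p(x|\theta_{i*})+\Big(1-\sum_{i=1}^{H_0-1}\tau_{i*}\Big)\tilde p(x|\theta_{H_0*})$$ with mutually distinct parameters $\theta_{1*},\ldots,\theta_{H_0*}$ in $[0,1]$ and $\tau_{i*}>0$, $\sum_{i=1}^{H_0-1}\tau_{i*}<1$ (for $H_0=1$, $q(x)=\tilde p(x|\theta_* )$). Write $w=(\theta_1,\ldots,\theta_H,\tau_1,\ldots,\tau_{H-1})$ for the parameter, $f(x|w)=\log\frac{q(x)}{p(x|w)}$ for the log-likelihood ratio and $K(w):=\sum_{x=0}^{M}q(x)\log\frac{q(x)}{p(x|w)}$ for the Kullback–Leibler divergence. The set of realizable parameters is $\Theta_*=\{w\in\Theta\mid K(w)=0\}$. Standing assumptions: $K$ is analytic, and $f$ is $L^2$ and analytic, around realizable parameters; the prior density is positive at every realizable parameter. Then the learning coefficient is $\lambda=\inf_{P\in\Theta_*}\lambda_P$, where $\lambda_P$ is the real log canonical threshold of $K$ at $P$. Real log canonical threshold. Let $F$ be real analytic near $P\in\mathbb{R}^n$, not identically zero, $F(P)=0$. By resolution of singularities there are an open neighborhood $W$ of $P$, a real analytic manifold $\tilde U$ and a proper analytic map $g:\tilde U\to W$, an analytic isomorphism outside $F^{-1}(0)$, such that at each point $Q\in\tilde U_0:=g^{-1}(F^{-1}(0))$ there are local coordinates $u$ centered at $Q$ with $F(g(u))=a(u)u_1^{k_1}\cdots u_n^{k_n}$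 and $|g'(u)|=|b(u)u_1^{h_1}\cdots u_n^{h_n}|$, where $g'$ is the Jacobian determinant, $k_i=k_i^{(Q)}$, $h_i=h_i^{(Q)}$ are non-negative integers, and $a,b$ are analytic with $a(0)\neq0$, $b(0)\ne0$. Then $\lambda_P=\inf_{Q\in\tilde U_0}\min_i(h_i^{(Q)}+1)/k_i^{(Q)}$ (with $(h_i+1)/k_i=\infty$ if $k_i=0$); this is independent of the choice of $(W,\tilde U,g)$. The multiplicity is the maximum number of indices $i$ for which $(h_i^{(Q)}+1)/k_i^{(Q)}=\lambda_P$. *)

theory Defs
  imports "HOL-Analysis.Analysis"
begin

section \<open>Real analytic functions of several variables\<close>

text \<open>Multi-indices are functions \<open>'n \<Rightarrow> nat\<close>; \<open>has_sum\<close> is unconditional (absolute)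
  convergence, required on a whole cube around the point.\<close>

definition real_analytic_at :: "(real^'n \<Rightarrow> real) \<Rightarrow> real^'n \<Rightarrow> bool" where
  "real_analytic_at f x \<longleftrightarrow>
     (\<exists>(c :: ('n \<Rightarrow> nat) \<Rightarrow> real) r. 0 < r \<and>
        (\<forall>y. (\<forall>i. \<bar>y $ i - x $ i\<bar> < r) \<longrightarrow>
           ((\<lambda>\<alpha>. c \<alpha> * (\<Prod>i\<in>UNIV. (y $ i - x $ i) ^ \<alpha> i)) has_sum f y) UNIV))"

definition real_analytic_on :: "(real^'n \<Rightarrow> real) \<Rightarrow> (real^'n) set \<Rightarrow> bool" where
  "real_analytic_on f S \<longleftrightarrow> (\<forall>x\<in>S. real_analytic_at f x)"

definition vec_analytic_on :: "(real^'n \<Rightarrow> real^'m) \<Rightarrow> (real^'n) set \<Rightarrow> bool" where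
  "vec_analytic_on f S \<longleftrightarrow> (\<forall>i. real_analytic_on (\<lambda>x. f x $ i) S)"

section \<open>Real analytic manifolds\<close>

type_synonym ('p, 'n) chart = "'p set \<times> ('p \<Rightarrow> real^'n)"

definition is_chart :: "'p topology \<Rightarrow> ('p, 'n::finite) chart \<Rightarrow> bool" where
  "is_chart T = (\<lambda>(V, \<phi>). openin T V \<and> open (\<phi> ` V) \<and>
     homeomorphic_map (subtopology T V) (top_of_set (\<phi> ` V)) \<phi>)"

definition charts_compatible :: "('p, 'n::finite) chart \<Rightarrow> ('p, 'n::finite) chart \<Rightarrow> bool" where
  "charts_compatible = (\<lambda>(V, \<phi>) (V', \<phi>').
     vec_analytic_on (\<phi>' \<circ> inv_into V \<phi>) (\<phi> ` (V \<inter> V')) \<and>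
     vec_analytic_on (\<phi> \<circ> inv_into V' \<phi>') (\<phi>' ` (V \<inter> V')))"

definition analytic_manifold :: "'p topology \<Rightarrow> ('p, 'n::finite) chart set \<Rightarrow> bool" where
  "analytic_manifold T A \<longleftrightarrow>
     Hausdorff_space T \<and> second_countable T \<and>
     (\<forall>c\<in>A. is_chart T c) \<and> (\<Union>c\<in>A. fst c) = topspace T \<and>
     (\<forall>c\<in>A. \<forall>c'\<in>A. charts_compatible c c')"

definition restrict_atlas :: "'p set \<Rightarrow> ('p, 'n::finite) chart set \<Rightarrow> ('p, 'n::finite) chart set" where
  "restrict_atlas S A = (\<lambda>(V, \<phi>). (V \<inter> S, \<phi>)) ` A"

definition id_atlas :: "(real^'n) set \<Rightarrow> (real^'n, 'n::finite) chart set" where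
  "id_atlas W = {(W, \<lambda>x. x)}"

definition analytic_map ::
  "'p topology \<Rightarrow> ('p, 'n::finite) chart set \<Rightarrow> 'q topology \<Rightarrow> ('q, 'm::finite) chart set \<Rightarrow> ('p \<Rightarrow> 'q) \<Rightarrow> bool" where
  "analytic_map T A T' B f \<longleftrightarrow> continuous_map T T' f \<and>
     (\<forall>(V, \<phi>)\<in>A. \<forall>(V', \<psi>)\<in>B.
        vec_analytic_on (\<psi> \<circ> f \<circ> inv_into V \<phi>) (\<phi> ` {p\<in>V. f p \<in> V'}))"

definition analytic_iso ::
  "'p topology \<Rightarrow> ('p, 'n::finite) chart set \<Rightarrow> 'q topology \<Rightarrow> ('q, 'm::finite) chart set \<Rightarrow> ('p \<Rightarrow> 'q) \<Rightarrow> bool" where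
  "analytic_iso T A T' B f \<longleftrightarrow>
     (\<exists>f'. homeomorphic_maps T T' f f' \<and> analytic_map T A T' B f \<and> analytic_map T' B T A f')"

text \<open>Local coordinates need not belong to the given atlas, only to the maximal one.\<close>

definition local_coordinates ::
  "'p topology \<Rightarrow> ('p, 'n::finite) chart set \<Rightarrow> 'p \<Rightarrow> 'p set \<Rightarrow> ('p \<Rightarrow> real^'n) \<Rightarrow> bool" where
  "local_coordinates T A Q V \<phi> \<longleftrightarrow>
     is_chart T (V, \<phi>) \<and> (\<forall>c\<in>A. charts_compatible (V, \<phi>) c) \<and> Q \<in> V \<and> \<phi> Q = 0"

section \<open>Resolution of singularities and the real log canonical threshold\<close>

definition zero_fibre :: "(real^'n \<Rightarrow> real) \<Rightarrow> 'p topology \<Rightarrow> ('p \<Rightarrow> real^'n) \<Rightarrow> 'p set" where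
  "zero_fibre F T g = {Q \<in> topspace T. F (g Q) = 0}"

definition normal_crossing_at ::
  "(real^'n \<Rightarrow> real) \<Rightarrow> 'p topology \<Rightarrow> ('p, 'n::finite) chart set \<Rightarrow> ('p \<Rightarrow> real^'n) \<Rightarrow> 'p
     \<Rightarrow> ('n \<Rightarrow> nat) \<Rightarrow> ('n \<Rightarrow> nat) \<Rightarrow> bool" where
  "normal_crossing_at F T A g Q k h \<longleftrightarrow>
     (\<exists>V \<phi> a b. local_coordinates T A Q V \<phi> \<and>
        real_analytic_on a (\<phi> ` V) \<and> real_analytic_on b (\<phi> ` V) \<and> a 0 \<noteq> 0 \<and> b 0 \<noteq> 0 \<and>
        (\<forall>u\<in>\<phi> ` V.
           F (g (inv_into V \<phi> u)) = a u * (\<Prod>i\<in>UNIV. u $ i ^ k i) \<and>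
           \<bar>det (jacobian (g \<circ> inv_into V \<phi>) (at u))\<bar> = \<bar>b u * (\<Prod>i\<in>UNIV. u $ i ^ h i)\<bar>))"

definition is_resolution ::
  "(real^'n \<Rightarrow> real) \<Rightarrow> (real^'n) set \<Rightarrow> 'p topology \<Rightarrow> ('p, 'n::finite) chart set \<Rightarrow> ('p \<Rightarrow> real^'n)
     \<Rightarrow> ('p \<Rightarrow> 'n \<Rightarrow> nat) \<Rightarrow> ('p \<Rightarrow> 'n \<Rightarrow> nat) \<Rightarrow> bool" where
  "is_resolution F W T A g k h \<longleftrightarrow>
     analytic_manifold T A \<and>
     analytic_map T A (top_of_set W) (id_atlas W) g \<and>
     proper_map T (top_of_set W) g \<and>
     analytic_iso
       (subtopology T (topspace T - zero_fibre F T g)) (restrict_atlas (topspace T - zero_fibre F T g) A)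
       (top_of_set {w\<in>W. F w \<noteq> 0}) (id_atlas {w\<in>W. F w \<noteq> 0}) g \<and>
     (\<forall>Q\<in>zero_fibre F T g. normal_crossing_at F T A g Q (k Q) (h Q))"

definition exponent_ratio :: "nat \<Rightarrow> nat \<Rightarrow> ereal" where
  "exponent_ratio k h = (if k = 0 then \<infinity> else ereal ((real h + 1) / real k))"

text \<open>\<open>has_rlct F P l m\<close>: the real log canonical threshold of \<open>F\<close> at \<open>P\<close> is \<open>l\<close>, with multiplicity
  \<open>m\<close>. The infimum and the maximum range over the whole zero fibre over a neighbourhood of \<open>P\<close>,
  so on a large neighbourhood they could see worse zeros of \<open>F\<close> away from \<open>P\<close>; they are independent
  of the choices once the neighbourhood is small enough. The quantifier over \<open>W'\<close> expresses exactly
  this. The points of the manifold are taken from \<open>nat \<Rightarrow> real\<close>, which has the cardinality of the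
  continuum, so that every second countable Hausdorff manifold has a copy there; the topology
  \<open>T\<close> is arbitrary.\<close>

definition has_rlct :: "(real^'n \<Rightarrow> real) \<Rightarrow> real^'n \<Rightarrow> ereal \<Rightarrow> nat \<Rightarrow> bool" where
  "has_rlct F P l m \<longleftrightarrow>
     F P = 0 \<and> (\<forall>W'. open W' \<and> P \<in> W' \<longrightarrow> (\<exists>w\<in>W'. F w \<noteq> 0)) \<and>
     (\<exists>W (T :: (nat \<Rightarrow> real) topology) A g k h.
        open W \<and> P \<in> W \<and> real_analytic_on F W \<and> is_resolution F W T A g k h \<and>
        (\<forall>W'. open W' \<and> P \<in> W' \<and> W' \<subseteq> W \<longrightarrow>
           l = (INF Q\<in>{Q \<in> zero_fibre F T g. g Q \<in> W'}.
                  Min (range (\<lambda>i. exponent_ratio (k Q i) (h Q i)))) \<and>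
           m = Max ((\<lambda>Q. card {i. exponent_ratio (k Q i) (h Q i) = l})
                  ` {Q \<in> zero_fibre F T g. g Q \<in> W'})))"

text \<open>\<open>has_rlct\<close> is a relation because existence (resolution of singularities) and uniqueness of
  the threshold are theorems; the learning coefficient is the infimum of all thresholds of \<open>K\<close>
  at the points of the given set of realizable parameters.\<close>

definition learning_coefficient :: "(real^'n \<Rightarrow> real) \<Rightarrow> (real^'n) set \<Rightarrow> ereal" where
  "learning_coefficient K R = Inf {l. \<exists>P\<in>R. \<exists>m. has_rlct K P l m}"

section \<open>Binomial mixtures\<close>

text \<open>The type \<open>'i\<close> indexes the free mixing proportions \<open>\<tau>\<^sub>1, \<dots>, \<tau>\<^bsub>H-1\<^esub>\<close>, so \<open>CARD('i) = H - 1\<close>.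
  The success probabilities \<open>\<theta>\<^sub>1, \<dots>, \<theta>\<^sub>H\<close> are indexed by \<open>'i option\<close>, where \<open>None\<close> is the last
  component, whose proportion is determined by the others.\<close>

type_synonym 'i param = "real ^ ('i option + 'i)"

abbreviation theta :: "'i::finite param \<Rightarrow> 'i option \<Rightarrow> real" where
  "theta w j \<equiv> w $ Inl j"

abbreviation tau :: "'i::finite param \<Rightarrow> 'i \<Rightarrow> real" where
  "tau w i \<equiv> w $ Inr i"

text \<open>Given by its polynomial formula rather than by \<open>pmf (binomial_pmf M \<theta>) x\<close>, since it is also
  needed for \<open>\<theta>\<close> in a neighbourhood of \<open>[0,1]\<close>.\<close>

definition binom_prob :: "nat \<Rightarrow> real \<Rightarrow> nat \<Rightarrow> real" where
  "binom_prob M \<theta> x = real (M choose x) * \<theta> ^ x * (1 - \<theta>) ^ (M - x)"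

definition mixture :: "nat \<Rightarrow> 'i::finite param \<Rightarrow> nat \<Rightarrow> real" where
  "mixture M w x = (\<Sum>i\<in>UNIV. tau w i * binom_prob M (theta w (Some i)) x)
     + (1 - (\<Sum>i\<in>UNIV. tau w i)) * binom_prob M (theta w None) x"

definition param_space :: "'i::finite param set" where
  "param_space = {w. (\<forall>j. theta w j \<in> {0..1}) \<and> (\<forall>i. tau w i \<in> {0..1}) \<and> (\<Sum>i\<in>UNIV. tau w i) \<le> 1}"

definition true_mixture :: "nat \<Rightarrow> nat \<Rightarrow> (nat \<Rightarrow> real) \<Rightarrow> bool" where
  "true_mixture M H0 q \<longleftrightarrow> 1 \<le> H0 \<and>
     (\<exists>\<theta> \<tau> :: nat \<Rightarrow> real.
        inj_on \<theta> {1..H0} \<and> (\<forall>i\<in>{1..H0}. \<theta> i \<in> {0..1}) \<and>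
        (\<forall>i\<in>{1..<H0}. 0 < \<tau> i) \<and> (\<Sum>i\<in>{1..<H0}. \<tau> i) < 1 \<and>
        (\<forall>x\<le>M. q x = (\<Sum>i\<in>{1..<H0}. \<tau> i * binom_prob M (\<theta> i) x)
           + (1 - (\<Sum>i\<in>{1..<H0}. \<tau> i)) * binom_prob M (\<theta> H0) x))"

definition loglik_ratio :: "nat \<Rightarrow> (nat \<Rightarrow> real) \<Rightarrow> nat \<Rightarrow> 'i::finite param \<Rightarrow> real" where
  "loglik_ratio M q x w = ln (q x / mixture M w x)"

definition KL :: "nat \<Rightarrow> (nat \<Rightarrow> real) \<Rightarrow> 'i::finite param \<Rightarrow> real" where
  "KL M q w = (\<Sum>x\<le>M. q x * loglik_ratio M q x w)"

text \<open>If \<open>mixture M w x = 0 < q x\<close> for some \<open>x\<close>, the divergence is infinite, whereas \<open>KL\<close> is a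
  meaningless real number because \<open>ln (q x / 0) = 0\<close>; such parameters are excluded.\<close>

definition realizable :: "nat \<Rightarrow> (nat \<Rightarrow> real) \<Rightarrow> 'i::finite param set" where
  "realizable M q =
     {w \<in> param_space. (\<forall>x\<le>M. 0 < q x \<longrightarrow> 0 < mixture M w x) \<and> KL M q w = 0}"

text \<open>The log-likelihood ratio must be a genuine real number around realizable parameters, hence the
  positivity requirement (\<open>ln\<close> is total, so analyticity alone would not express it). Square
  integrability is then automatic, because the sample space \<open>{..M}\<close> is finite.\<close>

definition analytic_around_realizable :: "nat \<Rightarrow> (nat \<Rightarrow> real) \<Rightarrow> 'i::finite param set \<Rightarrow> bool" where
  "analytic_around_realizable M q R \<longleftrightarrow>
     (\<forall>P\<in>R. \<exists>W. open W \<and> P \<in> W \<and>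
        (\<forall>x\<le>M. (\<forall>w\<in>W. 0 < q x \<and> 0 < mixture M w x) \<and> real_analytic_on (loglik_ratio M q x) W) \<and>
        real_analytic_on (KL M q) W)"

definition prior_density :: "('i::finite param \<Rightarrow> real) \<Rightarrow> bool" where
  "prior_density \<pi> \<longleftrightarrow> (\<forall>w\<in>param_space. 0 \<le> \<pi> w) \<and> (\<pi> has_integral 1) param_space"

end

theory Submission
  imports Defs
begin

text \<open>The point \<open>P\<close> is chosen with \<open>H0 - 1\<close> components equal to components of the true distribution and
  the other \<open>k + 1\<close> components, \<open>k = H - H0\<close>, merged into the remaining one with equal positive
  proportions. Near \<open>P\<close> take as coordinates the \<open>r = 2 H0 - 1\<close> parameters \<open>x\<close> which move the mixture to
  first order (the parameters of the single components and the first moment of the cluster), the \<open>k\<close>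
  displacements \<open>d\<close> inside the cluster, and the proportions \<open>s\<close> inside the cluster. Then \<open>p - q\<close> is a
  linear form in \<open>x\<close> plus a positive definite quadratic form in \<open>d\<close> times \<open>p''(\<theta>0)\<close>, up to terms of
  higher weight, and the vectors involved are linearly independent because \<open>2 H0 \<le> M\<close>. Hence \<open>K\<close> behaves
  like \<open>|x|^2 + |d|^4\<close>. Blowing up \<open>x = d = 0\<close>, and then the intersection of the exceptional divisor with
  the strict transform of \<open>x = 0\<close>, resolves \<open>K\<close>; the second divisor gives the threshold
  \<open>(2 r + k) / 4\<close>.\<close>

section \<open>Real analytic functions\<close>

text \<open>\<open>has_rlct\<close> asks for an actual resolution: a manifold, a proper map and
  normal crossings at every zero over a neighbourhood. The divisor that computes the value is that
  of the weighted blow-up with weight 2 on \<open>x\<close> and weight 1 on \<open>d\<close>, but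
  this space has quotient singularities in general. Two ordinary blow-ups reach the same divisor
  through smooth charts. The first divisor has the ratio \<open>(r + k) / 2\<close>, larger than
  \<open>(2 r + k) / 4\<close> when \<open>k > 0\<close>, so a single index attains the minimum and
  the multiplicity is 1. Terms of higher weight need no estimates. They are absorbed into
  coefficients that depend analytically on the point, which makes the factorisation on the blow-up
  exact, and non-degeneracy is an open condition. Equal proportions make the quadratic form a
  multiple of \<open>|d|^2 + (sum d)^2\<close>. The bound \<open>2 H0 \<le> M\<close> is a dimension
  count: \<open>2 H0\<close> directions have to be independent among the functions on
  \<open>{0..M}\<close> with sum 0. Finally
  \<open>2 r + k = 2 (2 H0 - 1) + (H - H0) = 3 H0 + H - 2\<close>.\<close>

text \<open>Grouping terms by their exponent makes every absolutely convergent sum of monomials, over an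
  arbitrary index set, a power series. Products and compositions are expanded over pairs and over
  families of lists of monomials.\<close>

lemma summable_on_abs_real:
  fixes f :: "'a \<Rightarrow> real"
  shows "f summable_on A \<Longrightarrow> (\<lambda>x. \<bar>f x\<bar>) summable_on A"
  using summable_on_iff_abs_summable_on_real[of f A] by simp

lemma has_sum_mult_real:
  fixes f :: "'a \<Rightarrow> real" and g :: "'b \<Rightarrow> real"
  assumes f: "(f has_sum a) A" and g: "(g has_sum b) B"
  shows "((\<lambda>(x, y). f x * g y) has_sum (a * b)) (A \<times> B)"
proof -
  have sf: "(\<lambda>x. norm (f x)) summable_on A" and sg: "(\<lambda>x. norm (g x)) summable_on B"
    using f g has_sum_imp_summable summable_on_iff_abs_summable_on_real by blast+
  have "(\<lambda>p. norm (case p of (x, y) \<Rightarrow> f x * g y)) summable_on A \<times> B"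
  proof (rule summable_on_SigmaI)
    show "((\<lambda>y. norm (case (x, y) of (x, y) \<Rightarrow> f x * g y)) has_sum norm (f x) * (\<Sum>\<^sub>\<infinity>y\<in>B. norm (g y))) B" for x
      using has_sum_cmult_right[OF has_sum_infsum[OF sg], of "norm (f x)"] by (simp add: abs_mult)
    show "(\<lambda>x. norm (f x) * (\<Sum>\<^sub>\<infinity>y\<in>B. norm (g y))) summable_on A"
      by (rule summable_on_cmult_left[OF sf])
  qed auto
  hence s: "(\<lambda>(x, y). f x * g y) summable_on A \<times> B"
    by (rule abs_summable_summable)
  show ?thesis
  proof (rule has_sum_SigmaI[where g="\<lambda>x. f x * b"])
    show "((\<lambda>y. case (x, y) of (x, y) \<Rightarrow> f x * g y) has_sum f x * b) B" for x
      using has_sum_cmult_right[OF g, of "f x"] by simp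
    show "((\<lambda>x. f x * b) has_sum a * b) A"
      using has_sum_cmult_left[OF f] .
    show "(\<lambda>(x, y). f x * g y) summable_on A \<times> B" by fact
  qed
qed

lemma real_analytic_at_groupI:
  fixes f :: "real^'n \<Rightarrow> real" and b :: "'j \<Rightarrow> real" and e :: "'j \<Rightarrow> 'n \<Rightarrow> nat"
  assumes r: "r > 0"
    and sum: "\<And>y. (\<And>i. \<bar>y $ i - x $ i\<bar> < r) \<Longrightarrow>
      ((\<lambda>j. b j * (\<Prod>i\<in>UNIV. (y $ i - x $ i) ^ e j i)) has_sum f y) J"
  shows "real_analytic_at f x"
proof -
  define F where "F \<gamma> = {j\<in>J. e j = \<gamma>}" for \<gamma>
  define c where "c \<gamma> = infsum b (F \<gamma>)" for \<gamma>
  \<comment> \<open>At this point every monomial is nonzero, and on a fibre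
    \<open>F \<gamma>\<close> it is one constant, so summability there passes to \<open>b\<close>
    itself.\<close>
  define y0 where "y0 = (\<chi> i. x $ i + r / 2)"
  have "(\<lambda>j. b j * (\<Prod>i\<in>UNIV. (y0 $ i - x $ i) ^ e j i)) summable_on J"
    using sum[of y0] r by (auto simp: y0_def has_sum_imp_summable)
  hence s0: "(\<lambda>j. b j * (\<Prod>i\<in>UNIV. (r / 2) ^ e j i)) summable_on J"
    by (simp add: y0_def)
  have sb: "b summable_on F \<gamma>" for \<gamma>
  proof -
    have "(\<lambda>j. b j * (\<Prod>i\<in>UNIV. (r / 2) ^ e j i)) summable_on F \<gamma>"
      by (rule summable_on_subset_banach[OF s0]) (auto simp: F_def)
    hence "(\<lambda>j. b j * (\<Prod>i\<in>UNIV. (r / 2) ^ \<gamma> i)) summable_on F \<gamma>"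
      by (rule summable_on_cong[THEN iffD1, rotated]) (auto simp: F_def)
    thus ?thesis
      using r by (subst (asm) summable_on_cmult_left') auto
  qed
  have "((\<lambda>\<alpha>. c \<alpha> * (\<Prod>i\<in>UNIV. (y $ i - x $ i) ^ \<alpha> i)) has_sum f y) UNIV"
    if y: "\<And>i. \<bar>y $ i - x $ i\<bar> < r" for y
  proof -
    define t where "t j = b j * (\<Prod>i\<in>UNIV. (y $ i - x $ i) ^ e j i)" for j
    have "bij_betw (\<lambda>j. (e j, j)) J (Sigma UNIV F)"
      by (rule bij_betwI[where g=snd]) (auto simp: F_def)
    hence "((\<lambda>(\<gamma>, j). t j) has_sum f y) (Sigma UNIV F)"
      using has_sum_reindex_bij_betw[of "\<lambda>j. (e j, j)" J "Sigma UNIV F" "\<lambda>(\<gamma>, j). t j" "f y"] sum[OF y]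
      by (simp add: t_def)
    moreover have "((\<lambda>j. case (\<gamma>, j) of (\<gamma>, j) \<Rightarrow> t j) has_sum c \<gamma> * (\<Prod>i\<in>UNIV. (y $ i - x $ i) ^ \<gamma> i)) (F \<gamma>)" for \<gamma>
    proof -
      have "((\<lambda>j. b j * (\<Prod>i\<in>UNIV. (y $ i - x $ i) ^ \<gamma> i)) has_sum c \<gamma> * (\<Prod>i\<in>UNIV. (y $ i - x $ i) ^ \<gamma> i)) (F \<gamma>)"
        unfolding c_def by (intro has_sum_cmult_left has_sum_infsum sb)
      thus ?thesis
        by (rule has_sum_cong[THEN iffD1, rotated]) (auto simp: F_def t_def)
    qed
    ultimately show ?thesis
      by (rule has_sum_SigmaD)
  qed
  thus ?thesis
    unfolding real_analytic_at_def using r by blast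
qed

lemma real_analytic_at_const: "real_analytic_at (\<lambda>_. c) x"
  by (rule real_analytic_at_groupI[where r=1 and J="{()}" and b="\<lambda>_. c" and e="\<lambda>_ _. 0"])
    (auto intro: has_sum_finiteI)

lemma real_analytic_at_nth: "real_analytic_at (\<lambda>v. v $ i) x"
proof (rule real_analytic_at_groupI[where r=1 and J="UNIV :: bool set"
    and b="\<lambda>b. if b then x $ i else 1" and e="\<lambda>b k. if b then 0 else if k = i then 1 else 0"])
  fix y :: "real^'a"
  have "(\<Prod>k\<in>UNIV. (y $ k - x $ k) ^ (if k = i then 1 else 0)) = y $ i - x $ i"
    by (simp add: if_distrib[of "\<lambda>n. _ ^ n"] cong: if_cong)
  thus "((\<lambda>b. (if b then x $ i else 1) * (\<Prod>k\<in>UNIV. (y $ k - x $ k) ^ (if b then 0 else if k = i then 1 else 0)))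
        has_sum y $ i) UNIV"
    by (intro has_sum_finiteI) (auto simp: UNIV_bool)
qed auto

lemma real_analytic_at_add:
  assumes "real_analytic_at f x" "real_analytic_at g x"
  shows "real_analytic_at (\<lambda>v. f v + g v) x"
proof -
  from assms obtain c r c' r' where r: "0 < r" "0 < r'" and
    c: "\<And>y. (\<And>i. \<bar>y $ i - x $ i\<bar> < r) \<Longrightarrow> ((\<lambda>\<alpha>. c \<alpha> * (\<Prod>i\<in>UNIV. (y $ i - x $ i) ^ \<alpha> i)) has_sum f y) UNIV" and
    c': "\<And>y. (\<And>i. \<bar>y $ i - x $ i\<bar> < r') \<Longrightarrow> ((\<lambda>\<alpha>. c' \<alpha> * (\<Prod>i\<in>UNIV. (y $ i - x $ i) ^ \<alpha> i)) has_sum g y) UNIV"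
    unfolding real_analytic_at_def by blast
  have "((\<lambda>\<alpha>. (c \<alpha> + c' \<alpha>) * (\<Prod>i\<in>UNIV. (y $ i - x $ i) ^ \<alpha> i)) has_sum (f y + g y)) UNIV"
    if "\<And>i. \<bar>y $ i - x $ i\<bar> < min r r'" for y
    using has_sum_add[OF c c'] that by (simp add: distrib_right)
  thus ?thesis
    unfolding real_analytic_at_def using r by (intro exI[of _ "\<lambda>\<alpha>. c \<alpha> + c' \<alpha>"] exI[of _ "min r r'"]) auto
qed

lemma real_analytic_at_mult:
  assumes "real_analytic_at f x" "real_analytic_at g x"
  shows "real_analytic_at (\<lambda>v. f v * g v) x"
proof -
  from assms obtain c r c' r' where r: "0 < r" "0 < r'" and
    c: "\<And>y. (\<And>i. \<bar>y $ i - x $ i\<bar> < r) \<Longrightarrow> ((\<lambda>\<alpha>. c \<alpha> * (\<Prod>i\<in>UNIV. (y $ i - x $ i) ^ \<alpha> i)) has_sum f y) UNIV" and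
    c': "\<And>y. (\<And>i. \<bar>y $ i - x $ i\<bar> < r') \<Longrightarrow> ((\<lambda>\<alpha>. c' \<alpha> * (\<Prod>i\<in>UNIV. (y $ i - x $ i) ^ \<alpha> i)) has_sum g y) UNIV"
    unfolding real_analytic_at_def by blast
  show ?thesis
  proof (rule real_analytic_at_groupI[where r="min r r'" and J="UNIV \<times> UNIV"
        and b="\<lambda>(\<alpha>, \<beta>). c \<alpha> * c' \<beta>" and e="\<lambda>(\<alpha>, \<beta>) i. \<alpha> i + \<beta> i"])
    fix y assume "\<And>i. \<bar>y $ i - x $ i\<bar> < min r r'"
    hence "((\<lambda>(\<alpha>, \<beta>). (c \<alpha> * (\<Prod>i\<in>UNIV. (y $ i - x $ i) ^ \<alpha> i)) * (c' \<beta> * (\<Prod>i\<in>UNIV. (y $ i - x $ i) ^ \<beta> i)))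
       has_sum (f y * g y)) (UNIV \<times> UNIV)"
      by (intro has_sum_mult_real c c') auto
    thus "((\<lambda>p. (case p of (\<alpha>, \<beta>) \<Rightarrow> c \<alpha> * c' \<beta>) * (\<Prod>i\<in>UNIV. (y $ i - x $ i) ^ (case p of (\<alpha>, \<beta>) \<Rightarrow> \<lambda>i. \<alpha> i + \<beta> i) i))
       has_sum (f y * g y)) (UNIV \<times> UNIV)"
      by (rule has_sum_cong[THEN iffD1, rotated]) (auto simp: power_add prod.distrib)
  qed (use r in auto)
qed


text \<open>A power of a series is expanded over words of length \<open>n\<close>, so that no
  multinomial coefficients appear and the convergence stays unconditional.\<close>

lemma has_sum_prod_list_real:
  fixes a :: "'a \<Rightarrow> real"
  assumes "(a has_sum s) UNIV"
  shows "((\<lambda>l. prod_list (map a l)) has_sum s ^ n) {l. length l = n}"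
proof (induction n)
  case 0
  have "{l :: 'a list. length l = 0} = {[]}" by auto
  thus ?case by (auto intro: has_sum_finiteI)
next
  case (Suc n)
  have bij: "bij_betw (\<lambda>(x, l). x # l) (UNIV \<times> {l :: 'a list. length l = n}) {l. length l = Suc n}"
    by (rule bij_betwI[where g="\<lambda>l. (hd l, tl l)"]) (auto simp: length_Suc_conv)
  have "((\<lambda>(x, l). a x * prod_list (map a l)) has_sum (s * s ^ n)) (UNIV \<times> {l. length l = n})"
    by (rule has_sum_mult_real[OF assms Suc])
  thus ?case
    unfolding has_sum_reindex_bij_betw[OF bij, symmetric] by (simp add: case_prod_unfold)
qed

lemma has_sum_prod_PiE_real:
  fixes f :: "'i \<Rightarrow> 'a \<Rightarrow> real"
  assumes "finite I" and "\<And>i. i \<in> I \<Longrightarrow> (f i has_sum s i) (B i)"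
  shows "((\<lambda>g. \<Prod>i\<in>I. f i (g i)) has_sum (\<Prod>i\<in>I. s i)) (PiE I B)"
  using assms
proof (induction I)
  case empty
  show ?case by (auto intro: has_sum_finiteI)
next
  case (insert k I)
  have inj: "inj_on (\<lambda>(y, g). g(k := y)) (B k \<times> PiE I B)"
    using insert.hyps by (intro inj_combinator)
  have "((\<lambda>(y, g). f k y * (\<Prod>i\<in>I. f i (g i))) has_sum (s k * (\<Prod>i\<in>I. s i))) (B k \<times> PiE I B)"
    using insert by (intro has_sum_mult_real) auto
  moreover have "(\<Prod>i\<in>insert k I. f i ((g(k := y)) i)) = f k y * (\<Prod>i\<in>I. f i (g i))" for y g
  proof -
    have "(\<Prod>i\<in>I. f i ((g(k := y)) i)) = (\<Prod>i\<in>I. f i (g i))"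
      using insert.hyps by (intro prod.cong) auto
    thus ?thesis using insert.hyps by simp
  qed
  ultimately show ?case
    unfolding PiE_insert_eq using insert.hyps
    by (subst has_sum_reindex[OF inj]) (simp add: o_def case_prod_unfold del: fun_upd_apply)
qed

text \<open>Substitution into a series of radius \<open>R\<close> needs more than
  \<open>\<bar>f x\<bar> < R\<close>: the sum of the absolute values of all terms must stay below
  \<open>R\<close> on a cube. Shrinking the cube by \<open>\<epsilon>\<close> keeps the constant
  term \<open>f x\<close> and multiplies every other term by at most
  \<open>\<epsilon>\<close>.\<close>

lemma real_analytic_at_small_majorant:
  fixes f :: "real^'n \<Rightarrow> real"
  assumes "real_analytic_at f x" and "\<bar>f x\<bar> < R"
  obtains a \<rho> G where "0 < \<rho>" "G < R"
    "\<And>y. (\<And>i. \<bar>y $ i - x $ i\<bar> < \<rho>) \<Longrightarrow>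
       ((\<lambda>\<alpha>. a \<alpha> * (\<Prod>i\<in>UNIV. (y $ i - x $ i) ^ \<alpha> i)) has_sum f y) UNIV"
    "((\<lambda>\<alpha>. \<bar>a \<alpha>\<bar> * (\<Prod>i\<in>UNIV. \<rho> ^ \<alpha> i)) has_sum G) UNIV"
proof -
  from assms obtain a r where r: "0 < r" and
    a: "\<And>y. (\<And>i. \<bar>y $ i - x $ i\<bar> < r) \<Longrightarrow> ((\<lambda>\<alpha>. a \<alpha> * (\<Prod>i\<in>UNIV. (y $ i - x $ i) ^ \<alpha> i)) has_sum f y) UNIV"
    unfolding real_analytic_at_def by blast
  define y0 where "y0 = (\<chi> i. x $ i + r / 2)"
  have s0: "(\<lambda>\<alpha>. a \<alpha> * (\<Prod>i\<in>UNIV. (r / 2) ^ \<alpha> i)) summable_on UNIV"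
    using a[of y0] r by (auto simp: y0_def has_sum_imp_summable)
  define S where "S = (\<Sum>\<^sub>\<infinity>\<alpha>. \<bar>a \<alpha>\<bar> * (\<Prod>i\<in>UNIV. (r / 2) ^ \<alpha> i))"
  have "(\<lambda>\<alpha>. \<bar>a \<alpha> * (\<Prod>i\<in>UNIV. (r / 2) ^ \<alpha> i)\<bar>) summable_on UNIV"
    by (rule summable_on_abs_real[OF s0])
  hence s1: "((\<lambda>\<alpha>. \<bar>a \<alpha>\<bar> * (\<Prod>i\<in>UNIV. (r / 2) ^ \<alpha> i)) has_sum S) UNIV"
    unfolding S_def using r by (intro has_sum_infsum) (simp add: abs_mult abs_prod power_abs)
  have S0: "0 \<le> S" using s1 by (rule has_sum_nonneg) (use r in \<open>auto intro!: mult_nonneg_nonneg prod_nonneg\<close>)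
  have zero: "(\<Prod>i\<in>UNIV. (0::real) ^ \<alpha> i) = (if \<alpha> = (\<lambda>_. 0) then 1 else 0)" for \<alpha> :: "'n \<Rightarrow> nat"
    by (auto simp: fun_eq_iff prod_zero_iff)
  have e1: "((\<lambda>\<alpha>. a \<alpha> * (if \<alpha> = (\<lambda>_. 0) then 1 else 0)) has_sum f x) UNIV"
    using a[of x] r by (simp add: zero)
  have e2: "((\<lambda>\<alpha>. a \<alpha> * (if \<alpha> = (\<lambda>_. 0) then 1 else 0)) has_sum a (\<lambda>_. 0)) UNIV"
    by (rule has_sum_finite_neutralI[of "{\<lambda>_. 0}"]) auto
  have a0: "a (\<lambda>_. 0) = f x" by (rule has_sum_unique[OF e2 e1])
  \<comment> \<open>\<open>\<epsilon> \<le> 1\<close> gives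
    \<open>\<epsilon> ^ n \<le> \<epsilon>\<close> for \<open>n \<ge> 1\<close>; the quotient keeps
    \<open>\<epsilon> * S\<close> below the margin \<open>R - \<bar>f x\<bar>\<close>.\<close>
  define \<epsilon> where "\<epsilon> = min 1 ((R - \<bar>f x\<bar>) / (2 * (S + 1)))"
  have \<epsilon>: "0 < \<epsilon>" "\<epsilon> \<le> 1" using S0 assms(2) by (auto simp: \<epsilon>_def)
  have "\<epsilon> * S \<le> (R - \<bar>f x\<bar>) / (2 * (S + 1)) * S"
    using S0 by (intro mult_right_mono) (auto simp: \<epsilon>_def)
  also have "\<dots> < R - \<bar>f x\<bar>"
  proof -
    have "(R - \<bar>f x\<bar>) * (S / (2 * (S + 1))) < (R - \<bar>f x\<bar>) * 1"
      using S0 assms(2) by (intro mult_strict_left_mono) (auto simp: field_simps)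
    thus ?thesis by simp
  qed
  finally have \<epsilon>S: "\<bar>f x\<bar> + \<epsilon> * S < R" by simp
  define \<rho> where "\<rho> = \<epsilon> * (r / 2)"
  have "\<epsilon> * (r / 2) \<le> 1 * (r / 2)" using \<epsilon> r by (intro mult_right_mono) auto
  hence \<rho>: "0 < \<rho>" "\<rho> < r" using \<epsilon> r by (auto simp: \<rho>_def)
  define y1 where "y1 = (\<chi> i. x $ i + \<rho>)"
  have "(\<lambda>\<alpha>. a \<alpha> * (\<Prod>i\<in>UNIV. \<rho> ^ \<alpha> i)) summable_on UNIV"
    using a[of y1] \<rho> by (auto simp: y1_def has_sum_imp_summable)
  hence "(\<lambda>\<alpha>. \<bar>a \<alpha> * (\<Prod>i\<in>UNIV. \<rho> ^ \<alpha> i)\<bar>) summable_on UNIV"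
    by (rule summable_on_abs_real)
  hence s2: "(\<lambda>\<alpha>. \<bar>a \<alpha>\<bar> * (\<Prod>i\<in>UNIV. \<rho> ^ \<alpha> i)) summable_on UNIV"
    using \<rho> by (simp add: abs_mult abs_prod power_abs)
  define G where "G = (\<Sum>\<^sub>\<infinity>\<alpha>. \<bar>a \<alpha>\<bar> * (\<Prod>i\<in>UNIV. \<rho> ^ \<alpha> i))"
  have G: "((\<lambda>\<alpha>. \<bar>a \<alpha>\<bar> * (\<Prod>i\<in>UNIV. \<rho> ^ \<alpha> i)) has_sum G) UNIV"
    unfolding G_def by (rule has_sum_infsum[OF s2])
  have d0: "((\<lambda>\<alpha>. \<bar>f x\<bar> * (if \<alpha> = (\<lambda>_. 0) then 1 else 0)) has_sum \<bar>f x\<bar>) UNIV"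
    by (rule has_sum_finite_neutralI[of "{\<lambda>_. 0}"]) auto
  have "G \<le> \<bar>f x\<bar> + \<epsilon> * S"
  proof (rule has_sum_mono[OF G has_sum_add[OF d0 has_sum_cmult_right[OF s1]]])
    fix \<alpha> :: "'n \<Rightarrow> nat"
    show "\<bar>a \<alpha>\<bar> * (\<Prod>i\<in>UNIV. \<rho> ^ \<alpha> i)
      \<le> \<bar>f x\<bar> * (if \<alpha> = (\<lambda>_. 0) then 1 else 0) + \<epsilon> * (\<bar>a \<alpha>\<bar> * (\<Prod>i\<in>UNIV. (r / 2) ^ \<alpha> i))"
    proof (cases "\<alpha> = (\<lambda>_. 0)")
      case True
      thus ?thesis using \<epsilon> a0 by auto
    next
      case False
      then obtain k where "\<alpha> k \<noteq> 0" by (auto simp: fun_eq_iff)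
      hence "1 \<le> (\<Sum>i\<in>UNIV. \<alpha> i)"
        by (metis One_nat_def Suc_leI UNIV_I finite sum_eq_0_iff zero_less_iff_neq_zero)
      hence "(\<Prod>i\<in>UNIV. \<epsilon> ^ \<alpha> i) \<le> \<epsilon>"
        using power_decreasing[of 1 "\<Sum>i\<in>UNIV. \<alpha> i" \<epsilon>] \<epsilon> by (simp add: power_sum)
      hence "(\<Prod>i\<in>UNIV. \<rho> ^ \<alpha> i) \<le> \<epsilon> * (\<Prod>i\<in>UNIV. (r / 2) ^ \<alpha> i)"
        unfolding \<rho>_def power_mult_distrib prod.distrib using r
        by (intro mult_right_mono prod_nonneg) auto
      hence "\<bar>a \<alpha>\<bar> * (\<Prod>i\<in>UNIV. \<rho> ^ \<alpha> i) \<le> \<bar>a \<alpha>\<bar> * (\<epsilon> * (\<Prod>i\<in>UNIV. (r / 2) ^ \<alpha> i))"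
        by (intro mult_left_mono) auto
      thus ?thesis using False by (simp add: mult_ac)
    qed
  qed
  hence "G < R" using \<epsilon>S by linarith
  thus ?thesis
    using \<rho> G by (intro that[of \<rho> G a] a) (auto intro: less_trans)
qed


lemma prod_list_mult_distrib:
  fixes a b :: "'a \<Rightarrow> 'b::comm_monoid_mult"
  shows "prod_list (map (\<lambda>x. a x * b x) l) = prod_list (map a l) * prod_list (map b l)"
  by (induction l) (auto simp: ac_simps)

lemma prod_list_prod_power:
  fixes z :: "'n::finite \<Rightarrow> real"
  shows "prod_list (map (\<lambda>\<alpha>. \<Prod>k\<in>UNIV. z k ^ \<alpha> k) l) = (\<Prod>k\<in>UNIV. z k ^ sum_list (map (\<lambda>\<alpha>. \<alpha> k) l))"
  by (induction l) (auto simp: power_add prod.distrib)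

lemma abs_prod_list_le:
  fixes a b :: "'a \<Rightarrow> real"
  assumes "\<And>x. \<bar>a x\<bar> \<le> b x"
  shows "\<bar>prod_list (map a l)\<bar> \<le> prod_list (map b l)"
proof (induction l)
  case (Cons x l)
  have "0 \<le> b x" using assms[of x] by linarith
  thus ?case
    using Cons assms[of x] by (auto simp: abs_mult intro!: mult_mono)
qed auto

text \<open>The composite is expanded over families \<open>L\<close> with one word of inner
  multi-indices for each outer variable; the word lengths form the outer multi-index. Absolute
  summability is tested at the outer point \<open>p + G\<close>, where the outer series converges
  because \<open>G i < R\<close>.\<close>

lemma real_analytic_at_compose:
  fixes f :: "real^'m \<Rightarrow> real" and \<phi> :: "real^'n \<Rightarrow> real^'m"
  assumes R: "R > 0"
    and f: "\<And>y. (\<And>i. \<bar>y $ i - p $ i\<bar> < R) \<Longrightarrow>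
      ((\<lambda>\<beta>. c \<beta> * (\<Prod>i\<in>UNIV. (y $ i - p $ i) ^ \<beta> i)) has_sum f y) UNIV"
    and \<phi>: "\<And>i. real_analytic_at (\<lambda>u. \<phi> u $ i) u"
    and near: "\<And>i. \<bar>\<phi> u $ i - p $ i\<bar> < R"
  shows "real_analytic_at (\<lambda>u. f (\<phi> u)) u"
proof -
  define Q where "Q i a \<rho> G \<longleftrightarrow> 0 < \<rho> \<and> G < R \<and>
    (\<forall>y. (\<forall>k. \<bar>y $ k - u $ k\<bar> < \<rho>) \<longrightarrow>
       ((\<lambda>\<alpha>. a \<alpha> * (\<Prod>k\<in>UNIV. (y $ k - u $ k) ^ \<alpha> k)) has_sum (\<phi> y $ i - p $ i)) UNIV) \<and>
    ((\<lambda>\<alpha>. \<bar>a \<alpha>\<bar> * (\<Prod>k\<in>UNIV. \<rho> ^ \<alpha> k)) has_sum G) UNIV" for i a \<rho> G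
  have "\<exists>a \<rho> G. Q i a \<rho> G" for i
  proof -
    have "real_analytic_at (\<lambda>u. \<phi> u $ i + (- p $ i)) u"
      by (rule real_analytic_at_add[OF \<phi> real_analytic_at_const])
    hence "real_analytic_at (\<lambda>u. \<phi> u $ i - p $ i) u" by simp
    thus ?thesis
    proof (rule real_analytic_at_small_majorant[where f="\<lambda>u. \<phi> u $ i - p $ i", OF _ near[of i]])
      fix a \<rho> G
      assume "0 < \<rho>" "G < R"
      and "\<And>y. (\<And>k. \<bar>y $ k - u $ k\<bar> < \<rho>) \<Longrightarrow>
         ((\<lambda>\<alpha>. a \<alpha> * (\<Prod>k\<in>UNIV. (y $ k - u $ k) ^ \<alpha> k)) has_sum (\<phi> y $ i - p $ i)) UNIV"
      "((\<lambda>\<alpha>. \<bar>a \<alpha>\<bar> * (\<Prod>k\<in>UNIV. \<rho> ^ \<alpha> k)) has_sum G) UNIV"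
      hence "Q i a \<rho> G" unfolding Q_def by simp
      thus "\<exists>a \<rho> G. Q i a \<rho> G" by blast
    qed
  qed
  then have "\<exists>a \<rho> G. \<forall>i. Q i (a i) (\<rho> i) (G i)" by metis
  then obtain a \<rho> G where Q: "\<And>i. Q i (a i) (\<rho> i) (G i)" by blast
  have \<rho>: "\<And>i. 0 < \<rho> i" and GR: "\<And>i. G i < R" and
    a: "\<And>i y. (\<And>k. \<bar>y $ k - u $ k\<bar> < \<rho> i) \<Longrightarrow>
       ((\<lambda>\<alpha>. a i \<alpha> * (\<Prod>k\<in>UNIV. (y $ k - u $ k) ^ \<alpha> k)) has_sum (\<phi> y $ i - p $ i)) UNIV" and
    G: "\<And>i. ((\<lambda>\<alpha>. \<bar>a i \<alpha>\<bar> * (\<Prod>k\<in>UNIV. \<rho> i ^ \<alpha> k)) has_sum G i) UNIV"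
    using Q unfolding Q_def by blast+
  define r where "r = Min (range \<rho>)"
  have r: "0 < r" "\<And>i. r \<le> \<rho> i"
    using \<rho> by (auto simp: r_def)
  define Ls where "Ls \<beta> = {L :: 'm \<Rightarrow> ('n \<Rightarrow> nat) list. \<forall>i. length (L i) = \<beta> i}" for \<beta>
  have Ls_PiE: "Ls \<beta> = PiE UNIV (\<lambda>i. {l. length l = \<beta> i})" for \<beta>
    by (auto simp: Ls_def)
  have bij: "bij_betw (\<lambda>L. (\<lambda>i. length (L i), L)) UNIV (Sigma UNIV Ls)"
    by (rule bij_betwI[where g=snd]) (auto simp: Ls_def)
  have inner: "((\<lambda>L. c \<beta> * (\<Prod>i\<in>UNIV. prod_list (map (t i) (L i)))) has_sum (c \<beta> * (\<Prod>i\<in>UNIV. s i ^ \<beta> i))) (Ls \<beta>)"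
    if "\<And>i. (t i has_sum s i) UNIV" for t s \<beta> and c :: "('m \<Rightarrow> nat) \<Rightarrow> real"
    unfolding Ls_PiE by (intro has_sum_cmult_right has_sum_prod_PiE_real has_sum_prod_list_real that) auto
  have G0: "0 \<le> G i" for i
    using G[of i] by (rule has_sum_nonneg) (use \<rho>[of i] in \<open>auto intro!: mult_nonneg_nonneg prod_nonneg\<close>)
  define tp where "tp i \<alpha> = \<bar>a i \<alpha>\<bar> * (\<Prod>k\<in>UNIV. \<rho> i ^ \<alpha> k)" for i \<alpha>
  have tp0: "0 \<le> tp i \<alpha>" for i \<alpha>
    using \<rho>[of i] by (auto simp: tp_def intro!: mult_nonneg_nonneg prod_nonneg)
  have sp: "(\<lambda>(\<beta>, L). \<bar>c \<beta>\<bar> * (\<Prod>i\<in>UNIV. prod_list (map (tp i) (L i)))) summable_on (Sigma UNIV Ls)"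
  proof (rule summable_on_SigmaI)
    show "((\<lambda>L. case (\<beta>, L) of (\<beta>, L) \<Rightarrow> \<bar>c \<beta>\<bar> * (\<Prod>i\<in>UNIV. prod_list (map (tp i) (L i))))
       has_sum (\<bar>c \<beta>\<bar> * (\<Prod>i\<in>UNIV. G i ^ \<beta> i))) (Ls \<beta>)" for \<beta>
      using inner[of tp G "\<lambda>\<beta>. \<bar>c \<beta>\<bar>" \<beta>] G by (simp add: tp_def[abs_def])
    define y where "y = (\<chi> i. p $ i + G i)"
    have "(\<lambda>\<beta>. c \<beta> * (\<Prod>i\<in>UNIV. G i ^ \<beta> i)) summable_on UNIV"
      using f[of y] G0 GR by (auto simp: y_def has_sum_imp_summable)
    from summable_on_abs_real[OF this]
    show "(\<lambda>\<beta>. \<bar>c \<beta>\<bar> * (\<Prod>i\<in>UNIV. G i ^ \<beta> i)) summable_on UNIV"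
      using G0 by (simp add: abs_mult abs_prod power_abs)
  qed (auto intro!: mult_nonneg_nonneg prod_nonneg prod_list_nonneg tp0)
  show ?thesis
  proof (rule real_analytic_at_groupI[where r=r and J=UNIV
      and b="\<lambda>L. c (\<lambda>i. length (L i)) * (\<Prod>i\<in>UNIV. prod_list (map (a i) (L i)))"
      and e="\<lambda>L k. \<Sum>i\<in>UNIV. sum_list (map (\<lambda>\<alpha>. \<alpha> k) (L i))"])
    show "r > 0" by (rule r)
    fix y assume y: "\<And>i. \<bar>y $ i - u $ i\<bar> < r"
    define t where "t i \<alpha> = a i \<alpha> * (\<Prod>k\<in>UNIV. (y $ k - u $ k) ^ \<alpha> k)" for i \<alpha>
    have t: "(t i has_sum (\<phi> y $ i - p $ i)) UNIV" for i
      unfolding t_def using a[of y i] y r by (meson less_le_trans)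
    have ttp: "\<bar>t i \<alpha>\<bar> \<le> tp i \<alpha>" for i \<alpha>
      unfolding t_def tp_def abs_mult abs_prod power_abs
      using y r \<rho> by (intro mult_left_mono prod_mono conjI power_mono) (auto intro: less_imp_le less_le_trans)
    have near': "\<bar>\<phi> y $ i - p $ i\<bar> < R" for i
    proof -
      have "((\<lambda>\<alpha>. \<bar>t i \<alpha>\<bar>) has_sum (\<Sum>\<^sub>\<infinity>\<alpha>. \<bar>t i \<alpha>\<bar>)) UNIV"
        by (intro has_sum_infsum summable_on_abs_real has_sum_imp_summable[OF t])
      moreover have "\<bar>\<phi> y $ i - p $ i\<bar> \<le> (\<Sum>\<^sub>\<infinity>\<alpha>. \<bar>t i \<alpha>\<bar>)"
        using norm_has_sum_bound[OF _ t, of i] calculation by (simp add: has_sum_imp_summable)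
      moreover have "(\<Sum>\<^sub>\<infinity>\<alpha>. \<bar>t i \<alpha>\<bar>) \<le> G i"
        by (rule has_sum_mono[OF calculation(1) G[of i, folded tp_def]]) (rule ttp)
      ultimately show ?thesis using GR[of i] by linarith
    qed
    have "(\<lambda>(\<beta>, L). c \<beta> * (\<Prod>i\<in>UNIV. prod_list (map (t i) (L i)))) summable_on (Sigma UNIV Ls)"
    proof (rule abs_summable_summable, rule summable_on_comparison_test[OF sp])
      fix bL assume "bL \<in> Sigma UNIV Ls"
      show "norm (case bL of (\<beta>, L) \<Rightarrow> c \<beta> * (\<Prod>i\<in>UNIV. prod_list (map (t i) (L i))))
        \<le> (case bL of (\<beta>, L) \<Rightarrow> \<bar>c \<beta>\<bar> * (\<Prod>i\<in>UNIV. prod_list (map (tp i) (L i))))"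
        by (auto simp: abs_mult abs_prod split: prod.split
            intro!: mult_left_mono prod_mono abs_prod_list_le ttp)
    qed auto
    hence "((\<lambda>(\<beta>, L). c \<beta> * (\<Prod>i\<in>UNIV. prod_list (map (t i) (L i)))) has_sum f (\<phi> y)) (Sigma UNIV Ls)"
    proof (rule has_sum_SigmaI[rotated 2, where g="\<lambda>\<beta>. c \<beta> * (\<Prod>i\<in>UNIV. (\<phi> y $ i - p $ i) ^ \<beta> i)"])
      show "((\<lambda>L. case (\<beta>, L) of (\<beta>, L) \<Rightarrow> c \<beta> * (\<Prod>i\<in>UNIV. prod_list (map (t i) (L i))))
         has_sum (c \<beta> * (\<Prod>i\<in>UNIV. (\<phi> y $ i - p $ i) ^ \<beta> i))) (Ls \<beta>)" for \<beta>
        using inner[of t "\<lambda>i. \<phi> y $ i - p $ i" c \<beta>] t by simp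
      show "((\<lambda>\<beta>. c \<beta> * (\<Prod>i\<in>UNIV. (\<phi> y $ i - p $ i) ^ \<beta> i)) has_sum f (\<phi> y)) UNIV"
        by (rule f[OF near'])
    qed
    hence "((\<lambda>L. c (\<lambda>i. length (L i)) * (\<Prod>i\<in>UNIV. prod_list (map (t i) (L i)))) has_sum f (\<phi> y)) UNIV"
      unfolding has_sum_reindex_bij_betw[OF bij, symmetric] by simp
    moreover have "(\<Prod>i\<in>UNIV. prod_list (map (t i) (L i))) =
       (\<Prod>i\<in>UNIV. prod_list (map (a i) (L i))) *
       (\<Prod>k\<in>UNIV. (y $ k - u $ k) ^ (\<Sum>i\<in>UNIV. sum_list (map (\<lambda>\<alpha>. \<alpha> k) (L i))))" for L :: "'m \<Rightarrow> ('n \<Rightarrow> nat) list"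
      unfolding t_def prod_list_mult_distrib prod_list_prod_power prod.distrib power_sum
      by (subst (2) prod.swap) simp
    ultimately show "((\<lambda>L. c (\<lambda>i. length (L i)) * (\<Prod>i\<in>UNIV. prod_list (map (a i) (L i))) *
        (\<Prod>k\<in>UNIV. (y $ k - u $ k) ^ (\<Sum>i\<in>UNIV. sum_list (map (\<lambda>\<alpha>. \<alpha> k) (L i))))) has_sum f (\<phi> y)) UNIV"
      by (simp add: mult.assoc)
  qed
qed

lemma real_analytic_at_comp:
  fixes f :: "real^'m \<Rightarrow> real" and \<phi> :: "real^'n \<Rightarrow> real^'m"
  assumes "real_analytic_at f (\<phi> u)" and "\<And>i. real_analytic_at (\<lambda>u. \<phi> u $ i) u"
  shows "real_analytic_at (\<lambda>u. f (\<phi> u)) u"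
proof -
  from assms(1) obtain c r where r: "0 < r" and
    c: "\<And>y. (\<And>i. \<bar>y $ i - \<phi> u $ i\<bar> < r) \<Longrightarrow> ((\<lambda>\<alpha>. c \<alpha> * (\<Prod>i\<in>UNIV. (y $ i - \<phi> u $ i) ^ \<alpha> i)) has_sum f y) UNIV"
    unfolding real_analytic_at_def by blast
  show ?thesis
    by (rule real_analytic_at_compose[where f=f and \<phi>=\<phi> and u=u and R=r and p="\<phi> u" and c=c])
      (use r in \<open>auto intro: c assms(2)\<close>)
qed

text \<open>A function of one variable is treated as a function on \<open>real^unit\<close>, which
  makes this an instance of the composition in several variables.\<close>

lemma real_analytic_at_power_series_comp:
  fixes e :: "nat \<Rightarrow> real" and f :: "real^'n \<Rightarrow> real"
  assumes R: "R > 0" and h: "\<And>z. \<bar>z - zc\<bar> < R \<Longrightarrow> ((\<lambda>n. e n * (z - zc) ^ n) has_sum h z) UNIV"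
    and f: "real_analytic_at f u" and near: "\<bar>f u - zc\<bar> < R"
  shows "real_analytic_at (\<lambda>u. h (f u)) u"
proof -
  define c where "c \<beta> = e (\<beta> ())" for \<beta>
  have bij: "bij_betw (\<lambda>\<beta>::unit \<Rightarrow> nat. \<beta> ()) UNIV UNIV"
    by (rule bij_betwI[where g="\<lambda>n _. n"]) auto
  have "real_analytic_at (\<lambda>u. (\<lambda>y :: real^unit. h (y $ ())) ((\<lambda>u. \<chi> _. f u) u)) u"
  proof (rule real_analytic_at_compose[where R=R and p="\<chi> _. zc" and c=c])
    fix y :: "real^unit" assume "\<And>i. \<bar>y $ i - (\<chi> _. zc) $ i\<bar> < R"
    hence "((\<lambda>n. e n * (y $ () - zc) ^ n) has_sum h (y $ ())) UNIV"
      by (intro h) auto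
    thus "((\<lambda>\<beta>. c \<beta> * (\<Prod>i\<in>UNIV. (y $ i - (\<chi> _. zc) $ i) ^ \<beta> i)) has_sum h (y $ ())) UNIV"
      unfolding has_sum_reindex_bij_betw[OF bij, symmetric] by (simp add: c_def UNIV_unit)
  qed (use assms in auto)
  thus ?thesis by simp
qed

lemma has_sum_real_absI:
  fixes f :: "nat \<Rightarrow> real"
  assumes "summable (\<lambda>n. \<bar>f n\<bar>)" and "f sums s"
  shows "(f has_sum s) UNIV"
  using norm_summable_imp_has_sum[of f s] assms by simp

lemma real_analytic_at_inverse:
  fixes f :: "real^'n \<Rightarrow> real"
  assumes f: "real_analytic_at f u" and nz: "f u \<noteq> 0"
  shows "real_analytic_at (\<lambda>u. inverse (f u)) u"
proof (rule real_analytic_at_power_series_comp[where h=inverse and f=f and zc="f u" and R="\<bar>f u\<bar>" and e="\<lambda>n. (-1) ^ n / f u ^ Suc n"])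
  fix z assume z: "\<bar>z - f u\<bar> < \<bar>f u\<bar>"
  define w where "w = - (z - f u) / f u"
  have w: "norm w < 1" using z nz by (simp add: w_def abs_minus_commute)
  have "z \<noteq> 0" using z by auto
  have "(\<lambda>n. w ^ n * inverse (f u)) sums (1 / (1 - w) * inverse (f u))"
    by (intro sums_mult2 geometric_sums w)
  moreover have "1 / (1 - w) * inverse (f u) = inverse z"
    using nz \<open>z \<noteq> 0\<close> by (simp add: w_def field_simps)
  moreover have "w ^ n * inverse (f u) = (-1) ^ n / f u ^ Suc n * (z - f u) ^ n" for n
  proof -
    have "w = (-1) * (z - f u) / f u" by (simp add: w_def)
    thus ?thesis by (simp only: power_divide power_mult_distrib) (simp add: field_simps)
  qed
  moreover have "summable (\<lambda>n. \<bar>w ^ n * inverse (f u)\<bar>)"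
    unfolding abs_mult power_abs using w by (intro summable_mult2 summable_geometric) auto
  ultimately show "((\<lambda>n. (-1) ^ n / f u ^ Suc n * (z - f u) ^ n) has_sum inverse z) UNIV"
    by (intro has_sum_real_absI) auto
qed (use assms in auto)

lemma real_analytic_at_uminus: "real_analytic_at f x \<Longrightarrow> real_analytic_at (\<lambda>v. - f v) x"
  using real_analytic_at_mult[OF real_analytic_at_const[of "-1"]] by fastforce

lemma real_analytic_at_diff:
  "real_analytic_at f x \<Longrightarrow> real_analytic_at g x \<Longrightarrow> real_analytic_at (\<lambda>v. f v - g v) x"
  using real_analytic_at_add[OF _ real_analytic_at_uminus, of f x g] by simp

lemma real_analytic_at_divide:
  "real_analytic_at f x \<Longrightarrow> real_analytic_at g x \<Longrightarrow> g x \<noteq> 0 \<Longrightarrow> real_analytic_at (\<lambda>v. f v / g v) x"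
  unfolding divide_inverse by (intro real_analytic_at_mult real_analytic_at_inverse)

lemma real_analytic_at_power: "real_analytic_at f x \<Longrightarrow> real_analytic_at (\<lambda>v. f v ^ n) x"
  by (induction n) (auto intro: real_analytic_at_const real_analytic_at_mult)

lemma real_analytic_at_sum:
  "(\<And>i. i \<in> I \<Longrightarrow> real_analytic_at (f i) x) \<Longrightarrow> real_analytic_at (\<lambda>v. \<Sum>i\<in>I. f i v) x"
  by (induction I rule: infinite_finite_induct)
    (auto intro: real_analytic_at_const real_analytic_at_add)

lemma real_analytic_at_poly:
  "real_analytic_at f x \<Longrightarrow> real_analytic_at (\<lambda>v. poly p (f v)) x"
  by (induction p) (auto intro: real_analytic_at_const real_analytic_at_add real_analytic_at_mult)

lemma real_analytic_at_cong:
  assumes f: "real_analytic_at f x" and S: "open S" "x \<in> S" and eq: "\<And>y. y \<in> S \<Longrightarrow> f y = g y"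
  shows "real_analytic_at g x"
proof -
  from f obtain c r where r: "0 < r" and
    c: "\<And>y. (\<And>i. \<bar>y $ i - x $ i\<bar> < r) \<Longrightarrow> ((\<lambda>\<alpha>. c \<alpha> * (\<Prod>i\<in>UNIV. (y $ i - x $ i) ^ \<alpha> i)) has_sum f y) UNIV"
    unfolding real_analytic_at_def by blast
  obtain d where d: "0 < d" "ball x d \<subseteq> S" using S open_contains_ball by blast
  define r' where "r' = min r (d / CARD('a))"
  have "y \<in> S" if "\<And>i. \<bar>y $ i - x $ i\<bar> < r'" for y
  proof -
    have "norm (y - x) \<le> (\<Sum>i\<in>UNIV. \<bar>(y - x) $ i\<bar>)" by (rule norm_le_l1_cart)
    also have "\<dots> < (\<Sum>i\<in>(UNIV::'a set). d / CARD('a))"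
      using that by (intro sum_strict_mono) (auto simp: r'_def)
    also have "\<dots> = d" by simp
    finally show ?thesis using d by (auto simp: dist_norm norm_minus_commute)
  qed
  thus ?thesis
    unfolding real_analytic_at_def using c r d eq
    by (intro exI[of _ c] exI[of _ r']) (force simp: r'_def)
qed

lemmas real_analytic_intros =
  real_analytic_at_const real_analytic_at_nth real_analytic_at_add real_analytic_at_diff
  real_analytic_at_mult real_analytic_at_uminus real_analytic_at_divide real_analytic_at_power
  real_analytic_at_sum real_analytic_at_poly

section \<open>The iterated blow-up\<close>

text \<open>A point of the blow-up has homogeneous coordinates \<open>(t1, t2, c)\<close>, where \<open>t1 = 0\<close> and \<open>t2 = 0\<close> are
  the two exceptional divisors and \<open>x = t1 t2^2 c\<close>, \<open>d = t1 t2 c\<close>; the torus acts by rescaling. It is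
  embedded into \<open>nat \<Rightarrow> real\<close> by its image \<open>v\<close> and by the projections onto the lines spanned by
  \<open>z = (t2 c\<^sub>x, c\<^sub>d)\<close> and \<open>y = (c\<^sub>x, t1 c\<^sub>d^2)\<close>, whose entries are invariant and bounded. The charts normalise
  one or two of the entries of \<open>c\<close> to 1: \<open>ChartX\<close> lies in the complement of \<open>t2 = 0\<close>, \<open>ChartD\<close> lies in the
  complement of \<open>t1 = 0\<close>, and \<open>ChartXD\<close> contains the intersection of the two divisors.\<close>

type_synonym 'n blowup_coord = "'n + ('n \<times> 'n) + ('n \<times> 'n)"

datatype 'n blowup_chart = ChartX 'n | ChartD 'n | ChartXD 'n 'n

fun chart_t1 :: "'n::finite blowup_chart \<Rightarrow> real^'n \<Rightarrow> real" where
  "chart_t1 (ChartX i) u = u $ i"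
| "chart_t1 (ChartD j) u = 1"
| "chart_t1 (ChartXD i j) u = u $ j"

fun chart_t2 :: "'n::finite blowup_chart \<Rightarrow> real^'n \<Rightarrow> real" where
  "chart_t2 (ChartX i) u = 1"
| "chart_t2 (ChartD j) u = u $ j"
| "chart_t2 (ChartXD i j) u = u $ i"

fun chart_pivots :: "'n blowup_chart \<Rightarrow> 'n set" where
  "chart_pivots (ChartX i) = {i}"
| "chart_pivots (ChartD j) = {j}"
| "chart_pivots (ChartXD i j) = {i, j}"

definition chart_c :: "'n::finite blowup_chart \<Rightarrow> real^'n \<Rightarrow> real^'n" where
  "chart_c ch u = (\<chi> l. if l \<in> chart_pivots ch then 1 else u $ l)"

definition coord_v :: "(nat \<Rightarrow> real) \<Rightarrow> real^'n::finite" where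
  "coord_v p = (\<chi> l. p (to_nat (Inl l :: 'n blowup_coord)))"

definition coord_z :: "(nat \<Rightarrow> real) \<Rightarrow> 'n::finite \<Rightarrow> 'n \<Rightarrow> real" where
  "coord_z p l m = p (to_nat (Inr (Inl (l, m)) :: 'n blowup_coord))"

definition coord_y :: "(nat \<Rightarrow> real) \<Rightarrow> 'n::finite \<Rightarrow> 'n \<Rightarrow> real" where
  "coord_y p l m = p (to_nat (Inr (Inr (l, m)) :: 'n blowup_coord))"

text \<open>An entry of a line can serve as pivot when the corresponding diagonal entry of the
  projection matrix is nonzero. In \<open>ChartX i\<close> the condition on \<open>z\<close> covers
  \<open>y\<close> as well: the entry \<open>t2 * c $ i\<close> of \<open>z\<close> is nonzero only
  if the entry \<open>c $ i\<close> of \<open>y\<close> is.\<close>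

fun chart_dom :: "'n::finite blowup_chart \<Rightarrow> (nat \<Rightarrow> real) \<Rightarrow> bool" where
  "chart_dom (ChartX i) p = (coord_z p i i \<noteq> 0)"
| "chart_dom (ChartD j) p = (coord_z p j j \<noteq> 0 \<and> coord_y p j j \<noteq> 0)"
| "chart_dom (ChartXD i j) p = (coord_z p j j \<noteq> 0 \<and> coord_y p i i \<noteq> 0)"

locale weighted_centre =
  fixes X D :: "'n::finite set"
  assumes disj: "X \<inter> D = {}" and X_ne: "X \<noteq> {}"
begin

definition vpt :: "real \<Rightarrow> real \<Rightarrow> real^'n \<Rightarrow> real^'n" where
  "vpt t1 t2 c = (\<chi> l. if l \<in> X then t1 * t2\<^sup>2 * c $ l else if l \<in> D then t1 * t2 * c $ l else c $ l)"

definition zpt :: "real \<Rightarrow> real^'n \<Rightarrow> 'n \<Rightarrow> real" where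
  "zpt t2 c l = (if l \<in> X then t2 * c $ l else if l \<in> D then c $ l else 0)"

definition ypt :: "real \<Rightarrow> real^'n \<Rightarrow> 'n \<Rightarrow> real" where
  "ypt t1 c l = (if l \<in> X then c $ l else if l \<in> D then t1 * (c $ l)\<^sup>2 else 0)"

text \<open>Removes the irrelevant locus of the homogeneous coordinates, where one of the two lines
  is undefined.\<close>

definition adm :: "real \<Rightarrow> real \<Rightarrow> real^'n \<Rightarrow> bool" where
  "adm t1 t2 c \<longleftrightarrow> (\<exists>l. zpt t2 c l \<noteq> 0) \<and> (\<exists>l. ypt t1 c l \<noteq> 0)"

definition nrm :: "('n \<Rightarrow> real) \<Rightarrow> real" where "nrm z = (\<Sum>l\<in>UNIV. (z l)\<^sup>2)"

definition emb :: "real \<Rightarrow> real \<Rightarrow> real^'n \<Rightarrow> nat \<Rightarrow> real" where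
  "emb t1 t2 c k = (case (from_nat k :: 'n blowup_coord) of
      Inl l \<Rightarrow> vpt t1 t2 c $ l
    | Inr (Inl (l, m)) \<Rightarrow> zpt t2 c l * zpt t2 c m / nrm (zpt t2 c)
    | Inr (Inr (l, m)) \<Rightarrow> ypt t1 c l * ypt t1 c m / nrm (ypt t1 c))"

lemma coord_emb [simp]:
  "coord_v (emb t1 t2 c) = vpt t1 t2 c"
  "coord_z (emb t1 t2 c) l m = zpt t2 c l * zpt t2 c m / nrm (zpt t2 c)"
  "coord_y (emb t1 t2 c) l m = ypt t1 c l * ypt t1 c m / nrm (ypt t1 c)"
  by (simp_all add: coord_v_def coord_z_def coord_y_def emb_def vec_eq_iff)

lemma nrm_pos: "z l \<noteq> 0 \<Longrightarrow> 0 < nrm z"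
  unfolding nrm_def by (rule sum_pos2[of _ l]) auto

lemma nrm_scale: "nrm (\<lambda>l. a * z l) = a\<^sup>2 * nrm z"
  by (simp add: nrm_def sum_distrib_left power_mult_distrib)

lemma adm_nrm: "adm t1 t2 c \<Longrightarrow> 0 < nrm (zpt t2 c)" "adm t1 t2 c \<Longrightarrow> 0 < nrm (ypt t1 c)"
  unfolding adm_def using nrm_pos by blast+

text \<open>The torus fixes \<open>v\<close> and multiplies \<open>z\<close> and \<open>y\<close> by
  nonzero scalars, which projection matrices do not see.\<close>

lemma emb_cong:
  assumes "vpt t1 t2 c = vpt t1' t2' c'"
    and a: "a \<noteq> 0" "\<And>l. zpt t2' c' l = a * zpt t2 c l"
    and b: "b \<noteq> 0" "\<And>l. ypt t1' c' l = b * ypt t1 c l"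
  shows "emb t1 t2 c = emb t1' t2' c'"
proof
  fix k
  have "zpt t2' c' = (\<lambda>l. a * zpt t2 c l)" "ypt t1' c' = (\<lambda>l. b * ypt t1 c l)"
    using a b by auto
  thus "emb t1 t2 c k = emb t1' t2' c' k"
    using assms by (auto simp: emb_def nrm_scale power2_eq_square split: sum.split)
qed

text \<open>Entries in one column of a projection matrix are in the ratio of the homogeneous
  coordinates; this recovers affine coordinates from the embedded point.\<close>

lemma ratio:
  assumes "z i \<noteq> 0"
  shows "z l * z i / nrm z / (z i * z i / nrm z) = z l / z i"
  using nrm_pos[of z i] assms by simp

fun valid :: "'n blowup_chart \<Rightarrow> bool" where
  "valid (ChartX i) = (i \<in> X)"
| "valid (ChartD j) = (j \<in> D)"
| "valid (ChartXD i j) = (i \<in> X \<and> j \<in> D)"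

definition par :: "'n blowup_chart \<Rightarrow> real^'n \<Rightarrow> nat \<Rightarrow> real" where
  "par ch u = emb (chart_t1 ch u) (chart_t2 ch u) (chart_c ch u)"

definition parv :: "'n blowup_chart \<Rightarrow> real^'n \<Rightarrow> real^'n" where
  "parv ch u = vpt (chart_t1 ch u) (chart_t2 ch u) (chart_c ch u)"

text \<open>Each chart normalises the pivot entries of \<open>z\<close> and \<open>y\<close> to 1,
  so the ratio to a pivot entry is the coordinate itself. In \<open>ChartXD i j\<close>,
  \<open>t2\<close> is the entry \<open>i\<close> of \<open>z\<close> and \<open>t1\<close> the
  entry \<open>j\<close> of \<open>y\<close>; in the other charts the remaining one of
  \<open>t1\<close>, \<open>t2\<close> is an entry of \<open>v\<close>.\<close>

fun chart_fun_nth :: "'n blowup_chart \<Rightarrow> (nat \<Rightarrow> real) \<Rightarrow> 'n \<Rightarrow> real" where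
  "chart_fun_nth (ChartX i) p l =
     (if l = i then coord_v p $ l else if l \<in> X \<union> D then coord_z p l i / coord_z p i i else coord_v p $ l)"
| "chart_fun_nth (ChartD j) p l =
     (if l = j then coord_v p $ l else if l \<in> D then coord_z p l j / coord_z p j j
      else if l \<in> X then coord_y p l j / coord_y p j j else coord_v p $ l)"
| "chart_fun_nth (ChartXD i j) p l =
     (if l = i then coord_z p i j / coord_z p j j else if l = j then coord_y p j i / coord_y p i i
      else if l \<in> D then coord_z p l j / coord_z p j j
      else if l \<in> X then coord_y p l i / coord_y p i i else coord_v p $ l)"

definition chart_fun :: "'n blowup_chart \<Rightarrow> (nat \<Rightarrow> real) \<Rightarrow> real^'n" where
  "chart_fun ch p = (\<chi> l. chart_fun_nth ch p l)"

lemma coord_v_par [simp]: "coord_v (par ch u) = parv ch u"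
  by (simp add: par_def parv_def)

lemma adm_chart:
  assumes "valid ch"
  shows "adm (chart_t1 ch u) (chart_t2 ch u) (chart_c ch u)"
proof (cases ch)
  case (ChartX i)
  thus ?thesis using assms disj
    by (auto simp: adm_def zpt_def ypt_def chart_c_def intro!: exI[of _ i])
next
  case (ChartD j)
  thus ?thesis using assms disj
    by (auto simp: adm_def zpt_def ypt_def chart_c_def intro!: exI[of _ j])
next
  case (ChartXD i j)
  hence "zpt (chart_t2 ch u) (chart_c ch u) j \<noteq> 0" "ypt (chart_t1 ch u) (chart_c ch u) i \<noteq> 0"
    using assms disj by (auto simp: zpt_def ypt_def chart_c_def)
  thus ?thesis unfolding adm_def by blast
qed

lemma chart_dom_par: "valid ch \<Longrightarrow> chart_dom ch (par ch u)"
  using adm_nrm[OF adm_chart[of ch u]] disj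
  by (cases ch) (auto simp: par_def zpt_def ypt_def chart_c_def)

lemma chart_fun_par:
  assumes "valid ch" shows "chart_fun ch (par ch u) = u"
  using adm_nrm[OF adm_chart[OF assms, of u]] disj assms
  by (cases ch) (auto simp: chart_fun_def vec_eq_iff par_def zpt_def ypt_def vpt_def chart_c_def)

lemma par_chart_fun_emb:
  assumes ch: "valid ch" and adm: "adm t1 t2 c" and dom: "chart_dom ch (emb t1 t2 c)"
  shows "par ch (chart_fun ch (emb t1 t2 c)) = emb t1 t2 c"
proof -
  note N = adm_nrm[OF adm]
  have rz: "coord_z (emb t1 t2 c) l i / coord_z (emb t1 t2 c) i i = zpt t2 c l / zpt t2 c i"
    if "zpt t2 c i \<noteq> 0" for l i
    unfolding coord_emb by (rule ratio[where z="zpt t2 c", OF that])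
  have ry: "coord_y (emb t1 t2 c) l i / coord_y (emb t1 t2 c) i i = ypt t1 c l / ypt t1 c i"
    if "ypt t1 c i \<noteq> 0" for l i
    unfolding coord_emb by (rule ratio[where z="ypt t1 c", OF that])
  show ?thesis
  proof (cases ch)
    case [simp]: (ChartX i)
    have i: "i \<in> X" "i \<notin> D" using ch disj by auto
    have nz: "c $ i \<noteq> 0" "t2 \<noteq> 0" "zpt t2 c i \<noteq> 0" using dom N i by (auto simp: zpt_def)
    define u where "u = chart_fun ch (emb t1 t2 c)"
    have u: "u $ l = (if l = i then t1 * t2\<^sup>2 * c $ i else if l \<in> X then c $ l / c $ i
       else if l \<in> D then c $ l / (t2 * c $ i) else c $ l)" for l
      using i nz disj by (auto simp: u_def chart_fun_def rz simp del: coord_emb(2,3)) (auto simp: vpt_def zpt_def)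
    have "emb t1 t2 c = par ch u" unfolding par_def
    \<comment> \<open>The scalars are the inverses of the pivot entries of \<open>z\<close> and
      \<open>y\<close>, here and in the other two cases.\<close>
    proof (rule emb_cong[where a="1 / (t2 * c $ i)" and b="1 / c $ i"])
      show "vpt t1 t2 c = vpt (chart_t1 ch u) (chart_t2 ch u) (chart_c ch u)"
        using i nz disj by (auto simp: vec_eq_iff vpt_def chart_c_def u field_simps power2_eq_square)
    qed (use i nz disj in \<open>auto simp: zpt_def ypt_def chart_c_def u field_simps power2_eq_square\<close>)
    thus ?thesis by (simp add: u_def)
  next
    case [simp]: (ChartD j)
    have j: "j \<in> D" "j \<notin> X" using ch disj by auto
    have nz: "c $ j \<noteq> 0" "t1 \<noteq> 0" "zpt t2 c j \<noteq> 0" "ypt t1 c j \<noteq> 0" using dom N j by (auto simp: zpt_def ypt_def)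
    define u where "u = chart_fun ch (emb t1 t2 c)"
    have u: "u $ l = (if l = j then t1 * t2 * c $ j else if l \<in> X then c $ l / (t1 * (c $ j)\<^sup>2)
       else if l \<in> D then c $ l / c $ j else c $ l)" for l
      using j nz disj by (auto simp: u_def chart_fun_def rz ry simp del: coord_emb(2,3)) (auto simp: vpt_def zpt_def ypt_def)
    have "emb t1 t2 c = par ch u" unfolding par_def
    proof (rule emb_cong[where a="1 / c $ j" and b="1 / (t1 * (c $ j)\<^sup>2)"])
      show "vpt t1 t2 c = vpt (chart_t1 ch u) (chart_t2 ch u) (chart_c ch u)"
        using j nz disj by (auto simp: vec_eq_iff vpt_def chart_c_def u field_simps power2_eq_square)
    qed (use j nz disj in \<open>auto simp: zpt_def ypt_def chart_c_def u field_simps power2_eq_square\<close>)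
    thus ?thesis by (simp add: u_def)
  next
    case [simp]: (ChartXD i j)
    have i: "i \<in> X" "i \<notin> D" and j: "j \<in> D" "j \<notin> X" using ch disj by auto
    have ij: "i \<noteq> j" "j \<noteq> i" using i j by auto
    have nz: "c $ j \<noteq> 0" "c $ i \<noteq> 0" "zpt t2 c j \<noteq> 0" "ypt t1 c i \<noteq> 0" using dom N i j by (auto simp: zpt_def ypt_def)
    define u where "u = chart_fun ch (emb t1 t2 c)"
    have u: "u $ l = (if l = i then t2 * c $ i / c $ j else if l = j then t1 * (c $ j)\<^sup>2 / c $ i
       else if l \<in> X then c $ l / c $ i else if l \<in> D then c $ l / c $ j else c $ l)" for l
      using i j ij nz disj by (auto simp: u_def chart_fun_def rz ry simp del: coord_emb(2,3)) (auto simp: vpt_def zpt_def ypt_def)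
    have "emb t1 t2 c = par ch u" unfolding par_def
    proof (rule emb_cong[where a="1 / c $ j" and b="1 / c $ i"])
      show "vpt t1 t2 c = vpt (chart_t1 ch u) (chart_t2 ch u) (chart_c ch u)"
        using i j ij nz disj by (auto simp: vec_eq_iff vpt_def chart_c_def u field_simps power2_eq_square)
    qed (use i j ij nz disj in \<open>auto simp: zpt_def ypt_def chart_c_def u field_simps power2_eq_square\<close>)
    thus ?thesis by (simp add: u_def)
  qed
qed

text \<open>Off the two divisors the torus can make \<open>t1\<close> and \<open>t2\<close> equal to
  1, so the point is determined by its image; this gives the inverse of the blow-down there.\<close>

lemma emb_unscaled:
  assumes "t1 \<noteq> 0" "t2 \<noteq> 0"
  shows "emb 1 1 (vpt t1 t2 c) = emb t1 t2 c"
  by (rule emb_cong[symmetric, where a="t1 * t2" and b="t1 * t2\<^sup>2"])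
    (use assms disj in \<open>auto simp: vec_eq_iff vpt_def zpt_def ypt_def power2_eq_square\<close>)

text \<open>Pivoting on the largest entry keeps the chart coordinates bounded; this makes the blow-up
  proper.\<close>

lemma bounded_chart:
  assumes adm: "adm t1 t2 c"
  obtains ch u where "valid ch" "emb t1 t2 c = par ch u" "\<And>l. \<bar>u $ l\<bar> \<le> max 1 \<bar>vpt t1 t2 c $ l\<bar>"
proof -
  note goal = that
  have XD: "finite (X \<union> D)" "X \<union> D \<noteq> {}" using X_ne by auto
  obtain m where m: "m \<in> X \<union> D" "\<And>l. l \<in> X \<union> D \<Longrightarrow> \<bar>zpt t2 c l\<bar> \<le> \<bar>zpt t2 c m\<bar>"
    using obtains_MAX[OF XD, of "\<lambda>l. \<bar>zpt t2 c l\<bar>"] Max_ge XD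
    by (metis (mono_tags, lifting) finite_imageI image_eqI)
  have zm: "zpt t2 c m \<noteq> 0"
  proof -
    obtain l where "zpt t2 c l \<noteq> 0" using adm by (auto simp: adm_def)
    moreover from this have "l \<in> X \<union> D" by (auto simp: zpt_def split: if_splits)
    ultimately show ?thesis using m(2)[of l] by auto
  qed
  obtain n where n: "n \<in> X \<union> D" "\<And>l. l \<in> X \<union> D \<Longrightarrow> \<bar>ypt t1 c l\<bar> \<le> \<bar>ypt t1 c n\<bar>"
    using obtains_MAX[OF XD, of "\<lambda>l. \<bar>ypt t1 c l\<bar>"] Max_ge XD
    by (metis (mono_tags, lifting) finite_imageI image_eqI)
  have yn: "ypt t1 c n \<noteq> 0"
  proof -
    obtain l where "ypt t1 c l \<noteq> 0" using adm by (auto simp: adm_def)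
    moreover from this have "l \<in> X \<union> D" by (auto simp: ypt_def split: if_splits)
    ultimately show ?thesis using n(2)[of l] by auto
  qed
  note N = adm_nrm[OF adm]
  have rz: "coord_z (emb t1 t2 c) l i / coord_z (emb t1 t2 c) i i = zpt t2 c l / zpt t2 c i"
    if "zpt t2 c i \<noteq> 0" for l i
    unfolding coord_emb by (rule ratio[where z="zpt t2 c", OF that])
  have ry: "coord_y (emb t1 t2 c) l i / coord_y (emb t1 t2 c) i i = ypt t1 c l / ypt t1 c i"
    if "ypt t1 c i \<noteq> 0" for l i
    unfolding coord_emb by (rule ratio[where z="ypt t1 c", OF that])
  have N': "coord_z (emb t1 t2 c) l l = 0 \<longleftrightarrow> zpt t2 c l = 0" "coord_y (emb t1 t2 c) l l = 0 \<longleftrightarrow> ypt t1 c l = 0" for l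
    using N by auto
  have fin: thesis if "valid ch" "chart_dom ch (emb t1 t2 c)"
    "\<And>l. \<bar>chart_fun_nth ch (emb t1 t2 c) l\<bar> \<le> max 1 \<bar>vpt t1 t2 c $ l\<bar>" for ch
    by (rule goal[OF that(1) par_chart_fun_emb[OF that(1) adm that(2), symmetric]])
      (use that(3) in \<open>auto simp: chart_fun_def\<close>)
  have le1: "\<bar>a\<bar> / \<bar>b\<bar> \<le> max 1 x" if "\<bar>a\<bar> \<le> \<bar>b\<bar>" "b \<noteq> 0" for a b x :: real
    using that by (simp add: max.coboundedI1)
  \<comment> \<open>\<open>m\<close> and \<open>n\<close> are the positions of the largest entries
    of \<open>z\<close> and \<open>y\<close>; pivots placed there keep all ratios within
    \<open>[-1, 1]\<close>.\<close>
  consider "m \<in> X" | "m \<in> D" "n \<in> X" | "m \<in> D" "n \<in> D" using m n by auto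
  thus thesis
  proof cases
    case 1
    show thesis
      by (rule fin[of "ChartX m"])
        (use 1 zm m(2) in \<open>auto simp: N' rz simp del: coord_emb(2,3) intro!: le1\<close>)
  next
    case 2
    show thesis
      by (rule fin[of "ChartXD n m"])
        (use 2 zm yn m n in \<open>auto simp: N' rz ry simp del: coord_emb(2,3) intro!: le1\<close>)
  next
    case 3
    have "m \<notin> X" "n \<notin> X" using 3 disj by auto
    \<comment> \<open>\<open>ChartD\<close> has one pivot for both lines. On \<open>D\<close> the
      entries of \<open>y\<close> are \<open>t1\<close> times the squares of those of
      \<open>z\<close>, so \<open>m\<close> is maximal for \<open>y\<close> too.\<close>
    have "(c $ n)\<^sup>2 \<le> (c $ m)\<^sup>2"
      using m(2)[of n] 3 \<open>m \<notin> X\<close> \<open>n \<notin> X\<close> by (auto simp: zpt_def abs_le_square_iff)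
    hence "\<bar>ypt t1 c n\<bar> \<le> \<bar>ypt t1 c m\<bar>"
      using 3 \<open>m \<notin> X\<close> \<open>n \<notin> X\<close> by (auto simp: ypt_def abs_mult mult_left_mono)
    hence ym: "ypt t1 c m \<noteq> 0" "\<And>l. l \<in> X \<union> D \<Longrightarrow> \<bar>ypt t1 c l\<bar> \<le> \<bar>ypt t1 c m\<bar>"
      using yn n(2) by (auto intro: order_trans)
    show thesis
      by (rule fin[of "ChartD m"])
        (use 3 zm ym m in \<open>auto simp: N' rz ry simp del: coord_emb(2,3) intro!: le1\<close>)
  qed
qed

end

section \<open>Continuity and analyticity of the embedding and of its charts\<close>

context weighted_centre
begin

lemma continuous_on_emb:
  assumes "continuous_on S t1" "continuous_on S t2" "continuous_on S c"
    and adm: "\<And>u. u \<in> S \<Longrightarrow> adm (t1 u) (t2 u) (c u)"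
  shows "continuous_on S (\<lambda>u. emb (t1 u) (t2 u) (c u))"
proof (rule continuous_on_coordinatewise_then_product)
  fix k
  have v: "continuous_on S (\<lambda>u. vpt (t1 u) (t2 u) (c u) $ l)" for l
    unfolding vpt_def vec_lambda_beta
    by (cases "l \<in> X"; cases "l \<in> D"; simp) (intro continuous_intros assms)+
  have z: "continuous_on S (\<lambda>u. zpt (t2 u) (c u) l)" for l
    unfolding zpt_def by (cases "l \<in> X"; cases "l \<in> D"; simp) (intro continuous_intros assms)+
  have y: "continuous_on S (\<lambda>u. ypt (t1 u) (c u) l)" for l
    unfolding ypt_def by (cases "l \<in> X"; cases "l \<in> D"; simp) (intro continuous_intros assms)+
  have n: "nrm (zpt (t2 u) (c u)) \<noteq> 0" "nrm (ypt (t1 u) (c u)) \<noteq> 0" if "u \<in> S" for u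
    using adm_nrm[OF adm[OF that]] by auto
  show "continuous_on S (\<lambda>u. emb (t1 u) (t2 u) (c u) k)"
  proof -
    have "continuous_on S (\<lambda>u. nrm (zpt (t2 u) (c u)))" "continuous_on S (\<lambda>u. nrm (ypt (t1 u) (c u)))"
      unfolding nrm_def by (intro continuous_intros z y)+
    note N = this
    consider l where "from_nat k = (Inl l :: 'n blowup_coord)"
      | l m where "from_nat k = (Inr (Inl (l, m)) :: 'n blowup_coord)"
      | l m where "from_nat k = (Inr (Inr (l, m)) :: 'n blowup_coord)"
      by (metis surj_pair sum.exhaust)
    thus ?thesis
      unfolding emb_def by cases (simp; intro continuous_intros v z y N ballI n; assumption)+
  qed
qed

lemma real_analytic_at_emb:
  assumes "real_analytic_at t1 u" "real_analytic_at t2 u" "\<And>l. real_analytic_at (\<lambda>u. c u $ l) u"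
    and adm: "adm (t1 u) (t2 u) (c u)"
  shows "real_analytic_at (\<lambda>u. coord_v (emb (t1 u) (t2 u) (c u)) $ (l :: 'n)) u"
    and "real_analytic_at (\<lambda>u. coord_z (emb (t1 u) (t2 u) (c u)) (l :: 'n) m) u"
    and "real_analytic_at (\<lambda>u. coord_y (emb (t1 u) (t2 u) (c u)) (l :: 'n) m) u"
proof -
  have z: "real_analytic_at (\<lambda>u. zpt (t2 u) (c u) l) u" for l
    unfolding zpt_def by (cases "l \<in> X"; cases "l \<in> D"; simp) (intro real_analytic_intros assms)+
  have y: "real_analytic_at (\<lambda>u. ypt (t1 u) (c u) l) u" for l
    unfolding ypt_def by (cases "l \<in> X"; cases "l \<in> D"; simp) (intro real_analytic_intros assms)+
  have n: "nrm (zpt (t2 u) (c u)) \<noteq> 0" "nrm (ypt (t1 u) (c u)) \<noteq> 0"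
    using adm_nrm[OF adm] by auto
  show "real_analytic_at (\<lambda>u. coord_v (emb (t1 u) (t2 u) (c u)) $ (l :: 'n)) u"
    unfolding coord_emb vpt_def vec_lambda_beta
    by (cases "l \<in> X"; cases "l \<in> D"; simp) (intro real_analytic_intros assms)+
  have N: "real_analytic_at (\<lambda>u. nrm (zpt (t2 u) (c u))) u" "real_analytic_at (\<lambda>u. nrm (ypt (t1 u) (c u))) u"
    unfolding nrm_def by (intro real_analytic_intros z y)+
  show "real_analytic_at (\<lambda>u. coord_z (emb (t1 u) (t2 u) (c u)) (l :: 'n) m) u"
     "real_analytic_at (\<lambda>u. coord_y (emb (t1 u) (t2 u) (c u)) (l :: 'n) m) u"
    unfolding coord_emb by (intro real_analytic_intros z y n N)+
qed

lemma chart_continuous: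
  "continuous_on S (chart_t1 ch)" "continuous_on S (chart_t2 ch)" "continuous_on S (chart_c ch)"
proof -
  show "continuous_on S (chart_t1 ch)" "continuous_on S (chart_t2 ch)"
    by (cases ch; auto intro!: continuous_intros simp: chart_t1.simps[abs_def] chart_t2.simps[abs_def])+
  have "continuous_on S (\<lambda>u. if l \<in> chart_pivots ch then 1 else u $ l)" for l
    by (cases "l \<in> chart_pivots ch") (auto intro!: continuous_intros)
  thus "continuous_on S (chart_c ch)"
    unfolding chart_c_def[abs_def] by (intro continuous_on_vec_lambda)
qed

lemma chart_analytic:
  "real_analytic_at (chart_t1 ch) u" "real_analytic_at (chart_t2 ch) u" "real_analytic_at (\<lambda>u. chart_c ch u $ l) u"
proof -
  show "real_analytic_at (chart_t1 ch) u" "real_analytic_at (chart_t2 ch) u"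
    by (cases ch; simp add: chart_t1.simps[abs_def] chart_t2.simps[abs_def] real_analytic_at_const real_analytic_at_nth)+
  show "real_analytic_at (\<lambda>u. chart_c ch u $ l) u"
    unfolding chart_c_def vec_lambda_beta
    by (cases "l \<in> chart_pivots ch") (auto intro: real_analytic_intros)
qed

lemma continuous_on_par: "valid ch \<Longrightarrow> continuous_on S (par ch)"
  unfolding par_def[abs_def] by (intro continuous_on_emb chart_continuous adm_chart)

lemma continuous_on_coords:
  "continuous_on S (coord_v :: _ \<Rightarrow> real^'n)" "continuous_on S (\<lambda>p. coord_z p (l :: 'n) m)" "continuous_on S (\<lambda>p. coord_y p (l :: 'n) m)"
  unfolding coord_v_def[abs_def] coord_z_def[abs_def] coord_y_def[abs_def]
  by (intro continuous_on_vec_lambda continuous_on_subset[OF continuous_on_product_coordinates] subset_UNIV)+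

lemma continuous_on_parv: "continuous_on S (parv ch)"
  unfolding parv_def[abs_def] vpt_def vec_lambda_beta
proof -
  have "continuous_on S (\<lambda>u. if l \<in> X then chart_t1 ch u * (chart_t2 ch u)\<^sup>2 * chart_c ch u $ l
     else if l \<in> D then chart_t1 ch u * chart_t2 ch u * chart_c ch u $ l else chart_c ch u $ l)" for l
    by (cases "l \<in> X"; cases "l \<in> D"; simp) (intro continuous_intros chart_continuous)+
  thus "continuous_on S (\<lambda>u. \<chi> l. if l \<in> X then chart_t1 ch u * (chart_t2 ch u)\<^sup>2 * chart_c ch u $ l
     else if l \<in> D then chart_t1 ch u * chart_t2 ch u * chart_c ch u $ l else chart_c ch u $ l)"
    by (intro continuous_on_vec_lambda)
qed

lemma continuous_on_chart_fun:
  assumes ch: "valid ch" and dom: "\<And>p. p \<in> S \<Longrightarrow> chart_dom ch p"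
  shows "continuous_on S (chart_fun ch)"
proof -
  have v: "continuous_on S (\<lambda>p. coord_v p $ (l :: 'n))" for l
    by (intro continuous_intros continuous_on_coords)
  have "continuous_on S (\<lambda>p. chart_fun_nth ch p l)" for l
  proof (cases ch)
    case (ChartX i)
    thus ?thesis using dom
      by (cases "l = i"; cases "l \<in> X \<union> D"; simp) (intro continuous_intros continuous_on_coords v ballI; simp)+
  next
    case (ChartD j)
    thus ?thesis using dom
      by (cases "l = j"; cases "l \<in> X"; cases "l \<in> D"; simp) (intro continuous_intros continuous_on_coords v ballI; simp)+
  next
    case (ChartXD i j)
    hence "i \<noteq> j" using ch disj by auto
    thus ?thesis using ChartXD dom
      by (cases "l = i"; cases "l = j"; cases "l \<in> X"; cases "l \<in> D"; simp) (intro continuous_intros continuous_on_coords v ballI; simp)+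
  qed
  thus ?thesis unfolding chart_fun_def[abs_def] by (intro continuous_on_vec_lambda)
qed

lemma real_analytic_at_chart_fun:
  fixes E :: "real^'m \<Rightarrow> nat \<Rightarrow> real"
  assumes E: "\<And>l. real_analytic_at (\<lambda>u. coord_v (E u) $ (l :: 'n)) u"
     "\<And>l m. real_analytic_at (\<lambda>u. coord_z (E u) (l :: 'n) m) u"
     "\<And>l m. real_analytic_at (\<lambda>u. coord_y (E u) (l :: 'n) m) u"
    and ch: "valid ch" and dom: "chart_dom ch (E u)"
  shows "real_analytic_at (\<lambda>u. chart_fun ch (E u) $ l) u"
proof (cases ch)
  case (ChartX i)
  thus ?thesis using dom unfolding chart_fun_def vec_lambda_beta
    by (cases "l = i"; cases "l \<in> X \<union> D"; simp) (intro real_analytic_intros E; simp)+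
next
  case (ChartD j)
  thus ?thesis using dom unfolding chart_fun_def vec_lambda_beta
    by (cases "l = j"; cases "l \<in> X"; cases "l \<in> D"; simp) (intro real_analytic_intros E; simp)+
next
  case (ChartXD i j)
  hence "i \<noteq> j" using ch disj by auto
  thus ?thesis using ChartXD dom unfolding chart_fun_def vec_lambda_beta
    by (cases "l = i"; cases "l = j"; cases "l \<in> X"; cases "l \<in> D"; simp) (intro real_analytic_intros E; simp)+
qed

lemma real_analytic_at_par:
  assumes "valid ch"
  shows "real_analytic_at (\<lambda>u. parv ch u $ (l :: 'n)) u"
     "real_analytic_at (\<lambda>u. coord_z (par ch u) (l :: 'n) m) u"
     "real_analytic_at (\<lambda>u. coord_y (par ch u) (l :: 'n) m) u"
  unfolding coord_v_par[symmetric] unfolding par_def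
  by (intro real_analytic_at_emb chart_analytic adm_chart assms)+

lemma open_chart_dom: "open {p. chart_dom (ch :: 'n blowup_chart) p}"
proof -
  have o: "open {p. coord_z p l m \<noteq> 0}" "open {p. coord_y p l m \<noteq> 0}" for l m :: 'n
    by (intro open_Collect_neq continuous_on_coords continuous_on_const)+
  show ?thesis
    by (cases ch) (auto intro!: o open_Collect_conj)
qed

lemma finite_valid: "finite {ch. valid ch}"
proof -
  have "{ch. valid ch} \<subseteq> range ChartX \<union> range ChartD \<union> range (\<lambda>(i, j). ChartXD i j)"
    by (auto simp: image_iff) (metis blowup_chart.exhaust)
  thus ?thesis by (rule finite_subset) auto
qed

end

section \<open>The blow-up as an analytic manifold, proper over its base\<close>

lemma second_countable_euclidean: "second_countable (euclidean :: 'a::second_countable_topology topology)"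
proof -
  obtain B :: "'a set set" where B: "countable B" "\<And>C. C \<in> B \<Longrightarrow> open C" "\<And>S. open S \<Longrightarrow> \<exists>U. U \<subseteq> B \<and> S = \<Union>U"
    using univ_second_countable by blast
  have "\<exists>V\<in>B. x \<in> V \<and> V \<subseteq> U" if U: "open U" "x \<in> U" for U x
  proof -
    obtain V where "V \<subseteq> B" "U = \<Union>V" using B(3)[OF U(1)] by auto
    thus ?thesis using U(2) by (meson Sup_upper UnionE subsetD)
  qed
  thus ?thesis
    unfolding second_countable_def using B(1,2) by (intro exI[of _ B]) simp
qed

text \<open>The blow-up is built in the adapted coordinates \<open>v\<close> on \<open>U0\<close>,
  while the function to be resolved lives on \<open>W\<close>; \<open>\<Psi>\<close> and
  \<open>\<Phi>\<close> are the mutually inverse analytic coordinate changes.\<close>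

locale blowup_domain = weighted_centre X D for X D :: "'n::finite set" +
  fixes U0 W :: "(real^'n) set" and \<Psi> \<Phi> :: "real^'n \<Rightarrow> real^'n"
  assumes U0: "open U0" and W: "open W"
    and \<Psi>_cont: "continuous_on U0 \<Psi>" and \<Phi>_cont: "continuous_on W \<Phi>"
    and \<Psi>_W: "\<And>v. v \<in> U0 \<Longrightarrow> \<Psi> v \<in> W" and \<Phi>_U0: "\<And>w. w \<in> W \<Longrightarrow> \<Phi> w \<in> U0"
    and \<Phi>_\<Psi>: "\<And>v. v \<in> U0 \<Longrightarrow> \<Phi> (\<Psi> v) = v" and \<Psi>_\<Phi>: "\<And>w. w \<in> W \<Longrightarrow> \<Psi> (\<Phi> w) = w"
    and \<Psi>_an: "\<And>v l. v \<in> U0 \<Longrightarrow> real_analytic_at (\<lambda>v. \<Psi> v $ l) v"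
    and \<Phi>_an: "\<And>w l. w \<in> W \<Longrightarrow> real_analytic_at (\<lambda>w. \<Phi> w $ l) w"
begin

definition Mfd :: "(nat \<Rightarrow> real) set" where
  "Mfd = {emb t1 t2 c | t1 t2 c. adm t1 t2 c \<and> vpt t1 t2 c \<in> U0}"

definition Top :: "(nat \<Rightarrow> real) topology" where "Top = top_of_set Mfd"

definition gm :: "(nat \<Rightarrow> real) \<Rightarrow> real^'n" where "gm p = \<Psi> (coord_v p)"

definition dom :: "'n blowup_chart \<Rightarrow> (nat \<Rightarrow> real) set" where
  "dom ch = {p \<in> Mfd. chart_dom ch p}"

definition cod :: "'n blowup_chart \<Rightarrow> (real^'n) set" where
  "cod ch = {u. parv ch u \<in> U0}"

text \<open>Local coordinates at a point have to vanish there, so all charts come with a translation.\<close>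

definition tchart :: "'n blowup_chart \<Rightarrow> real^'n \<Rightarrow> (nat \<Rightarrow> real) \<Rightarrow> real^'n" where
  "tchart ch a p = chart_fun ch p - a"

definition Atlas :: "(nat \<Rightarrow> real, 'n) chart set" where
  "Atlas = {(dom ch, tchart ch 0) | ch. valid ch}"

lemma topspace_Top [simp]: "topspace Top = Mfd" by (simp add: Top_def)

lemma open_cod: "open (cod ch)"
proof -
  have "open (parv ch -` U0)"
    using continuous_on_parv[of UNIV ch] U0 continuous_on_open_vimage[OF open_UNIV] by auto
  thus ?thesis by (simp add: cod_def vimage_def)
qed

lemma par_in_dom: "valid ch \<Longrightarrow> u \<in> cod ch \<Longrightarrow> par ch u \<in> dom ch"
  using chart_dom_par[of ch u] adm_chart[of ch u]
  by (auto simp: dom_def cod_def Mfd_def par_def parv_def)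

lemma dom_par:
  assumes "valid ch" "p \<in> dom ch"
  shows "par ch (chart_fun ch p) = p" "chart_fun ch p \<in> cod ch"
proof -
  from assms(2) obtain t1 t2 c where p: "p = emb t1 t2 c" "adm t1 t2 c" "vpt t1 t2 c \<in> U0" "chart_dom ch p"
    by (auto simp: dom_def Mfd_def)
  show *: "par ch (chart_fun ch p) = p"
    using par_chart_fun_emb[OF assms(1) p(2)] p by simp
  have "parv ch (chart_fun ch p) = coord_v p"
    using * by (metis coord_v_par)
  thus "chart_fun ch p \<in> cod ch" using p by (simp add: cod_def)
qed

lemma tchart_par: "valid ch \<Longrightarrow> tchart ch a (par ch u) = u - a"
  by (simp add: tchart_def chart_fun_par)

lemma inj_tchart: "valid ch \<Longrightarrow> inj_on (tchart ch a) (dom ch)"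
  by (rule inj_on_inverseI[where g="\<lambda>u. par ch (u + a)"]) (simp add: tchart_def dom_par)

lemma tchart_image: "valid ch \<Longrightarrow> tchart ch a ` dom ch = {u. u + a \<in> cod ch}"
proof (intro equalityI subsetI)
  fix u assume ch: "valid ch" and "u \<in> {u. u + a \<in> cod ch}"
  thus "u \<in> tchart ch a ` dom ch"
    using par_in_dom[OF ch, of "u + a"] tchart_par[OF ch, of a "u + a"] by (force simp: image_iff)
qed (auto simp: tchart_def dom_par)

lemma open_tchart_image: "valid ch \<Longrightarrow> open {u. u + a \<in> cod ch}"
  using open_translation[OF open_cod, of "-a" ch]
  by (rule back_subst) (auto simp: image_iff algebra_simps intro: exI[of _ "_ + a"])

lemma inv_tchart:
  assumes ch: "valid ch" and S: "S \<subseteq> dom ch" and u: "u \<in> tchart ch a ` S"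
  shows "inv_into S (tchart ch a) u = par ch (u + a)"
proof -
  from u obtain p where p: "p \<in> S" "u = tchart ch a p" by auto
  have "inv_into S (tchart ch a) u = p"
    unfolding p(2) by (rule inv_into_f_f[OF inj_on_subset[OF inj_tchart[OF ch] S] p(1)])
  also have "p = par ch (u + a)" using p S dom_par[OF ch] by (auto simp: tchart_def)
  finally show ?thesis .
qed

lemma openin_dom: "openin Top (dom ch)"
  unfolding Top_def openin_open dom_def using open_chart_dom[of ch] by blast

lemma continuous_tchart: "valid ch \<Longrightarrow> continuous_on (dom ch) (tchart ch a)"
  unfolding tchart_def[abs_def] by (intro continuous_intros continuous_on_chart_fun) (auto simp: dom_def)

lemma is_chart_tchart:
  assumes ch: "valid ch"
  shows "is_chart Top (dom ch, tchart ch a)"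
proof -
  have sub: "subtopology Top (dom ch) = top_of_set (dom ch)"
    by (simp add: Top_def subtopology_subtopology dom_def Int_absorb1 Collect_conj_eq inf_commute)
  have "homeomorphic_maps (top_of_set (dom ch)) (top_of_set (tchart ch a ` dom ch)) (tchart ch a) (\<lambda>u. par ch (u + a))"
    unfolding homeomorphic_maps_def
  proof (intro conjI)
    show "continuous_map (top_of_set (dom ch)) (top_of_set (tchart ch a ` dom ch)) (tchart ch a)"
      using continuous_tchart[OF ch] by (auto simp: continuous_map_in_subtopology)
    have "continuous_on (tchart ch a ` dom ch) (\<lambda>u. par ch (u + a))"
      by (rule continuous_on_compose2[OF continuous_on_par[OF ch, of UNIV]]) (auto intro!: continuous_intros)
    thus "continuous_map (top_of_set (tchart ch a ` dom ch)) (top_of_set (dom ch)) (\<lambda>u. par ch (u + a))"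
      using par_in_dom[OF ch] by (auto simp: continuous_map_in_subtopology tchart_image[OF ch])
  qed (auto simp: tchart_def dom_par[OF ch])
  thus ?thesis
    unfolding is_chart_def using openin_dom open_tchart_image[OF ch]
    by (auto simp: sub homeomorphic_map_maps tchart_image[OF ch])
qed

lemma real_analytic_at_add_const:
  fixes f :: "real^'n \<Rightarrow> real"
  assumes "real_analytic_at f (u + a)" shows "real_analytic_at (\<lambda>u. f (u + a)) u"
  by (rule real_analytic_at_comp[where f=f and \<phi>="\<lambda>u. u + a"])
    (use assms in \<open>auto intro: real_analytic_intros\<close>)

lemma tchart_analytic:
  assumes ch: "valid ch" and ch': "valid ch'" and u: "chart_dom ch' (par ch (u + a))"
  shows "real_analytic_at (\<lambda>u. tchart ch' b (par ch (u + a)) $ l) u"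
proof -
  have "real_analytic_at (\<lambda>u. chart_fun ch' (par ch u) $ l) (u + a)"
    by (rule real_analytic_at_chart_fun) (use real_analytic_at_par[OF ch] ch' u in auto)
  from real_analytic_at_add_const[OF this]
  have "real_analytic_at (\<lambda>u. chart_fun ch' (par ch (u + a)) $ l) u" .
  thus ?thesis unfolding tchart_def vector_minus_component
    by (rule real_analytic_intros) (rule real_analytic_intros)
qed

lemma transition_analytic:
  assumes ch: "valid ch" and ch': "valid ch'"
  shows "vec_analytic_on (tchart ch' b \<circ> inv_into (dom ch) (tchart ch a)) (tchart ch a ` (dom ch \<inter> dom ch'))"
  unfolding vec_analytic_on_def real_analytic_on_def
proof (intro allI ballI)
  fix l u assume "u \<in> tchart ch a ` (dom ch \<inter> dom ch')"
  then obtain p where p: "p \<in> dom ch" "p \<in> dom ch'" "u = tchart ch a p" by auto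
  have pu: "par ch (u + a) = p" using dom_par[OF ch p(1)] p by (simp add: tchart_def)
  have u: "u \<in> {u. u + a \<in> cod ch}" using dom_par[OF ch p(1)] p by (simp add: tchart_def)
  have an: "real_analytic_at (\<lambda>u. tchart ch' b (par ch (u + a)) $ l) u"
    by (rule tchart_analytic[OF ch ch']) (use p pu in \<open>simp add: dom_def\<close>)
  have eq: "tchart ch' b (par ch (u + a)) $ l = (tchart ch' b \<circ> inv_into (dom ch) (tchart ch a)) u $ l"
    if "u \<in> {u. u + a \<in> cod ch}" for u
    using that by (subst o_def) (simp add: inv_tchart[OF ch order_refl] tchart_image[OF ch])
  show "real_analytic_at (\<lambda>u. (tchart ch' b \<circ> inv_into (dom ch) (tchart ch a)) u $ l) u"
    by (rule real_analytic_at_cong[OF an open_tchart_image[OF ch, of a] u eq])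
qed

lemma compatible:
  "valid ch \<Longrightarrow> valid ch' \<Longrightarrow> charts_compatible (dom ch, tchart ch a) (dom ch', tchart ch' b)"
  unfolding charts_compatible_def using transition_analytic[of ch ch'] transition_analytic[of ch' ch]
  by (auto simp: Int_commute)

lemma Mfd_bounded_chart:
  assumes "p \<in> Mfd"
  obtains ch where "valid ch" "p \<in> dom ch" "\<And>l. \<bar>chart_fun ch p $ l\<bar> \<le> max 1 \<bar>coord_v p $ l\<bar>"
proof -
  from assms obtain t1 t2 c where p: "p = emb t1 t2 c" "adm t1 t2 c" "vpt t1 t2 c \<in> U0"
    by (auto simp: Mfd_def)
  from bounded_chart[OF p(2)] obtain ch u where u: "valid ch" "p = par ch u" "\<And>l. \<bar>u $ l\<bar> \<le> max 1 \<bar>coord_v p $ l\<bar>"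
    unfolding p(1) coord_emb(1) by metis
  have "u \<in> cod ch" using p u by (metis cod_def coord_emb(1) coord_v_par mem_Collect_eq)
  thus thesis using u par_in_dom[OF u(1)] by (intro that[of ch]) (auto simp: chart_fun_par)
qed

lemma manifold: "analytic_manifold Top Atlas"
  unfolding analytic_manifold_def
proof (intro conjI)
  show "Hausdorff_space Top"
    unfolding Top_def by (simp add: Hausdorff_space_subtopology)
  show "second_countable Top"
    unfolding Top_def by (rule second_countable_subtopology[OF second_countable_euclidean])
  show "\<forall>c\<in>Atlas. is_chart Top c" using is_chart_tchart by (auto simp: Atlas_def)
  show "(\<Union>c\<in>Atlas. fst c) = topspace Top"
  proof (intro equalityI subsetI)
    fix p assume "p \<in> topspace Top"
    hence "p \<in> Mfd" by simp
    then obtain ch where "valid ch" "p \<in> dom ch" by (rule Mfd_bounded_chart)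
    thus "p \<in> (\<Union>c\<in>Atlas. fst c)" by (force simp: Atlas_def)
  qed (auto simp: Atlas_def dom_def)
  show "\<forall>c\<in>Atlas. \<forall>c'\<in>Atlas. charts_compatible c c'"
    using compatible by (auto simp: Atlas_def)
qed

lemma coord_v_Mfd: "p \<in> Mfd \<Longrightarrow> coord_v p \<in> U0" by (auto simp: Mfd_def)

lemma continuous_gm: "continuous_on Mfd gm"
  unfolding gm_def[abs_def]
  by (rule continuous_on_compose2[OF \<Psi>_cont continuous_on_coords(1)]) (auto simp: coord_v_Mfd)

lemma gm_par: "gm (par ch u) = \<Psi> (parv ch u)" by (simp add: gm_def)

lemma parv_comp_analytic:
  fixes f :: "real^'n \<Rightarrow> real"
  assumes "valid ch" "real_analytic_at f (parv ch (u + a))"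
  shows "real_analytic_at (\<lambda>u. f (parv ch (u + a))) u"
  by (rule real_analytic_at_comp[where f=f and \<phi>="\<lambda>u. parv ch (u + a)", OF assms(2)])
    (rule real_analytic_at_add_const[OF real_analytic_at_par(1)[OF assms(1)]])

lemma analytic_gm: "analytic_map Top Atlas (top_of_set W) (id_atlas W) gm"
  unfolding analytic_map_def
proof (intro conjI)
  show "continuous_map Top (top_of_set W) gm"
    unfolding Top_def using continuous_gm \<Psi>_W coord_v_Mfd
    by (auto simp: continuous_map_in_subtopology gm_def)
  have "vec_analytic_on ((\<lambda>x. x) \<circ> gm \<circ> inv_into (dom ch) (tchart ch 0)) (tchart ch 0 ` {p \<in> dom ch. gm p \<in> W})"
    if ch: "valid ch" for ch
    unfolding vec_analytic_on_def real_analytic_on_def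
  proof (intro allI ballI)
    fix l u assume "u \<in> tchart ch 0 ` {p \<in> dom ch. gm p \<in> W}"
    hence u: "u \<in> tchart ch 0 ` dom ch" by auto
    hence "parv ch (u + 0) \<in> U0" by (simp add: tchart_image[OF ch] cod_def)
    hence "real_analytic_at (\<lambda>u. \<Psi> (parv ch (u + 0)) $ l) u"
      by (intro parv_comp_analytic[OF ch] \<Psi>_an)
    thus "real_analytic_at (\<lambda>u. ((\<lambda>x. x) \<circ> gm \<circ> inv_into (dom ch) (tchart ch 0)) u $ l) u"
      by (rule real_analytic_at_cong[OF _ open_tchart_image[OF ch, of 0]])
        (use u in \<open>auto simp: inv_tchart[OF ch order_refl] tchart_image[OF ch] gm_par\<close>)
  qed
  thus "\<forall>(V, \<phi>)\<in>Atlas. \<forall>(V', \<psi>)\<in>id_atlas W. vec_analytic_on (\<psi> \<circ> gm \<circ> inv_into V \<phi>) (\<phi> ` {p \<in> V. gm p \<in> V'})"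
    by (auto simp: Atlas_def id_atlas_def)
qed

text \<open>Every point has a chart in which its coordinates are bounded by 1 or by those of its
  image, so the preimage of a compact set is a finite union of images of compact sets under
  \<open>par\<close>. Since \<open>W\<close> is metrizable, compactness of preimages gives
  properness.\<close>

lemma proper_gm: "proper_map Top (top_of_set W) gm"
proof (rule compact_imp_proper_map)
  show "k_space (top_of_set W)"
    by (intro metrizable_imp_k_space metrizable_space_subtopology metrizable_space_euclidean)
  show "kc_space (top_of_set W)"
    by (intro Hausdorff_imp_kc_space Hausdorff_space_subtopology) simp
  show "gm \<in> topspace Top \<rightarrow> topspace (top_of_set W)"
    using \<Psi>_W coord_v_Mfd by (auto simp: gm_def)
  show "continuous_map Top (top_of_set W) gm \<or> kc_space Top"
    using analytic_gm by (simp add: analytic_map_def)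
  fix K assume "compactin (top_of_set W) K"
  hence K: "compact K" "K \<subseteq> W" by (auto simp: compactin_subtopology)
  have cK: "compact (\<Phi> ` K)" by (rule compact_continuous_image[OF continuous_on_subset[OF \<Phi>_cont K(2)] K(1)])
  have KU: "\<Phi> ` K \<subseteq> U0" using K \<Phi>_U0 by auto
  obtain R where R: "\<And>v. v \<in> \<Phi> ` K \<Longrightarrow> norm v \<le> R"
    using compact_imp_bounded[OF cK] by (auto simp: bounded_iff)
  define B where "B ch = {u. parv ch u \<in> \<Phi> ` K} \<inter> cbox (\<chi> l. - max 1 R) (\<chi> l. max 1 R)" for ch
  have "compact (B ch)" for ch
  proof -
    have "closed (parv ch -` \<Phi> ` K)"
      using continuous_on_parv[of UNIV ch] compact_imp_closed[OF cK] continuous_closed_vimage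
      by (metis continuous_on_eq_continuous_at open_UNIV UNIV_I)
    thus ?thesis unfolding B_def vimage_def by (intro closed_Int_compact compact_cbox)
  qed
  hence "compact (\<Union>ch\<in>{ch. valid ch}. par ch ` B ch)"
    by (intro compact_UN finite_valid ballI compact_continuous_image continuous_on_par) auto
  also have "(\<Union>ch\<in>{ch. valid ch}. par ch ` B ch) = {p \<in> Mfd. gm p \<in> K}"
  proof (intro equalityI subsetI)
    fix p assume "p \<in> (\<Union>ch\<in>{ch. valid ch}. par ch ` B ch)"
    then obtain ch u where u: "valid ch" "p = par ch u" "parv ch u \<in> \<Phi> ` K" by (auto simp: B_def)
    hence "p \<in> Mfd" using par_in_dom[of ch u] KU by (auto simp: cod_def dom_def)
    moreover have "gm p \<in> K" using u \<Psi>_\<Phi> K by (auto simp: gm_par)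
    ultimately show "p \<in> {p \<in> Mfd. gm p \<in> K}" by simp
  next
    fix p assume "p \<in> {p \<in> Mfd. gm p \<in> K}"
    hence p: "p \<in> Mfd" "gm p \<in> K" by auto
    have v: "coord_v p \<in> \<Phi> ` K"
      using p(2) \<Phi>_\<Psi>[OF coord_v_Mfd[OF p(1)]] by (auto simp: gm_def intro!: image_eqI[of _ _ "\<Psi> (coord_v p)"])
    obtain ch where ch: "valid ch" "p \<in> dom ch" "\<And>l. \<bar>chart_fun ch p $ l\<bar> \<le> max 1 \<bar>coord_v p $ l\<bar>"
      by (rule Mfd_bounded_chart[OF p(1)]) blast
    define u where "u = chart_fun ch p"
    have pu: "p = par ch u" using dom_par[OF ch(1,2)] by (simp add: u_def)
    have "\<bar>u $ l\<bar> \<le> max 1 R" for l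
      using ch(3)[of l] R[OF v] component_le_norm_cart[of "coord_v p" l] unfolding u_def by linarith
    hence "u \<in> B ch" using v by (auto simp: B_def pu mem_box_cart abs_le_iff) (meson minus_le_iff)+
    thus "p \<in> (\<Union>ch\<in>{ch. valid ch}. par ch ` B ch)" using ch pu by auto
  qed
  finally show "compactin Top {x \<in> topspace Top. gm x \<in> K}"
    unfolding Top_def by (auto simp: compactin_subtopology)
qed

end

section \<open>Normal crossings and the threshold\<close>

text \<open>A substitute for triangularity, as the index type carries no order: all Leibniz terms
  except the diagonal one vanish.\<close>

lemma det_unique_permutation:
  fixes A :: "'a::comm_ring_1^'n^'n"
  assumes "\<And>p. p permutes UNIV \<Longrightarrow> (\<And>i. A $ i $ p i \<noteq> 0) \<Longrightarrow> p = id"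
  shows "det A = (\<Prod>i\<in>UNIV. A $ i $ i)"
proof -
  have "(\<Prod>i\<in>UNIV. A $ i $ p i) = 0" if p: "p permutes UNIV" "p \<noteq> id" for p
  proof -
    obtain i where "A $ i $ p i = 0" using assms[OF p(1)] p(2) by blast
    thus ?thesis by (intro prod_zero) auto
  qed
  hence "det A = (\<Sum>p\<in>{id}. of_int (sign p) * (\<Prod>i\<in>UNIV. A $ i $ p i))"
    unfolding det_def by (intro sum.mono_neutral_right) (auto simp: finite_permutations permutes_id)
  thus ?thesis by (simp add: sign_id)
qed

lemma has_derivative_vecI:
  fixes f :: "real^'n \<Rightarrow> real^'m"
  assumes "\<And>l. ((\<lambda>v. f v $ l) has_derivative (\<lambda>h. f' h $ l)) (at v)"
  shows "(f has_derivative f') (at v)"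
  unfolding has_derivative_componentwise_within[of f]
  using assms by (auto simp: Basis_vec_def inner_axis)

text \<open>For \<open>i \<notin> C\<close>, the chart map with pivot \<open>i\<close> of the
  ordinary blow-up whose centre is the vanishing of the coordinates in
  \<open>insert i C\<close>.\<close>

definition pivot_scale :: "'n \<Rightarrow> 'n set \<Rightarrow> real^'n \<Rightarrow> real^'n" where
  "pivot_scale i C v = (\<chi> l. if l \<in> C then v $ i * v $ l else v $ l)"

text \<open>Rows outside \<open>C\<close>, among them row \<open>i\<close>, are unit rows, and row
  \<open>l\<close> in \<open>C\<close> has entries only in the columns \<open>l\<close> and
  \<open>i\<close>. A permutation with nonzero product therefore fixes \<open>i\<close>, and then
  every other index.\<close>

lemma pivot_scale_derivative:
  fixes v :: "real^'n"
  assumes "i \<notin> C"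
  obtains f' where "(pivot_scale i C has_derivative f') (at v)" "det (matrix f') = v $ i ^ card C"
proof
  define f' where "f' h = (\<chi> l. if l \<in> C then v $ i * h $ l + h $ i * v $ l else h $ l)" for h :: "real^'n"
  have "((\<lambda>v. if l \<in> C then v $ i * v $ l else v $ l) has_derivative
      (\<lambda>h. if l \<in> C then v $ i * h $ l + h $ i * v $ l else h $ l)) (at v)" for l
    by (cases "l \<in> C")
      (auto intro!: derivative_eq_intros bounded_linear_imp_has_derivative bounded_linear_vec_nth)
  thus "(pivot_scale i C has_derivative f') (at v)"
    by (intro has_derivative_vecI) (simp add: pivot_scale_def f'_def)
  have m: "matrix f' $ l $ m = (if l \<in> C then (if m = l then v $ i else 0) + (if m = i then v $ l else 0)
      else if m = l then 1 else 0)" for l m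
    by (auto simp: matrix_def f'_def axis_def)
  have "det (matrix f') = (\<Prod>l\<in>UNIV. matrix f' $ l $ l)"
  proof (rule det_unique_permutation)
    fix p assume p: "p permutes (UNIV :: 'n set)" and nz: "\<And>l. matrix f' $ l $ p l \<noteq> 0"
    have pi: "p i = i" using nz[of i] assms by (auto simp: m split: if_splits)
    have "p l = l" for l
    proof (cases "l = i")
      case False
      hence "p l \<noteq> i" using pi permutes_inj[OF p] by (metis injD)
      thus ?thesis using nz[of l] by (auto simp: m split: if_splits)
    qed (simp add: pi)
    thus "p = id" by auto
  qed
  also have "\<dots> = (\<Prod>l\<in>UNIV. if l \<in> C then v $ i else 1)"
    by (rule prod.cong) (use assms in \<open>auto simp: m\<close>)
  also have "\<dots> = v $ i ^ card C"
    by (simp add: prod.If_cases)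
  finally show "det (matrix f') = v $ i ^ card C" .
qed

lemma det_compose_derivative:
  fixes f g :: "real^'n \<Rightarrow> real^'n"
  assumes f: "(f has_derivative f') (at (g x))" and g: "(g has_derivative g') (at x)"
  shows "((f \<circ> g) has_derivative (f' \<circ> g')) (at x)" "det (matrix (f' \<circ> g')) = det (matrix f') * det (matrix g')"
proof -
  show "((f \<circ> g) has_derivative (f' \<circ> g')) (at x)" by (rule diff_chain_at[OF g f])
  show "det (matrix (f' \<circ> g')) = det (matrix f') * det (matrix g')"
    using f g by (subst matrix_compose) (auto simp: det_mul dest!: has_derivative_linear)
qed

context weighted_centre
begin

text \<open>The pulled back form is a unit times \<open>(t1 * t2\<^sup>2)\<^sup>2\<close>, which has
  order 2 along \<open>t1 = 0\<close> and order 4 along \<open>t2 = 0\<close>.\<close>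

fun kexp :: "'n blowup_chart \<Rightarrow> 'n \<Rightarrow> nat" where
  "kexp (ChartX i) l = (if l = i then 2 else 0)"
| "kexp (ChartD j) l = (if l = j then 4 else 0)"
| "kexp (ChartXD i j) l = (if l = i then 4 else if l = j then 2 else 0)"

text \<open>The first centre has codimension \<open>|X| + |D|\<close>, whence the discrepancy
  \<open>|X| + |D| - 1\<close>. The second centre has codimension \<open>|X| + 1\<close> and lies in
  the first divisor, which adds \<open>|X|\<close>.\<close>

fun hexp :: "'n blowup_chart \<Rightarrow> 'n \<Rightarrow> nat" where
  "hexp (ChartX i) l = (if l = i then card X + card D - 1 else 0)"
| "hexp (ChartD j) l = (if l = j then 2 * card X + card D - 1 else 0)"
| "hexp (ChartXD i j) l = (if l = i then 2 * card X + card D - 1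
     else if l = j then card X + card D - 1 else 0)"

lemma prod_single_power: "(\<Prod>l\<in>UNIV. (u :: real^'n) $ l ^ (if l = i then a else 0)) = u $ i ^ a"
proof -
  have "u $ l ^ (if l = i then a else 0) = (if l = i then u $ i ^ a else 1)" for l by auto
  thus ?thesis by simp
qed

lemma prod_double_power:
  assumes "i \<noteq> j"
  shows "(\<Prod>l\<in>UNIV. (u :: real^'n) $ l ^ (if l = i then a else if l = j then b else 0)) = u $ i ^ a * u $ j ^ b"
proof -
  have "u $ l ^ (if l = i then a else if l = j then b else 0) =
      u $ l ^ (if l = i then a else 0) * u $ l ^ (if l = j then b else 0)" for l
    using assms by auto
  thus ?thesis by (simp only: prod.distrib prod_single_power)
qed

lemma prod_kexp:
  assumes "valid ch"
  shows "(\<Prod>l\<in>UNIV. u $ l ^ kexp ch l) = (chart_t1 ch u * (chart_t2 ch u)\<^sup>2)\<^sup>2"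
proof (cases ch)
  case (ChartXD i j)
  hence "i \<noteq> j" using assms disj by auto
  thus ?thesis using ChartXD
    by (simp add: prod_double_power power_mult_distrib flip: power_mult)
qed (simp_all add: prod_single_power flip: power_mult)

lemma card_X_pos: "0 < card X" using X_ne by (simp add: card_gt_0_iff)

text \<open>The chart maps are compositions of ordinary blow-up charts, whose Jacobians multiply.
  The strict transform of \<open>x = 0\<close> does not meet a first chart with pivot in
  \<open>X\<close>, so \<open>ChartX\<close> takes one step and the others two.\<close>

lemma parv_derivative:
  assumes ch: "valid ch"
  obtains f' where "(parv ch has_derivative f') (at u)" "det (matrix f') = (\<Prod>l\<in>UNIV. u $ l ^ hexp ch l)"
proof -
  have cXD: "card (X \<union> D) = card X + card D" using disj by (simp add: card_Un_disjoint)
  show thesis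
  proof (cases ch)
    case [simp]: (ChartX i)
    have i: "i \<in> X" using ch by simp
    obtain f' where f': "(pivot_scale i (X \<union> D - {i}) has_derivative f') (at u)"
      "det (matrix f') = u $ i ^ card (X \<union> D - {i})"
      by (rule pivot_scale_derivative[of i "X \<union> D - {i}" u]) auto
    have "parv ch = pivot_scale i (X \<union> D - {i})"
      using i disj by (auto simp: fun_eq_iff vec_eq_iff parv_def vpt_def chart_c_def pivot_scale_def)
    thus thesis using f' i by (intro that[of f']) (auto simp: cXD prod_single_power)
  next
    case [simp]: (ChartD j)
    have j: "j \<in> D" "j \<notin> X" using ch disj by auto
    obtain g' where g': "(pivot_scale j X has_derivative g') (at u)"
      "det (matrix g') = u $ j ^ card X"
      by (rule pivot_scale_derivative[of j X u]) (use j in auto)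
    obtain f' where f': "(pivot_scale j (X \<union> D - {j}) has_derivative f') (at (pivot_scale j X u))"
      "det (matrix f') = pivot_scale j X u $ j ^ card (X \<union> D - {j})"
      by (rule pivot_scale_derivative[of j "X \<union> D - {j}" "pivot_scale j X u"]) auto
    note d = det_compose_derivative[OF f'(1) g'(1)]
    have "parv ch = pivot_scale j (X \<union> D - {j}) \<circ> pivot_scale j X"
      using j disj by (auto simp: fun_eq_iff vec_eq_iff parv_def vpt_def chart_c_def pivot_scale_def power2_eq_square)
    moreover have "card X + card D + card X - Suc 0 = 2 * card X + card D - Suc 0" by simp
    ultimately show thesis using d f' g' j card_X_pos
      by (intro that[of "f' \<circ> g'"]) (auto simp: cXD prod_single_power pivot_scale_def simp flip: power_add)
  next
    case [simp]: (ChartXD i j)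
    have i: "i \<in> X" "i \<notin> D" and j: "j \<in> D" "j \<notin> X" using ch disj by auto
    have ij: "i \<noteq> j" using i j by auto
    \<comment> \<open>After the first blow-up with pivot \<open>j\<close>, the exceptional divisor
      is the vanishing of coordinate \<open>j\<close> and the strict transform that of the
      coordinates in \<open>X\<close>. The second centre is thus given by \<open>insert j X\<close>,
      with pivot \<open>i\<close>.\<close>
    define C where "C = insert j (X - {i})"
    have C: "i \<notin> C" "card C = card X" using i j ij card_X_pos by (auto simp: C_def)
    obtain g' where g': "(pivot_scale i C has_derivative g') (at u)"
      "det (matrix g') = u $ i ^ card C"
      by (rule pivot_scale_derivative[of i C u]) (use C in auto)
    obtain f' where f': "(pivot_scale j (X \<union> D - {j}) has_derivative f') (at (pivot_scale i C u))"
      "det (matrix f') = pivot_scale i C u $ j ^ card (X \<union> D - {j})"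
      by (rule pivot_scale_derivative[of j "X \<union> D - {j}" "pivot_scale i C u"]) auto
    note d = det_compose_derivative[OF f'(1) g'(1)]
    have pj: "pivot_scale i C u $ j = u $ i * u $ j" by (simp add: pivot_scale_def C_def)
    have "parv ch = pivot_scale j (X \<union> D - {j}) \<circ> pivot_scale i C"
      using i j ij disj by (auto simp: fun_eq_iff vec_eq_iff parv_def vpt_def chart_c_def pivot_scale_def C_def power2_eq_square)
    moreover have "det (matrix (f' \<circ> g')) = (\<Prod>l\<in>UNIV. u $ l ^ hexp ch l)"
    proof -
      have "2 * card X + card D - 1 = card X + (card X + card D - 1)" using card_X_pos by simp
      thus ?thesis unfolding d(2) f'(2) g'(2) pj C(2) using j
        by (simp add: cXD prod_double_power[OF ij] power_mult_distrib power_add)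
    qed
    ultimately show thesis using d(1) by (intro that[of "f' \<circ> g'"]) auto
  qed
qed

text \<open>The threshold is attained on the second exceptional divisor, of multiplicity \<open>4\<close> and discrepancy
  \<open>2 |X| + |D| - 1\<close>; if \<open>D\<close> is empty, the first blow-up alone gives the same value.\<close>

definition thr :: ereal where "thr = ereal ((2 * real (card X) + real (card D)) / 4)"

text \<open>The second divisor has exactly the ratio \<open>thr\<close>; the first has
  \<open>(|X| + |D|) / 2\<close>, which exceeds \<open>thr\<close> by
  \<open>|D| / 4\<close>.\<close>

lemma exponent_ratio_ge:
  assumes "valid ch" shows "thr \<le> exponent_ratio (kexp ch l) (hexp ch l)"
  using assms card_X_pos
  by (cases ch) (auto simp: thr_def exponent_ratio_def of_nat_diff field_simps)

lemma Min_exponent_ratio_ge: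
  "valid ch \<Longrightarrow> thr \<le> Min (range (\<lambda>l. exponent_ratio (kexp ch l) (hexp ch l)))"
  using exponent_ratio_ge by (auto simp: Min_ge_iff)

text \<open>The source of the multiplicity 1. For nonempty \<open>D\<close> only the second divisor
  is critical; for empty \<open>D\<close> all valid charts are of the form \<open>ChartX\<close>,
  and the first divisor is critical.\<close>

lemma critical_exponent:
  assumes "valid ch"
  shows "{l. exponent_ratio (kexp ch l) (hexp ch l) = thr} =
    (case ch of ChartX i \<Rightarrow> if D = {} then {i} else {} | ChartD j \<Rightarrow> {j} | ChartXD i j \<Rightarrow> {i})"
proof (cases ch)
  case (ChartX i)
  have "D = {} \<longleftrightarrow> card D = 0" by simp
  thus ?thesis using ChartX card_X_pos assms
    by (auto simp: thr_def exponent_ratio_def of_nat_diff field_simps split: if_splits)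
next
  case (ChartD j)
  thus ?thesis using card_X_pos assms
    by (auto simp: thr_def exponent_ratio_def of_nat_diff field_simps split: if_splits)
next
  case (ChartXD i j)
  hence "i \<noteq> j" "card D \<noteq> 0" using assms disj by auto
  thus ?thesis using ChartXD card_X_pos assms
    by (auto simp: thr_def exponent_ratio_def of_nat_diff field_simps split: if_splits)
qed

end

text \<open>With weight 2 on \<open>X\<close> and weight 1 on \<open>D\<close>, every squared term
  is homogeneous of weight 2 once its coefficients are frozen. The coefficients may depend on
  \<open>v\<close>, which is how terms of higher weight are accommodated without a
  remainder.\<close>

locale weighted_form = blowup_domain X D U0 W \<Psi> \<Phi>
  for X D :: "'n::finite set" and U0 W \<Psi> \<Phi> +
  fixes F :: "real^'n \<Rightarrow> real" and I :: "'x set" and e :: "'x \<Rightarrow> real^'n \<Rightarrow> real"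
    and A :: "'x \<Rightarrow> 'n \<Rightarrow> real^'n \<Rightarrow> real" and B :: "'x \<Rightarrow> 'n \<Rightarrow> 'n \<Rightarrow> real^'n \<Rightarrow> real"
    and jac :: "real^'n \<Rightarrow> real"
  assumes F_an: "real_analytic_on F W"
    and fin_I: "finite I"
    and F_form: "\<And>v. v \<in> U0 \<Longrightarrow> F (\<Psi> v) =
      (\<Sum>x\<in>I. e x v * ((\<Sum>i\<in>X. v $ i * A x i v) + (\<Sum>i\<in>D. \<Sum>j\<in>D. v $ i * v $ j * B x i j v))\<^sup>2)"
    and e_pos: "\<And>x v. x \<in> I \<Longrightarrow> v \<in> U0 \<Longrightarrow> 0 < e x v"
    and e_an: "\<And>x v. x \<in> I \<Longrightarrow> v \<in> U0 \<Longrightarrow> real_analytic_at (e x) v"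
    and A_an: "\<And>x i v. x \<in> I \<Longrightarrow> v \<in> U0 \<Longrightarrow> real_analytic_at (A x i) v"
    and B_an: "\<And>x i j v. x \<in> I \<Longrightarrow> v \<in> U0 \<Longrightarrow> real_analytic_at (B x i j) v"
    and nondegenerate: "\<And>v c. v \<in> U0 \<Longrightarrow>
      (\<And>x. x \<in> I \<Longrightarrow> (\<Sum>i\<in>X. c $ i * A x i v) + (\<Sum>i\<in>D. \<Sum>j\<in>D. c $ i * c $ j * B x i j v) = 0) \<Longrightarrow>
      (\<And>l. l \<in> X \<union> D \<Longrightarrow> c $ l = 0)"
    and jac_an: "\<And>v. v \<in> U0 \<Longrightarrow> real_analytic_at jac v"
    and jac_nz: "\<And>v. v \<in> U0 \<Longrightarrow> jac v \<noteq> 0"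
    and jac: "\<And>v. v \<in> U0 \<Longrightarrow> \<exists>\<Psi>'. (\<Psi> has_derivative \<Psi>') (at v) \<and> det (matrix \<Psi>') = jac v"
begin

definition unit_factor :: "real \<Rightarrow> real^'n \<Rightarrow> real^'n \<Rightarrow> real" where
  "unit_factor t1 c v = (\<Sum>x\<in>I. e x v * ((\<Sum>i\<in>X. c $ i * A x i v) + t1 * (\<Sum>i\<in>D. \<Sum>j\<in>D. c $ i * c $ j * B x i j v))\<^sup>2)"

text \<open>The part linear in \<open>X\<close> contains \<open>t1 * t2\<^sup>2\<close>, the part
  quadratic in \<open>D\<close> contains \<open>(t1 * t2)\<^sup>2\<close>; the common factor leaves
  one \<open>t1\<close> on the quadratic part.\<close>

lemma F_factor:
  assumes "vpt t1 t2 c \<in> U0"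
  shows "F (\<Psi> (vpt t1 t2 c)) = (t1 * t2\<^sup>2)\<^sup>2 * unit_factor t1 c (vpt t1 t2 c)"
proof -
  define v where "v = vpt t1 t2 c"
  have vX: "v $ i = t1 * t2\<^sup>2 * c $ i" if "i \<in> X" for i using that by (simp add: v_def vpt_def)
  have vD: "v $ i = t1 * t2 * c $ i" if "i \<in> D" for i using that disj by (auto simp: v_def vpt_def)
  have "(\<Sum>i\<in>X. v $ i * A x i v) + (\<Sum>i\<in>D. \<Sum>j\<in>D. v $ i * v $ j * B x i j v)
     = t1 * t2\<^sup>2 * ((\<Sum>i\<in>X. c $ i * A x i v) + t1 * (\<Sum>i\<in>D. \<Sum>j\<in>D. c $ i * c $ j * B x i j v))" for x
  proof -
    have "(\<Sum>i\<in>X. v $ i * A x i v) = t1 * t2\<^sup>2 * (\<Sum>i\<in>X. c $ i * A x i v)"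
      unfolding sum_distrib_left by (rule sum.cong) (auto simp: vX)
    moreover have "(\<Sum>i\<in>D. \<Sum>j\<in>D. v $ i * v $ j * B x i j v) = t1 * t2\<^sup>2 * (t1 * (\<Sum>i\<in>D. \<Sum>j\<in>D. c $ i * c $ j * B x i j v))"
      unfolding sum_distrib_left by (intro sum.cong refl) (auto simp: vD power2_eq_square)
    ultimately show ?thesis by (simp add: distrib_left)
  qed
  note eq = this
  have "F (\<Psi> v) = (\<Sum>x\<in>I. e x v * (t1 * t2\<^sup>2 * ((\<Sum>i\<in>X. c $ i * A x i v) + t1 * (\<Sum>i\<in>D. \<Sum>j\<in>D. c $ i * c $ j * B x i j v)))\<^sup>2)"
    using F_form[of v] assms unfolding eq by (simp add: v_def)
  also have "\<dots> = (t1 * t2\<^sup>2)\<^sup>2 * unit_factor t1 c v"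
    unfolding unit_factor_def sum_distrib_left
    by (intro sum.cong refl) (simp only: power_mult_distrib mult_ac)
  finally show ?thesis by (simp add: v_def)
qed

text \<open>A zero would yield a common zero of the forms. For \<open>t1 \<noteq> 0\<close>,
  dividing the \<open>X\<close> entries by \<open>t1\<close> removes the factor in front of the
  quadratic part; for \<open>t1 = 0\<close> that part is absent and the \<open>D\<close> entries are
  set to 0. The nonzero entry of \<open>y\<close> shows that the resulting vector is nonzero on
  \<open>X \<union> D\<close>.\<close>

lemma unit_factor_nz:
  assumes adm: "adm t1 t2 c" and v: "v \<in> U0"
  shows "unit_factor t1 c v \<noteq> 0"
proof
  assume "unit_factor t1 c v = 0"
  hence "\<forall>x\<in>I. e x v * ((\<Sum>i\<in>X. c $ i * A x i v) + t1 * (\<Sum>i\<in>D. \<Sum>j\<in>D. c $ i * c $ j * B x i j v))\<^sup>2 = 0"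
    unfolding unit_factor_def
    by (subst (asm) sum_nonneg_eq_0_iff[OF fin_I]) (use e_pos v in \<open>auto intro!: mult_nonneg_nonneg less_imp_le[OF e_pos]\<close>)
  hence eq: "(\<Sum>i\<in>X. c $ i * A x i v) + t1 * (\<Sum>i\<in>D. \<Sum>j\<in>D. c $ i * c $ j * B x i j v) = 0" if "x \<in> I" for x
    using that e_pos[OF that v] by fastforce
  from adm obtain l where l: "ypt t1 c l \<noteq> 0" by (auto simp: adm_def)
  hence lXD: "l \<in> X \<union> D" by (auto simp: ypt_def split: if_splits)
  define d where "d = (\<chi> i. if i \<in> X then (if t1 = 0 then c $ i else c $ i / t1) else if t1 = 0 then 0 else c $ i)"
  have "(\<Sum>i\<in>X. d $ i * A x i v) + (\<Sum>i\<in>D. \<Sum>j\<in>D. d $ i * d $ j * B x i j v) = 0" if "x \<in> I" for x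
  proof (cases "t1 = 0")
    case True
    have "(\<Sum>i\<in>X. d $ i * A x i v) = (\<Sum>i\<in>X. c $ i * A x i v)"
      by (rule sum.cong) (auto simp: d_def True)
    moreover have "(\<Sum>i\<in>D. \<Sum>j\<in>D. d $ i * d $ j * B x i j v) = 0"
      by (intro sum.neutral ballI) (use disj in \<open>auto simp: d_def True\<close>)
    ultimately show ?thesis using eq[OF that] True by simp
  next
    case False
    have "(\<Sum>i\<in>X. d $ i * A x i v) = (\<Sum>i\<in>X. c $ i * A x i v) / t1"
      unfolding sum_divide_distrib by (rule sum.cong) (auto simp: d_def False)
    moreover have "(\<Sum>i\<in>D. \<Sum>j\<in>D. d $ i * d $ j * B x i j v) = (\<Sum>i\<in>D. \<Sum>j\<in>D. c $ i * c $ j * B x i j v)"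
      by (intro sum.cong refl) (use disj in \<open>auto simp: d_def False\<close>)
    moreover have "(\<Sum>i\<in>X. c $ i * A x i v) / t1 + (\<Sum>i\<in>D. \<Sum>j\<in>D. c $ i * c $ j * B x i j v) = 0"
    proof -
      have "s / t + b = 0" if "s + t * b = 0" "t \<noteq> 0" for s t b :: real
        using that by (simp add: field_simps)
      thus ?thesis using eq[OF that] False by blast
    qed
    ultimately show ?thesis by (simp only:)
  qed
  from nondegenerate[OF v this lXD] have "d $ l = 0" .
  thus False using l by (auto simp: d_def ypt_def split: if_splits)
qed

lemma F_zero_iff:
  assumes "adm t1 t2 c" "vpt t1 t2 c \<in> U0"
  shows "F (\<Psi> (vpt t1 t2 c)) = 0 \<longleftrightarrow> t1 = 0 \<or> t2 = 0"
  using unit_factor_nz[OF assms] by (auto simp: F_factor[OF assms(2)])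

lemma vpt_1 [simp]: "vpt 1 1 v = v" by (simp add: vpt_def vec_eq_iff)

lemma adm_1: "adm 1 1 v \<longleftrightarrow> (\<exists>l\<in>X \<union> D. v $ l \<noteq> 0)"
  by (auto simp: adm_def zpt_def ypt_def)

lemma F_nz_iff:
  assumes "v \<in> U0"
  shows "F (\<Psi> v) \<noteq> 0 \<longleftrightarrow> (\<exists>l\<in>X \<union> D. v $ l \<noteq> 0)"
proof (cases "\<exists>l\<in>X \<union> D. v $ l \<noteq> 0")
  case True
  hence "F (\<Psi> v) \<noteq> 0" using F_zero_iff[of 1 1 v] assms adm_1 by simp
  thus ?thesis using True by simp
next
  case False
  hence "F (\<Psi> v) = 0" using F_form[OF assms] by simp
  thus ?thesis using False by simp
qed

text \<open>Local coordinates at \<open>Q\<close> are obtained by translation. If the pivot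
  coordinates already vanish at \<open>Q\<close>, the translation leaves them alone, and the
  monomials, which involve only pivots, keep their form.\<close>

definition centred_chart :: "(nat \<Rightarrow> real) \<Rightarrow> 'n blowup_chart \<Rightarrow> bool" where
  "centred_chart Q ch \<longleftrightarrow> valid ch \<and> Q \<in> dom ch \<and> (\<forall>l\<in>chart_pivots ch. chart_fun ch Q $ l = 0)"

text \<open>The chart is chosen by the divisors through the point: \<open>ChartX\<close> on
  \<open>t1 = 0\<close> alone, \<open>ChartD\<close> on \<open>t2 = 0\<close> alone,
  \<open>ChartXD\<close> on their intersection.\<close>

lemma ex_centred_chart:
  assumes Q: "Q \<in> Mfd" "F (gm Q) = 0"
  shows "\<exists>ch. centred_chart Q ch"
proof -
  from Q(1) obtain t1 t2 c where p: "Q = emb t1 t2 c" "adm t1 t2 c" "vpt t1 t2 c \<in> U0"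
    by (auto simp: Mfd_def)
  have z: "t1 = 0 \<or> t2 = 0" using Q(2) F_zero_iff[OF p(2,3)] by (simp add: gm_def p)
  have nz: "nrm (zpt t2 c) \<noteq> 0" "nrm (ypt t1 c) \<noteq> 0" using adm_nrm[OF p(2)] by auto
  from p(2) obtain l l' where l: "zpt t2 c l \<noteq> 0" "ypt t1 c l' \<noteq> 0" by (auto simp: adm_def)
  consider "t2 \<noteq> 0" "t1 = 0" | "t1 \<noteq> 0" "t2 = 0" | "t1 = 0" "t2 = 0" using z by auto
  thus ?thesis
  proof cases
    case 1
    hence "l' \<in> X" "c $ l' \<noteq> 0" using l by (auto simp: ypt_def split: if_splits)
    hence "centred_chart Q (ChartX l')"
      using 1 Q(1) nz by (auto simp: centred_chart_def dom_def chart_fun_def p(1) zpt_def vpt_def)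
    thus ?thesis by blast
  next
    case 2
    hence "l \<in> D" "l \<notin> X" "c $ l \<noteq> 0" using l by (auto simp: zpt_def split: if_splits)
    hence "centred_chart Q (ChartD l)"
      using 2 Q(1) nz by (auto simp: centred_chart_def dom_def chart_fun_def p(1) zpt_def vpt_def ypt_def)
    thus ?thesis by blast
  next
    case 3
    hence "l \<in> D" "l \<notin> X" "c $ l \<noteq> 0" "l' \<in> X" "c $ l' \<noteq> 0" using l by (auto simp: zpt_def ypt_def split: if_splits)
    hence "centred_chart Q (ChartXD l' l)"
      using 3 Q(1) nz disj by (auto simp: centred_chart_def dom_def chart_fun_def p(1) zpt_def vpt_def ypt_def)
    thus ?thesis by blast
  qed
qed

lemma normal_crossing:
  assumes "centred_chart Q ch"
  shows "normal_crossing_at F Top Atlas gm Q (kexp ch) (hexp ch)"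
proof -
  have ch: "valid ch" and Q: "Q \<in> dom ch" and piv: "\<And>l. l \<in> chart_pivots ch \<Longrightarrow> chart_fun ch Q $ l = 0"
    using assms by (auto simp: centred_chart_def)
  define q where "q = chart_fun ch Q"
  have q: "q \<in> cod ch" using dom_par[OF ch Q] by (simp add: q_def)
  define \<phi> where "\<phi> = tchart ch q"
  define a where "a u = unit_factor (chart_t1 ch (u + q)) (chart_c ch (u + q)) (parv ch (u + q))" for u
  define b where "b u = jac (parv ch (u + q))" for u
  have img: "\<phi> ` dom ch = {u. u + q \<in> cod ch}" unfolding \<phi>_def by (rule tchart_image[OF ch])
  have opn: "open (\<phi> ` dom ch)" unfolding img by (rule open_tchart_image[OF ch])
  have inv: "inv_into (dom ch) \<phi> u = par ch (u + q)" if "u \<in> \<phi> ` dom ch" for u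
    using inv_tchart[OF ch order_refl, of u q] that by (simp add: \<phi>_def)
  have U: "parv ch (u + q) \<in> U0" if "u \<in> \<phi> ` dom ch" for u
    using that by (simp add: img cod_def)
  have vec0: "(0 :: real^'n) \<in> \<phi> ` dom ch" using q by (simp add: img)
  have shift: "(u + q) $ l ^ kexp ch l = u $ l ^ kexp ch l" "(u + q) $ l ^ hexp ch l = u $ l ^ hexp ch l" for u l
    using piv[of l] by (cases ch; auto simp: q_def)+
  have a_an: "real_analytic_on a (\<phi> ` dom ch)"
    unfolding real_analytic_on_def a_def unit_factor_def
    by (intro ballI real_analytic_intros parv_comp_analytic[OF ch] e_an A_an B_an U
        real_analytic_at_add_const chart_analytic) auto
  have b_an: "real_analytic_on b (\<phi> ` dom ch)"
    unfolding real_analytic_on_def b_def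
    by (intro ballI parv_comp_analytic[OF ch] jac_an U)
  have a0: "a 0 \<noteq> 0" unfolding a_def by (rule unit_factor_nz[OF adm_chart[OF ch] U[OF vec0]])
  have b0: "b 0 \<noteq> 0" unfolding b_def by (rule jac_nz[OF U[OF vec0]])
  have Fg: "F (gm (inv_into (dom ch) \<phi> u)) = a u * (\<Prod>i\<in>UNIV. u $ i ^ kexp ch i)" if u: "u \<in> \<phi> ` dom ch" for u
  proof -
    have "F (gm (inv_into (dom ch) \<phi> u)) = F (\<Psi> (parv ch (u + q)))"
      using u by (simp add: inv gm_par)
    also have "\<dots> = (chart_t1 ch (u + q) * (chart_t2 ch (u + q))\<^sup>2)\<^sup>2 * a u"
      using F_factor U[OF u] unfolding parv_def a_def by blast
    also have "(chart_t1 ch (u + q) * (chart_t2 ch (u + q))\<^sup>2)\<^sup>2 = (\<Prod>i\<in>UNIV. u $ i ^ kexp ch i)"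
      unfolding prod_kexp[OF ch, symmetric] by (simp only: shift)
    finally show ?thesis by (simp add: mult.commute)
  qed
  have J: "\<bar>det (jacobian (gm \<circ> inv_into (dom ch) \<phi>) (at u))\<bar> = \<bar>b u * (\<Prod>i\<in>UNIV. u $ i ^ hexp ch i)\<bar>"
    if u: "u \<in> \<phi> ` dom ch" for u
  proof -
    obtain f' where f': "(parv ch has_derivative f') (at (u + q))"
      "det (matrix f') = (\<Prod>l\<in>UNIV. (u + q) $ l ^ hexp ch l)"
      by (rule parv_derivative[OF ch])
    obtain \<Psi>' where \<Psi>': "(\<Psi> has_derivative \<Psi>') (at (parv ch (u + q)))" "det (matrix \<Psi>') = jac (parv ch (u + q))"
      using jac[OF U[OF u]] by blast
    have t: "((\<lambda>u. u + q) has_derivative (\<lambda>h. h)) (at u)" by (auto intro!: derivative_eq_intros)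
    have f2: "((\<lambda>u. parv ch (u + q)) has_derivative f') (at u)"
      using has_derivative_compose[OF t f'(1)] by simp
    note d = det_compose_derivative[where f=\<Psi> and g="\<lambda>u. parv ch (u + q)", OF \<Psi>'(1) f2]
    have "((gm \<circ> inv_into (dom ch) \<phi>) has_derivative (\<Psi>' \<circ> f')) (at u)"
      by (rule has_derivative_transform_within_open[OF d(1) opn u]) (simp add: inv gm_par)
    hence "frechet_derivative (gm \<circ> inv_into (dom ch) \<phi>) (at u) = \<Psi>' \<circ> f'"
      by (rule frechet_derivative_at[symmetric])
    thus ?thesis unfolding jacobian_def by (simp only: d(2) \<Psi>'(2) f'(2) b_def shift)
  qed
  have lc: "local_coordinates Top Atlas Q (dom ch) \<phi>"
    unfolding local_coordinates_def \<phi>_def using is_chart_tchart[OF ch] compatible[OF ch] Q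
    by (auto simp: Atlas_def tchart_def q_def)
  show ?thesis
    unfolding normal_crossing_at_def
    by (intro exI[of _ "dom ch"] exI[of _ \<phi>] exI[of _ a] exI[of _ b] conjI ballI lc a_an b_an a0 b0 Fg J)
qed

definition Nz :: "(real^'n) set" where "Nz = {w \<in> W. F w \<noteq> 0}"

definition S :: "(nat \<Rightarrow> real) set" where "S = {p \<in> Mfd. F (gm p) \<noteq> 0}"

lemma Nz_eq: "Nz = {w \<in> W. \<exists>l\<in>X \<union> D. \<Phi> w $ l \<noteq> 0}"
proof -
  have "F w \<noteq> 0 \<longleftrightarrow> (\<exists>l\<in>X \<union> D. \<Phi> w $ l \<noteq> 0)" if "w \<in> W" for w
    using F_nz_iff[OF \<Phi>_U0[OF that]] that by (simp add: \<Psi>_\<Phi>)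
  thus ?thesis unfolding Nz_def by blast
qed

lemma open_Nz: "open Nz"
proof -
  have "open (W \<inter> \<Phi> -` {v. v $ l \<noteq> 0})" for l
    by (rule continuous_open_preimage[OF \<Phi>_cont W])
      (intro open_Collect_neq continuous_intros)
  moreover have "Nz = (\<Union>l\<in>X \<union> D. W \<inter> \<Phi> -` {v. v $ l \<noteq> 0})" by (auto simp: Nz_eq)
  ultimately show ?thesis by (metis (no_types, lifting) open_UN)
qed

definition lift :: "real^'n \<Rightarrow> nat \<Rightarrow> real" where "lift w = emb 1 1 (\<Phi> w)"

lemma adm_\<Phi>: "w \<in> Nz \<Longrightarrow> adm 1 1 (\<Phi> w)" by (simp add: adm_1 Nz_eq)

lemma gm_lift: "w \<in> W \<Longrightarrow> gm (lift w) = w" by (simp add: gm_def lift_def \<Psi>_\<Phi>)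

lemma emb_Mfd: "adm t1 t2 c \<Longrightarrow> vpt t1 t2 c \<in> U0 \<Longrightarrow> emb t1 t2 c \<in> Mfd"
  unfolding Mfd_def by blast

lemma lift_S:
  assumes w: "w \<in> Nz" shows "lift w \<in> S"
proof -
  have "w \<in> W" "F w \<noteq> 0" using w by (simp_all add: Nz_def)
  moreover have "lift w \<in> Mfd"
    unfolding lift_def using \<open>w \<in> W\<close> by (intro emb_Mfd adm_\<Phi> w) (simp add: \<Phi>_U0)
  ultimately show ?thesis by (simp add: S_def gm_lift)
qed

lemma gm_Nz: "p \<in> S \<Longrightarrow> gm p \<in> Nz"
  by (auto simp: S_def Nz_def gm_def coord_v_Mfd \<Psi>_W)

lemma lift_gm:
  assumes "p \<in> S" shows "lift (gm p) = p"
proof -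
  from assms obtain t1 t2 c where p: "p = emb t1 t2 c" "adm t1 t2 c" "vpt t1 t2 c \<in> U0" "F (\<Psi> (vpt t1 t2 c)) \<noteq> 0"
    by (auto simp: S_def Mfd_def gm_def)
  hence "t1 \<noteq> 0" "t2 \<noteq> 0" using F_zero_iff[OF p(2,3)] by auto
  thus ?thesis using p by (simp add: lift_def gm_def \<Phi>_\<Psi> emb_unscaled)
qed

lemma S_Mfd: "S \<subseteq> Mfd" by (auto simp: S_def)

lemma iso_off_zeros:
  "analytic_iso (subtopology Top S) (restrict_atlas S Atlas) (top_of_set Nz) (id_atlas Nz) gm"
  unfolding analytic_iso_def
proof (intro exI conjI)
  have sub: "subtopology Top S = top_of_set S"
    using S_Mfd by (simp add: Top_def subtopology_subtopology Int_absorb1)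
  have c1: "continuous_map (top_of_set S) (top_of_set Nz) gm"
    using continuous_on_subset[OF continuous_gm S_Mfd] gm_Nz by (auto simp: continuous_map_in_subtopology)
  have "continuous_on Nz lift"
    unfolding lift_def[abs_def]
    by (intro continuous_on_emb continuous_on_const continuous_on_subset[OF \<Phi>_cont] adm_\<Phi>) (auto simp: Nz_def)
  hence c2: "continuous_map (top_of_set Nz) (top_of_set S) lift"
    using lift_S by (auto simp: continuous_map_in_subtopology)
  show "homeomorphic_maps (subtopology Top S) (top_of_set Nz) gm lift"
    unfolding homeomorphic_maps_def sub using c1 c2 lift_gm gm_lift by (auto simp: Nz_def)
  have "vec_analytic_on ((\<lambda>x. x) \<circ> gm \<circ> inv_into (dom ch \<inter> S) (tchart ch 0))
      (tchart ch 0 ` {p \<in> dom ch \<inter> S. gm p \<in> Nz})" if ch: "valid ch" for ch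
    unfolding vec_analytic_on_def real_analytic_on_def
  proof (intro allI ballI)
    fix l u assume u: "u \<in> tchart ch 0 ` {p \<in> dom ch \<inter> S. gm p \<in> Nz}"
    \<comment> \<open>Analyticity needs an open set of chart coordinates on which the inverse of the
      restricted chart is \<open>par\<close>; \<open>F \<noteq> 0\<close> is expressed there by a
      nonzero entry of \<open>parv\<close>.\<close>
    define O' where "O' = {u. u + 0 \<in> cod ch} \<inter> (\<Union>m\<in>X \<union> D. {u. parv ch u $ m \<noteq> 0})"
    have "open O'"
      unfolding O'_def
      by (intro open_Int open_tchart_image[OF ch] open_UN ballI open_Collect_neq continuous_intros continuous_on_parv)
    have O': "O' \<subseteq> tchart ch 0 ` (dom ch \<inter> S)"
    proof
      fix u assume "u \<in> O'"
      hence c: "u \<in> cod ch" and "\<exists>m\<in>X \<union> D. parv ch u $ m \<noteq> 0" by (auto simp: O'_def)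
      hence "F (gm (par ch u)) \<noteq> 0" using F_nz_iff[of "parv ch u"] by (simp add: gm_par cod_def)
      hence "par ch u \<in> dom ch \<inter> S" using par_in_dom[OF ch c] by (auto simp: S_def dom_def)
      thus "u \<in> tchart ch 0 ` (dom ch \<inter> S)"
        using tchart_par[OF ch, of 0 u] by (metis diff_zero image_eqI)
    qed
    have uO: "u \<in> O'"
    proof -
      from u obtain p where p: "p \<in> dom ch" "p \<in> S" "u = tchart ch 0 p" by auto
      have pu: "par ch u = p" "u \<in> cod ch" using dom_par[OF ch p(1)] p by (simp_all add: tchart_def)
      have "F (\<Psi> (parv ch u)) \<noteq> 0" using p pu by (simp add: S_def flip: gm_par)
      thus ?thesis using F_nz_iff[of "parv ch u"] pu by (auto simp: O'_def cod_def)
    qed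
    have "real_analytic_at (\<lambda>u. \<Psi> (parv ch (u + 0)) $ l) u"
      by (intro parv_comp_analytic[OF ch] \<Psi>_an) (use uO in \<open>simp add: O'_def cod_def\<close>)
    thus "real_analytic_at (\<lambda>u. ((\<lambda>x. x) \<circ> gm \<circ> inv_into (dom ch \<inter> S) (tchart ch 0)) u $ l) u"
      by (rule real_analytic_at_cong[OF _ \<open>open O'\<close> uO])
        (use O' inv_tchart[OF ch, of "dom ch \<inter> S"] in \<open>auto simp: gm_par subset_iff\<close>)
  qed
  thus "analytic_map (subtopology Top S) (restrict_atlas S Atlas) (top_of_set Nz) (id_atlas Nz) gm"
    unfolding analytic_map_def using c1 by (auto simp: sub restrict_atlas_def Atlas_def id_atlas_def)
  have "vec_analytic_on (tchart ch 0 \<circ> lift \<circ> inv_into Nz (\<lambda>x. x)) ((\<lambda>x. x) ` {w \<in> Nz. lift w \<in> dom ch \<inter> S})"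
    if ch: "valid ch" for ch
    unfolding vec_analytic_on_def real_analytic_on_def
  proof (intro allI ballI)
    fix l w assume "w \<in> (\<lambda>x. x) ` {w \<in> Nz. lift w \<in> dom ch \<inter> S}"
    hence w: "w \<in> Nz" "w \<in> W" "lift w \<in> dom ch" by (auto simp: Nz_def)
    have "real_analytic_at (\<lambda>w. chart_fun ch (lift w) $ l) w"
    proof (rule real_analytic_at_chart_fun)
      show "chart_dom ch (lift w)" using w by (simp add: dom_def)
    qed (unfold lift_def, (intro real_analytic_at_emb real_analytic_at_const \<Phi>_an w adm_\<Phi> ch)+)
    thus "real_analytic_at (\<lambda>w. (tchart ch 0 \<circ> lift \<circ> inv_into Nz (\<lambda>x. x)) w $ l) w"
      by (rule real_analytic_at_cong[OF _ open_Nz w(1)])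
        (simp add: tchart_def inv_into_f_f[where f="\<lambda>x. x", OF inj_on_id2])
  qed
  thus "analytic_map (top_of_set Nz) (id_atlas Nz) (subtopology Top S) (restrict_atlas S Atlas) lift"
    unfolding analytic_map_def using c2 by (auto simp: sub restrict_atlas_def Atlas_def id_atlas_def)
qed

definition the_chart :: "(nat \<Rightarrow> real) \<Rightarrow> 'n blowup_chart" where
  "the_chart Q = (SOME ch. centred_chart Q ch)"

lemma zero_fibre_eq: "zero_fibre F Top gm = {Q \<in> Mfd. F (gm Q) = 0}"
  by (simp add: zero_fibre_def)

lemma the_chart: "Q \<in> zero_fibre F Top gm \<Longrightarrow> centred_chart Q (the_chart Q)"
  unfolding the_chart_def by (rule someI_ex, rule ex_centred_chart) (simp_all add: zero_fibre_eq)

lemma resolution: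
  "is_resolution F W Top Atlas gm (\<lambda>Q. kexp (the_chart Q)) (\<lambda>Q. hexp (the_chart Q))"
proof -
  have S: "topspace Top - zero_fibre F Top gm = S" by (auto simp: zero_fibre_eq S_def)
  show ?thesis
    unfolding is_resolution_def S Nz_def[symmetric]
    using manifold analytic_gm proper_gm iso_off_zeros normal_crossing the_chart by auto
qed

text \<open>The critical divisor meets the fibre over every point of the centre. For nonempty
  \<open>D\<close> take \<open>t2 = 0\<close>; for empty \<open>D\<close> all entries of
  \<open>z\<close> are multiples of \<open>t2\<close>, so \<open>t2\<close> cannot vanish and
  \<open>t1 = 0\<close> is used.\<close>

lemma exceptional_point:
  assumes P: "P \<in> W" "\<And>l. l \<in> X \<union> D \<Longrightarrow> \<Phi> P $ l = 0"
  obtains Q where "Q \<in> zero_fibre F Top gm" "gm Q = P"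
    "card {l. exponent_ratio (kexp (the_chart Q) l) (hexp (the_chart Q) l) = thr} = 1"
proof (cases "D = {}")
  case True
  obtain i where i: "i \<in> X" using X_ne by auto
  define c where "c = (\<chi> l. if l \<in> X then 1 else \<Phi> P $ l)"
  have v: "vpt 0 1 c = \<Phi> P" unfolding vec_eq_iff vpt_def c_def using P(2) True by simp
  have "zpt 1 c i \<noteq> 0" "ypt 0 c i \<noteq> 0" using i by (auto simp: zpt_def ypt_def c_def)
  hence adm: "adm 0 1 c" unfolding adm_def by blast
  define Q where "Q = emb 0 1 c"
  have gQ: "gm Q = P" by (simp add: gm_def Q_def v \<Psi>_\<Phi> P)
  have Q: "Q \<in> zero_fibre F Top gm"
    using emb_Mfd[OF adm] v \<Phi>_U0[OF P(1)] F_zero_iff[OF adm] by (simp add: zero_fibre_eq Q_def gm_def)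
  have "valid (the_chart Q)" using the_chart[OF Q] by (simp add: centred_chart_def)
  hence "card {l. exponent_ratio (kexp (the_chart Q) l) (hexp (the_chart Q) l) = thr} = 1"
    using True by (subst critical_exponent) (auto split: blowup_chart.split)
  thus thesis using Q gQ that by blast
next
  case False
  then obtain j where j: "j \<in> D" "j \<notin> X" using disj by auto
  define c where "c = (\<chi> l. if l \<in> X \<union> D then 1 else \<Phi> P $ l)"
  have v: "vpt 1 0 c = \<Phi> P" using P(2) by (auto simp: vec_eq_iff vpt_def c_def)
  have "zpt 0 c j \<noteq> 0" "ypt 1 c j \<noteq> 0" using j by (auto simp: zpt_def ypt_def c_def)
  hence adm: "adm 1 0 c" unfolding adm_def by blast
  define Q where "Q = emb 1 0 c"
  have gQ: "gm Q = P" by (simp add: gm_def Q_def v \<Psi>_\<Phi> P)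
  have Q: "Q \<in> zero_fibre F Top gm"
    using emb_Mfd[OF adm] v \<Phi>_U0[OF P(1)] F_zero_iff[OF adm] by (simp add: zero_fibre_eq Q_def gm_def)
  have ch: "valid (the_chart Q)" "chart_dom (the_chart Q) Q"
    using the_chart[OF Q] by (auto simp: centred_chart_def dom_def)
  \<comment> \<open>On \<open>t2 = 0\<close> the \<open>X\<close> entries of \<open>z\<close>
    vanish, which leaves only charts in which the second divisor is a coordinate hyperplane.\<close>
  have "the_chart Q \<noteq> ChartX i" for i
  proof
    assume eq: "the_chart Q = ChartX i"
    hence "i \<in> X" using ch(1) by simp
    hence "coord_z Q i i = 0" by (simp add: Q_def zpt_def)
    thus False using ch(2) eq by simp
  qed
  hence "card {l. exponent_ratio (kexp (the_chart Q) l) (hexp (the_chart Q) l) = thr} = 1"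
    using ch(1) by (subst critical_exponent) (auto split: blowup_chart.split)
  thus thesis using Q gQ that by blast
qed

theorem has_rlct_thr:
  assumes P: "P \<in> W" "\<And>l. l \<in> X \<union> D \<Longrightarrow> \<Phi> P $ l = 0"
  shows "has_rlct F P thr 1"
  unfolding has_rlct_def
proof (intro conjI allI impI exI)
  show "F P = 0" using F_nz_iff[OF \<Phi>_U0[OF P(1)]] P by (auto simp: \<Psi>_\<Phi>)
  show "\<exists>w\<in>W'. F w \<noteq> 0" if W': "open W' \<and> P \<in> W'" for W'
  proof -
    obtain i where i: "i \<in> X" using X_ne by auto
    \<comment> \<open>Moving from \<open>\<Phi> P\<close> along an axis in \<open>X\<close> leaves
      the zero set at once, so \<open>F\<close> does not vanish identically near
      \<open>P\<close>.\<close>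
    define line where "line t = \<Phi> P + t *\<^sub>R axis i 1" for t :: real
    have "open (U0 \<inter> \<Psi> -` W')" using continuous_open_preimage[OF \<Psi>_cont U0] W' by blast
    moreover have "continuous_on UNIV line" unfolding line_def[abs_def] by (intro continuous_intros)
    ultimately have "open (line -` (U0 \<inter> \<Psi> -` W'))" by (metis continuous_on_open_vimage open_UNIV Int_UNIV_right)
    moreover have "0 \<in> line -` (U0 \<inter> \<Psi> -` W')" using W' P \<Phi>_U0 by (simp add: line_def \<Psi>_\<Phi>)
    ultimately obtain d where d: "0 < d" "ball 0 d \<subseteq> line -` (U0 \<inter> \<Psi> -` W')"
      using open_contains_ball by blast
    have "d / 2 \<in> ball (0 :: real) d" using d by simp
    hence "line (d / 2) \<in> U0" "\<Psi> (line (d / 2)) \<in> W'" using d(2) by blast+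
    moreover have "line (d / 2) $ i \<noteq> 0" using d P(2)[of i] i by (simp add: line_def)
    ultimately show ?thesis using F_nz_iff[of "line (d / 2)"] i by blast
  qed
  show "open W" by (rule W)
  show "P \<in> W" by (rule P)
  show "real_analytic_on F W" by (rule F_an)
  show "is_resolution F W Top Atlas gm (\<lambda>Q. kexp (the_chart Q)) (\<lambda>Q. hexp (the_chart Q))" by (rule resolution)
  fix W' assume W': "open W' \<and> P \<in> W' \<and> W' \<subseteq> W"
  \<comment> \<open>\<open>Q0\<close> lies over \<open>P\<close> itself, hence over every
    \<open>W'\<close>; this makes the infimum and the maximum the same for all of them.\<close>
  obtain Q0 where Q0: "Q0 \<in> zero_fibre F Top gm" "gm Q0 = P"
    "card {l. exponent_ratio (kexp (the_chart Q0) l) (hexp (the_chart Q0) l) = thr} = 1"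
    using exceptional_point[OF P] by blast
  let ?Z = "{Q \<in> zero_fibre F Top gm. gm Q \<in> W'}"
  have Q0Z: "Q0 \<in> ?Z" using Q0 W' by simp
  have v: "valid (the_chart Q)" if "Q \<in> ?Z" for Q using the_chart[of Q] that by (simp add: centred_chart_def)
  show "thr = (INF Q\<in>?Z. Min (range (\<lambda>i. exponent_ratio (kexp (the_chart Q) i) (hexp (the_chart Q) i))))"
  proof (rule antisym)
    show "thr \<le> (INF Q\<in>?Z. Min (range (\<lambda>i. exponent_ratio (kexp (the_chart Q) i) (hexp (the_chart Q) i))))"
      by (rule INF_greatest) (rule Min_exponent_ratio_ge[OF v])
    obtain l where "exponent_ratio (kexp (the_chart Q0) l) (hexp (the_chart Q0) l) = thr"
      using Q0(3) by (metis (mono_tags, lifting) card_1_singletonE insertI1 mem_Collect_eq)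
    hence "Min (range (\<lambda>i. exponent_ratio (kexp (the_chart Q0) i) (hexp (the_chart Q0) i))) \<le> thr"
      by (intro Min_le) (auto simp: image_iff intro!: exI[of _ l])
    with INF_lower[OF Q0Z]
    show "(INF Q\<in>?Z. Min (range (\<lambda>i. exponent_ratio (kexp (the_chart Q) i) (hexp (the_chart Q) i)))) \<le> thr"
      by (rule order_trans)
  qed
  have le1: "card {l. exponent_ratio (kexp (the_chart Q) l) (hexp (the_chart Q) l) = thr} \<le> 1" if "Q \<in> ?Z" for Q
    unfolding critical_exponent[OF v[OF that]] by (auto split: blowup_chart.split)
  show "1 = Max ((\<lambda>Q. card {i. exponent_ratio (kexp (the_chart Q) i) (hexp (the_chart Q) i) = thr}) ` ?Z)"
  proof (rule Max_eqI[symmetric])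
    have "((\<lambda>Q. card {i. exponent_ratio (kexp (the_chart Q) i) (hexp (the_chart Q) i) = thr}) ` ?Z) \<subseteq> {..1}"
      using le1 by auto
    thus "finite ((\<lambda>Q. card {i. exponent_ratio (kexp (the_chart Q) i) (hexp (the_chart Q) i) = thr}) ` ?Z)"
      by (rule finite_subset) simp
    show "1 \<in> (\<lambda>Q. card {i. exponent_ratio (kexp (the_chart Q) i) (hexp (the_chart Q) i) = thr}) ` ?Z"
      using Q0Z Q0(3) by (intro image_eqI[of _ _ Q0]) auto
  qed (use le1 in auto)
qed

end

section \<open>Kullback--Leibler divergence of binomial mixtures\<close>

text \<open>\<open>f y - f x\<close> vanishes at \<open>x\<close>, so its majorant can be made
  smaller than any given \<open>\<epsilon>\<close> on a cube.\<close>

lemma real_analytic_at_imp_isCont: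
  fixes f :: "real^'n \<Rightarrow> real"
  assumes "real_analytic_at f x"
  shows "isCont f x"
  unfolding continuous_at_eps_delta
proof (intro allI impI)
  fix \<epsilon> :: real assume \<epsilon>: "0 < \<epsilon>"
  have an: "real_analytic_at (\<lambda>y. f y - f x) x"
    by (intro real_analytic_intros assms)
  have "\<bar>f x - f x\<bar> < \<epsilon>" using \<epsilon> by simp
  with an show "\<exists>d>0. \<forall>y. dist y x < d \<longrightarrow> dist (f y) (f x) < \<epsilon>"
  proof (rule real_analytic_at_small_majorant[where f="\<lambda>y. f y - f x"])
    fix a \<rho> G
    assume \<rho>: "0 < \<rho>" and G: "G < \<epsilon>" and
      a: "\<And>y. (\<And>i. \<bar>y $ i - x $ i\<bar> < \<rho>) \<Longrightarrow>
         ((\<lambda>\<alpha>. a \<alpha> * (\<Prod>i\<in>UNIV. (y $ i - x $ i) ^ \<alpha> i)) has_sum (f y - f x)) UNIV" and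
      S: "((\<lambda>\<alpha>. \<bar>a \<alpha>\<bar> * (\<Prod>i\<in>UNIV. \<rho> ^ \<alpha> i)) has_sum G) UNIV"
    have "dist (f y) (f x) < \<epsilon>" if y: "dist y x < \<rho>" for y
    proof -
      have yi: "\<bar>y $ i - x $ i\<bar> < \<rho>" for i
        using component_le_norm_cart[of "y - x" i] y by (simp add: dist_norm)
      define t where "t \<alpha> = a \<alpha> * (\<Prod>i\<in>UNIV. (y $ i - x $ i) ^ \<alpha> i)" for \<alpha>
      have t: "(t has_sum (f y - f x)) UNIV" unfolding t_def by (rule a[OF yi])
      have at: "((\<lambda>\<alpha>. \<bar>t \<alpha>\<bar>) has_sum (\<Sum>\<^sub>\<infinity>\<alpha>. \<bar>t \<alpha>\<bar>)) UNIV"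
        by (intro has_sum_infsum summable_on_abs_real has_sum_imp_summable[OF t])
      have "\<bar>f y - f x\<bar> \<le> (\<Sum>\<^sub>\<infinity>\<alpha>. \<bar>t \<alpha>\<bar>)"
        using norm_has_sum_bound[OF _ t] at by simp
      also have "\<dots> \<le> G"
      proof (rule has_sum_mono[OF at S])
        fix \<alpha> show "\<bar>t \<alpha>\<bar> \<le> \<bar>a \<alpha>\<bar> * (\<Prod>i\<in>UNIV. \<rho> ^ \<alpha> i)"
          unfolding t_def abs_mult abs_prod power_abs
          using less_imp_le[OF yi] by (intro mult_left_mono prod_mono conjI power_mono) auto
      qed
      finally show ?thesis using G by (simp add: dist_real_def)
    qed
    thus ?thesis using \<rho> by blast
  qed
qed

lemma real_analytic_at_imp_continuous_on:
  fixes f :: "real^'n \<Rightarrow> real"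
  assumes "\<And>x. x \<in> S \<Longrightarrow> real_analytic_at f x"
  shows "continuous_on S f"
  using real_analytic_at_imp_isCont[OF assms] by (simp add: continuous_at_imp_continuous_on)

text \<open>The weighted form is non-degenerate near any point at which it is: by weighted homogeneity it
  suffices to look at the compact weighted unit sphere.\<close>

lemma nondegenerate_nhd:
  fixes X D :: "'n::finite set" and A :: "'x \<Rightarrow> 'n \<Rightarrow> real^'n \<Rightarrow> real" and B :: "'x \<Rightarrow> 'n \<Rightarrow> 'n \<Rightarrow> real^'n \<Rightarrow> real"
  defines "form \<equiv> \<lambda>x v (c :: real^'n). (\<Sum>i\<in>X. c $ i * A x i v) + (\<Sum>i\<in>D. \<Sum>j\<in>D. c $ i * c $ j * B x i j v)"
  assumes disj: "X \<inter> D = {}" and I: "finite I" and U: "open U" "p \<in> U"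
    and A: "\<And>x i. x \<in> I \<Longrightarrow> i \<in> X \<Longrightarrow> continuous_on U (A x i)"
    and B: "\<And>x i j. x \<in> I \<Longrightarrow> i \<in> D \<Longrightarrow> j \<in> D \<Longrightarrow> continuous_on U (B x i j)"
    and nd: "\<And>c l. (\<And>x. x \<in> I \<Longrightarrow> form x p c = 0) \<Longrightarrow> l \<in> X \<union> D \<Longrightarrow> c $ l = 0"
  obtains U' where "open U'" "p \<in> U'" "U' \<subseteq> U"
    "\<And>v c l. v \<in> U' \<Longrightarrow> (\<And>x. x \<in> I \<Longrightarrow> form x v c = 0) \<Longrightarrow> l \<in> X \<union> D \<Longrightarrow> c $ l = 0"
proof -
  \<comment> \<open>Homogeneous of weight 4 when \<open>X\<close> has weight 2 and \<open>D\<close>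
    weight 1.\<close>
  define N where "N c = (\<Sum>i\<in>X. (c $ i)\<^sup>2) + (\<Sum>i\<in>D. (c $ i)\<^sup>2)\<^sup>2" for c :: "real^'n"
  \<comment> \<open>The remaining coordinates do not enter \<open>N\<close>; setting them to 0 makes
    the weighted sphere compact.\<close>
  define C where "C = {c. N c = 1} \<inter> (\<Inter>l\<in>- (X \<union> D). {c. c $ l = 0})"
  have Npos: "N c > 0" if "c $ l \<noteq> 0" "l \<in> X \<union> D" for c l
  proof (cases "l \<in> X")
    case True
    have "0 < (\<Sum>i\<in>X. (c $ i)\<^sup>2)" by (rule sum_pos2[of _ l]) (use that True in auto)
    thus ?thesis unfolding N_def by (intro add_pos_nonneg) auto
  next
    case False
    have "0 < (\<Sum>i\<in>D. (c $ i)\<^sup>2)" by (rule sum_pos2[of _ l]) (use that False in auto)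
    thus ?thesis unfolding N_def by (intro add_nonneg_pos sum_nonneg) auto
  qed
  have contN: "continuous_on UNIV N" unfolding N_def[abs_def] by (intro continuous_intros)
  have "closed C"
    unfolding C_def
    by (intro closed_Int closed_INT ballI closed_Collect_eq contN continuous_on_const continuous_intros)
  moreover have "bounded C"
  proof (rule bounded_subset[OF bounded_cbox])
    show "C \<subseteq> cbox (\<chi> l. - 1) (\<chi> l. 1)"
    proof
      fix c assume c: "c \<in> C"
      have "\<bar>c $ l\<bar> \<le> 1" for l
      proof (rule ccontr)
        assume "\<not> \<bar>c $ l\<bar> \<le> 1"
        hence g: "1 < (c $ l)\<^sup>2" using abs_square_le_1 not_le by blast
        have l: "l \<in> X \<union> D"
        proof (rule ccontr)
          assume "l \<notin> X \<union> D"
          hence "c $ l = 0" using c by (simp add: C_def)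
          thus False using g by simp
        qed
        have s: "0 \<le> (\<Sum>i\<in>X. (c $ i)\<^sup>2)" "0 \<le> (\<Sum>i\<in>D. (c $ i)\<^sup>2)" by (auto intro: sum_nonneg)
        show False
        proof (cases "l \<in> X")
          case True
          have "(c $ l)\<^sup>2 \<le> (\<Sum>i\<in>X. (c $ i)\<^sup>2)" by (rule member_le_sum) (use True in auto)
          moreover have "N c = 1" using c by (simp add: C_def)
          ultimately show False using g zero_le_power2[of "\<Sum>i\<in>D. (c $ i)\<^sup>2"] unfolding N_def by linarith
        next
          case False
          have "(c $ l)\<^sup>2 \<le> (\<Sum>i\<in>D. (c $ i)\<^sup>2)" by (rule member_le_sum) (use False l in auto)
          hence "1 < (\<Sum>i\<in>D. (c $ i)\<^sup>2)" using g by linarith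
          hence "1 < (\<Sum>i\<in>D. (c $ i)\<^sup>2)\<^sup>2" by simp
          moreover have "N c = 1" using c by (simp add: C_def)
          ultimately show False using s unfolding N_def by linarith
        qed
      qed
      thus "c \<in> cbox (\<chi> l. - 1) (\<chi> l. 1)" by (auto simp: mem_box_cart abs_le_iff minus_le_iff)
    qed
  qed
  ultimately have cC: "compact C" by (simp add: compact_eq_bounded_closed)
  define G where "G = (\<lambda>z. \<Sum>x\<in>I. (form x (fst z) (snd z))\<^sup>2)"
  have contG: "continuous_on (U \<times> UNIV) G"
    unfolding G_def form_def
    by (intro continuous_intros continuous_on_compose2[OF A] continuous_on_compose2[OF B]) auto
  have opn: "open (U \<times> (UNIV :: (real^'n) set))" by (intro open_Times U open_UNIV)
  define O' where "O' = (U \<times> UNIV) \<inter> G -` (- {0})"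
  have "open O'" unfolding O'_def by (rule continuous_open_preimage[OF contG opn]) auto
  moreover have "{p} \<times> C \<subseteq> O'"
  proof clarify
    fix c assume c: "c \<in> C"
    have "G (p, c) \<noteq> 0"
    proof
      assume "G (p, c) = 0"
      hence "\<forall>x\<in>I. form x p c = 0" unfolding G_def by (subst (asm) sum_nonneg_eq_0_iff[OF I]) auto
      hence "\<forall>l\<in>X \<union> D. c $ l = 0" using nd by blast
      hence "N c = 0" unfolding N_def by simp
      thus False using c by (simp add: C_def)
    qed
    thus "(p, c) \<in> O'" using U by (simp add: O'_def)
  qed
  \<comment> \<open>\<open>G\<close> is nonzero on \<open>{p} \<times> C\<close>, and compactness of
    \<open>C\<close> spreads this to a whole neighbourhood of \<open>p\<close>.\<close>
  ultimately obtain U' V where U': "open U'" "p \<in> U'" "C \<subseteq> V" "U' \<times> V \<subseteq> O'"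
    using tube_lemma_right[of euclidean euclidean O' C p] cC by auto
  show thesis
  proof (rule that[of "U' \<inter> U"])
    fix v and c :: "real^'n" and l
    assume v: "v \<in> U' \<inter> U" and z: "\<And>x. x \<in> I \<Longrightarrow> form x v c = 0" and l: "l \<in> X \<union> D"
    show "c $ l = 0"
    proof (rule ccontr)
      assume nz: "c $ l \<noteq> 0"
      \<comment> \<open>The fourth root matches the weight 4 of \<open>N\<close>, so rescaling by
        \<open>r\<close> lands on the sphere; the form has weight 2 and is only divided by
        \<open>r\<^sup>2\<close>.\<close>
      define r where "r = sqrt (sqrt (N c))"
      have r: "0 < r" "r ^ 4 = N c"
        using Npos[OF nz l] power_mult[of r 2 2] by (auto simp: r_def)
      define c' where "c' = (\<chi> i. if i \<in> X then c $ i / r\<^sup>2 else if i \<in> D then c $ i / r else 0)"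
      have "(\<Sum>i\<in>D. (c' $ i)\<^sup>2) = (\<Sum>i\<in>D. (c $ i)\<^sup>2) / r\<^sup>2"
        unfolding sum_divide_distrib using disj
        by (intro sum.cong refl) (auto simp: c'_def power_divide)
      moreover have "(\<Sum>i\<in>X. (c' $ i)\<^sup>2) = (\<Sum>i\<in>X. (c $ i)\<^sup>2) / r ^ 4"
        unfolding sum_divide_distrib
        by (intro sum.cong refl) (simp add: c'_def power_divide flip: power_mult)
      ultimately have "N c' = (\<Sum>i\<in>X. (c $ i)\<^sup>2) / r ^ 4 + ((\<Sum>i\<in>D. (c $ i)\<^sup>2) / r\<^sup>2)\<^sup>2"
        by (simp only: N_def)
      also have "\<dots> = N c / r ^ 4"
        by (simp add: N_def power_divide add_divide_distrib flip: power_mult)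
      finally have "N c' = 1" using r Npos[OF nz l] by simp
      hence "c' \<in> C" by (auto simp: C_def c'_def)
      hence "(v, c') \<in> O'" using U' v by auto
      moreover have "form x v c' = form x v c / r\<^sup>2" for x
      proof -
        have "(\<Sum>i\<in>X. c' $ i * A x i v) = (\<Sum>i\<in>X. c $ i * A x i v) / r\<^sup>2"
          unfolding sum_divide_distrib by (intro sum.cong) (auto simp: c'_def)
        moreover have "(\<Sum>i\<in>D. \<Sum>j\<in>D. c' $ i * c' $ j * B x i j v) = (\<Sum>i\<in>D. \<Sum>j\<in>D. c $ i * c $ j * B x i j v) / r\<^sup>2"
          unfolding sum_divide_distrib using disj
          by (intro sum.cong refl) (auto simp: c'_def power2_eq_square)
        ultimately show ?thesis unfolding form_def by (simp add: add_divide_distrib)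
      qed
      hence "G (v, c') = 0" using z by (simp add: G_def)
      ultimately show False by (simp add: O'_def)
    qed
  qed (use U' U in auto)
qed

text \<open>Since \<open>p\<close> and \<open>q\<close> both sum to 1, \<open>K\<close> is the sum of \<open>q (r - ln (1 + r))\<close> with \<open>r = (p - q) / q\<close>.\<close>

definition log_defect :: "real \<Rightarrow> real" where
  "log_defect r = (if r = 0 then 1 / 2 else (r - ln (1 + r)) / r\<^sup>2)"

lemma log_defect: "r - ln (1 + r) = log_defect r * r\<^sup>2"
  by (simp add: log_defect_def)

lemma log_defect_pos:
  assumes "\<bar>r\<bar> < 1" shows "0 < log_defect r"
proof (cases "r = 0")
  case False
  have "ln (1 + r) < r"
    using ln_add_one_self_le_self2[of r] ln_eq_minus_one[of "1 + r"] assms False by force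
  thus ?thesis using False by (simp add: log_defect_def)
qed (simp add: log_defect_def)

text \<open>The logarithm series without its linear term, divided by \<open>r\<^sup>2\<close>. Its
  constant term is the value \<open>1 / 2\<close> chosen for \<open>log_defect\<close> at 0.\<close>

lemma log_defect_series:
  assumes r: "\<bar>r\<bar> < 1"
  shows "((\<lambda>n. (-1) ^ n / real (n + 2) * r ^ n) has_sum log_defect r) UNIV"
proof (rule has_sum_real_absI)
  show "summable (\<lambda>n. \<bar>(-1) ^ n / real (n + 2) * r ^ n\<bar>)"
  proof (rule summable_comparison_test'[of "\<lambda>n. \<bar>r\<bar> ^ n"])
    show "summable (\<lambda>n. \<bar>r\<bar> ^ n)" using r by (intro summable_geometric) auto
    show "norm \<bar>(-1) ^ n / real (n + 2) * r ^ n\<bar> \<le> \<bar>r\<bar> ^ n" for n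
      using divide_left_mono[of 1 "real (n + 2)" "\<bar>r\<bar> ^ n"] by (simp add: abs_mult power_abs)
  qed
  show "(\<lambda>n. (-1) ^ n / real (n + 2) * r ^ n) sums log_defect r"
  proof (cases "r = 0")
    case True
    have "(\<lambda>n. if n = 0 then 1 / 2 else 0 :: real) sums (1 / 2)"
      using sums_single[of 0 "\<lambda>_. 1 / 2 :: real"] by simp
    moreover have "(\<lambda>n. (-1) ^ n / real (n + 2) * r ^ n) = (\<lambda>n. if n = 0 then 1 / 2 else 0)"
      using True by (auto simp: fun_eq_iff)
    ultimately show ?thesis using True by (simp add: log_defect_def)
  next
    case False
    have "(\<lambda>n. - ((- r) ^ n) / real n) sums ln (1 + r)" by (rule ln_series'[OF r])
    hence "(\<lambda>n. - ((- r) ^ (n + 2)) / real (n + 2)) sums (ln (1 + r) - (\<Sum>n<2. - ((- r) ^ n) / real n))"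
      by (rule sums_split_initial_segment)
    \<comment> \<open>Of the two removed terms, the one for \<open>n = 0\<close> is a division by
      zero with value 0 and the one for \<open>n = 1\<close> is \<open>r\<close>.\<close>
    hence "(\<lambda>n. - ((- r) ^ (n + 2)) / real (n + 2)) sums (ln (1 + r) - r)"
      by (simp add: numeral_2_eq_2)
    from sums_mult[OF this, of "- 1 / r\<^sup>2"]
    have "(\<lambda>n. - 1 / r\<^sup>2 * (- ((- r) ^ (n + 2)) / real (n + 2))) sums (- 1 / r\<^sup>2 * (ln (1 + r) - r))" .
    moreover have "- 1 / r\<^sup>2 * (ln (1 + r) - r) = log_defect r"
      using False by (simp add: log_defect_def diff_divide_distrib)
    moreover have "- 1 / r\<^sup>2 * (- ((- r) ^ (n + 2)) / real (n + 2)) = (-1) ^ n / real (n + 2) * r ^ n" for n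
    proof -
      have "(- r) ^ (n + 2) = (-1) ^ n * r ^ n * r\<^sup>2"
        by (simp add: power_add power_minus[of r] power2_eq_square)
      thus ?thesis using False by simp
    qed
    ultimately show ?thesis by simp
  qed
qed

lemma real_analytic_at_log_defect:
  assumes "real_analytic_at f u" "\<bar>f u\<bar> < 1"
  shows "real_analytic_at (\<lambda>u. log_defect (f u)) u"
proof (rule real_analytic_at_power_series_comp[where h=log_defect and f=f and zc=0 and R=1
      and e="\<lambda>n. (-1) ^ n / real (n + 2)"])
  show "((\<lambda>n. (-1) ^ n / real (n + 2) * (z - 0) ^ n) has_sum log_defect z) UNIV" if "\<bar>z - 0\<bar> < 1" for z
    using log_defect_series[of z] that unfolding diff_0_right by blast
qed (use assms in simp_all)

section \<open>Binomial probabilities as a spanning set of polynomials\<close>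

definition binom_poly :: "nat \<Rightarrow> nat \<Rightarrow> real poly" where
  "binom_poly M x = smult (real (M choose x)) ([:0, 1:] ^ x * [:1, -1:] ^ (M - x))"

lemma poly_binom_poly: "poly (binom_poly M x) t = binom_prob M t x"
  by (simp add: binom_poly_def binom_prob_def poly_power)

lemma sum_binom_prob: "(\<Sum>x\<le>M. binom_prob M t x) = 1"
  unfolding binom_prob_def using binomial_ring[of t "1 - t" M] by simp

lemma binom_poly_span_monom:
  assumes "j \<le> M"
  obtains a where "monom 1 j = (\<Sum>x\<le>M. smult (a x) (binom_poly M x))"
proof
  \<comment> \<open>The coefficients come from expanding
    \<open>t ^ j * (t + (1 - t)) ^ (M - j)\<close>.\<close>
  define a where "a x = (if x < j then 0 else real (M - j choose (x - j)) / real (M choose x))" for x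
  have "poly (\<Sum>x\<le>M. smult (a x) (binom_poly M x)) t = poly (monom 1 j) t" for t
  proof -
    have "poly (\<Sum>x\<le>M. smult (a x) (binom_poly M x)) t = (\<Sum>x\<le>M. a x * binom_prob M t x)"
      by (simp add: poly_sum poly_binom_poly)
    also have "\<dots> = (\<Sum>x\<in>{j..M}. real (M - j choose (x - j)) * t ^ x * (1 - t) ^ (M - x))"
      by (intro sum.mono_neutral_cong_right) (auto simp: a_def binom_prob_def)
    also have "\<dots> = (\<Sum>y\<le>M - j. real (M - j choose y) * t ^ (y + j) * (1 - t) ^ (M - j - y))"
      by (rule sum.reindex_bij_witness[of _ "\<lambda>y. y + j" "\<lambda>x. x - j"]) (use assms in auto)
    also have "\<dots> = t ^ j * (\<Sum>y\<le>M - j. real (M - j choose y) * t ^ y * (1 - t) ^ (M - j - y))"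
      by (simp add: sum_distrib_left power_add mult_ac)
    also have "(\<Sum>y\<le>M - j. real (M - j choose y) * t ^ y * (1 - t) ^ (M - j - y)) = 1"
      using binomial_ring[of t "1 - t" "M - j"] by simp
    finally show ?thesis by (simp add: poly_monom)
  qed
  thus "monom 1 j = (\<Sum>x\<le>M. smult (a x) (binom_poly M x))"
    by (intro iffD1[OF poly_eq_poly_eq_iff] ext) simp
qed

text \<open>Consequently a linear functional that vanishes on the binomial polynomials vanishes on
  all polynomials of degree at most \<open>M\<close>.\<close>

lemma binom_poly_span:
  fixes f :: "real poly"
  assumes "degree f \<le> M"
  obtains a where "f = (\<Sum>x\<le>M. smult (a x) (binom_poly M x))"
proof -
  have "\<forall>j\<in>{..M}. \<exists>a. monom 1 j = (\<Sum>x\<le>M. smult (a x) (binom_poly M x))"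
    using binom_poly_span_monom by (metis atMost_iff)
  then obtain a where a: "\<And>j. j \<le> M \<Longrightarrow> monom 1 j = (\<Sum>x\<le>M. smult (a j x) (binom_poly M x))"
    by (metis atMost_iff)
  have "f = (\<Sum>j\<le>M. smult (coeff f j) (monom 1 j))"
    using poly_as_sum_of_monoms'[OF assms] by (simp add: smult_monom)
  also have "\<dots> = (\<Sum>j\<le>M. \<Sum>x\<le>M. smult (coeff f j * a j x) (binom_poly M x))"
    by (intro sum.cong refl) (simp add: a poly_eq_iff coeff_sum sum_distrib_left mult.assoc)
  also have "\<dots> = (\<Sum>x\<le>M. smult (\<Sum>j\<le>M. coeff f j * a j x) (binom_poly M x))"
    by (subst sum.swap) (simp add: smult_sum)
  finally show thesis by (rule that)
qed

section \<open>Taylor coefficients and remainders of polynomials\<close>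

definition tcoeff :: "nat \<Rightarrow> real \<Rightarrow> real poly \<Rightarrow> real" where
  "tcoeff n a p = coeff (pcompose p [:a, 1:]) n"

text \<open>The factor of \<open>d ^ n\<close> in the Taylor remainder of order \<open>n\<close> of
  \<open>p\<close> at \<open>a\<close>. It is a polynomial in the displacement \<open>d\<close>, so
  coefficients built from it are analytic.\<close>

definition trem :: "nat \<Rightarrow> real \<Rightarrow> real poly \<Rightarrow> real poly" where
  "trem n a p = poly_shift n (pcompose p [:a, 1:])"

lemma poly_trem_Suc: "poly (trem n a p) d = tcoeff n a p + d * poly (trem (Suc n) a p) d"
proof -
  have "trem n a p = pCons (tcoeff n a p) (trem (Suc n) a p)"
    by (auto simp: poly_eq_iff trem_def tcoeff_def coeff_poly_shift coeff_pCons split: nat.split)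
  thus ?thesis by simp
qed

lemma poly_trem_0: "poly (trem n a p) 0 = tcoeff n a p"
  using poly_trem_Suc[of n a p 0] by simp

lemma tcoeff_0: "tcoeff 0 a p = poly p a"
  by (simp add: tcoeff_def coeff_pcompose_0)

lemma poly_taylor1: "poly p (a + d) = poly p a + d * poly (trem 1 a p) d"
proof -
  have "poly (trem 0 a p) d = poly p (a + d)" by (simp add: trem_def poly_pcompose)
  thus ?thesis using poly_trem_Suc[of 0 a p d] by (simp add: tcoeff_0)
qed

lemma poly_taylor2: "poly p (a + d) = poly p a + d * tcoeff 1 a p + d\<^sup>2 * poly (trem 2 a p) d"
  using poly_taylor1[of p a d] poly_trem_Suc[of 1 a p d]
  unfolding Suc_1 by (simp only: distrib_left power2_eq_square mult.assoc add.assoc)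

text \<open>Translation by \<open>a\<close> turns the root factor into a monomial, which shifts
  coefficients. Test polynomials with prescribed roots are evaluated this way.\<close>

lemma tcoeff_root_power:
  "tcoeff n a ([:- a, 1:] ^ k * g) = (if n < k then 0 else tcoeff (n - k) a g)"
proof -
  have "pcompose [:- a, 1:] [:a, 1:] = [:0, 1:]" by (simp add: pcompose_pCons)
  hence "pcompose ([:- a, 1:] ^ k) [:a, 1:] = monom 1 k"
    by (induction k)
      (simp_all only: power_Suc power_0 pcompose_mult pcompose_1 monom_altdef smult_1_left)
  hence "pcompose ([:- a, 1:] ^ k * g) [:a, 1:] = monom 1 k * pcompose g [:a, 1:]"
    by (simp add: pcompose_mult)
  thus ?thesis by (simp add: tcoeff_def coeff_monom_mult)
qed

text \<open>Components in \<open>K\<close> carry the atoms \<open>\<theta>\<^sub>c\<close> of the true distribution; those in \<open>- K\<close>, together with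
  the component \<open>None\<close>, share the remaining atom \<open>\<theta>0\<close> with equal proportions \<open>t0\<close>.\<close>

locale merged_mixture =
  fixes M :: nat and K :: "'i::finite set" and \<theta> \<tau> :: "'i \<Rightarrow> real" and \<theta>0 t0 :: real
  assumes \<theta>_inj: "inj_on \<theta> K" and \<theta>_ne: "\<And>c. c \<in> K \<Longrightarrow> \<theta> c \<noteq> \<theta>0"
    and \<tau>_pos: "\<And>c. c \<in> K \<Longrightarrow> 0 < \<tau> c" and t0_pos: "0 < t0"
    and t0: "(\<Sum>c\<in>K. \<tau> c) + (real (card (- K)) + 1) * t0 = 1"
    and M: "2 * card K + 2 \<le> M"
begin

section \<open>The merged point and its moment coordinates\<close>

definition q :: "nat \<Rightarrow> real" where
  "q x = (\<Sum>c\<in>K. \<tau> c * binom_prob M (\<theta> c) x) + (1 - (\<Sum>c\<in>K. \<tau> c)) * binom_prob M \<theta>0 x"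

definition P :: "'i param" where
  "P = (\<chi> z. case z of Inl None \<Rightarrow> \<theta>0 | Inl (Some c) \<Rightarrow> if c \<in> K then \<theta> c else \<theta>0
     | Inr c \<Rightarrow> if c \<in> K then \<tau> c else t0)"

definition X :: "('i option + 'i) set" where
  "X = insert (Inl None) ((\<lambda>c. Inl (Some c)) ` K \<union> Inr ` K)"

definition D :: "('i option + 'i) set" where "D = (\<lambda>c. Inl (Some c)) ` (- K)"

lemma sum_X: "sum f X = f (Inl None) + (\<Sum>c\<in>K. f (Inl (Some c))) + (\<Sum>c\<in>K. f (Inr c))"
proof -
  have "sum f ((\<lambda>c. Inl (Some c)) ` K \<union> Inr ` K) = sum f ((\<lambda>c. Inl (Some c)) ` K) + sum f (Inr ` K)"
    by (rule sum.union_disjoint) auto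
  also have "\<dots> = (\<Sum>c\<in>K. f (Inl (Some c))) + (\<Sum>c\<in>K. f (Inr c))"
    by (simp add: sum.reindex inj_on_def)
  finally show ?thesis
    unfolding X_def by (subst sum.insert) (auto simp: add.assoc)
qed

lemma sum_D: "sum f D = (\<Sum>c\<in>- K. f (Inl (Some c)))"
  unfolding D_def by (simp add: sum.reindex inj_on_def)

lemma card_X: "card X = 1 + 2 * card K"
  using sum_X[of "\<lambda>_. 1 :: nat"] by simp

lemma card_D: "card D = card (- K)"
  using sum_D[of "\<lambda>_. 1 :: nat"] by simp

lemma X_D_disj: "X \<inter> D = {}" by (auto simp: X_def D_def)

text \<open>At the parameter with coordinates \<open>v\<close>, the cluster component
  \<open>c\<close> has proportion \<open>wt v c\<close> and \<open>None\<close> has proportion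
  \<open>rest v\<close>. The displacement \<open>dN v\<close> of \<open>None\<close> solves
  \<open>mom v + rest v * dN v = v $ Inl None\<close>.\<close>

definition wt :: "'i param \<Rightarrow> 'i \<Rightarrow> real" where "wt v c = t0 + v $ Inr c"

definition rest :: "'i param \<Rightarrow> real" where "rest v = t0 - (\<Sum>c\<in>UNIV. v $ Inr c)"

definition mom :: "'i param \<Rightarrow> real" where "mom v = (\<Sum>c\<in>- K. wt v c * v $ Inl (Some c))"

definition dN :: "'i param \<Rightarrow> real" where "dN v = (v $ Inl None - mom v) / rest v"

text \<open>The coordinate \<open>Inl None\<close> of \<open>v\<close> is the first moment of the cluster about \<open>\<theta>0\<close>.\<close>

definition \<Psi> :: "'i param \<Rightarrow> 'i param" where
  "\<Psi> v = (\<chi> z. if z = Inl None then \<theta>0 + dN v else P $ z + v $ z)"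

definition \<Phi> :: "'i param \<Rightarrow> 'i param" where
  "\<Phi> w = (\<chi> z. if z = Inl None
     then (\<Sum>c\<in>- K. w $ Inr c * (w $ Inl (Some c) - \<theta>0)) + (1 - (\<Sum>c\<in>UNIV. w $ Inr c)) * (w $ Inl None - \<theta>0)
     else w $ z - P $ z)"

lemma sum_P: "(\<Sum>c\<in>UNIV. P $ Inr c) = 1 - t0"
proof -
  have "(\<Sum>c\<in>UNIV. P $ Inr c) = (\<Sum>c\<in>K. P $ Inr c) + (\<Sum>c\<in>- K. P $ Inr c)"
    by (subst sum.union_disjoint[symmetric]) auto
  also have "\<dots> = (\<Sum>c\<in>K. \<tau> c) + real (card (- K)) * t0"
    by (simp add: P_def)
  finally show ?thesis using t0 by (simp add: algebra_simps)
qed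

lemma rest_\<Psi>: "1 - (\<Sum>c\<in>UNIV. \<Psi> v $ Inr c) = rest v"
  by (simp add: \<Psi>_def rest_def sum.distrib sum_P)

lemma rest_\<Phi>: "rest (\<Phi> w) = 1 - (\<Sum>c\<in>UNIV. w $ Inr c)"
  by (simp add: \<Phi>_def rest_def sum_subtractf sum_P)

lemma P_cluster: "c \<notin> K \<Longrightarrow> P $ Inr c = t0" "c \<notin> K \<Longrightarrow> P $ Inl (Some c) = \<theta>0"
  by (simp_all add: P_def)

lemma \<Phi>_\<Psi>:
  assumes "rest v \<noteq> 0" shows "\<Phi> (\<Psi> v) = v"
proof -
  have "(\<Sum>c\<in>- K. \<Psi> v $ Inr c * (\<Psi> v $ Inl (Some c) - \<theta>0)) = mom v"
    unfolding mom_def by (rule sum.cong) (auto simp: \<Psi>_def P_cluster wt_def)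
  hence "\<Phi> (\<Psi> v) $ Inl None = v $ Inl None"
    using assms rest_\<Psi>[of v] by (simp add: \<Phi>_def) (simp add: \<Psi>_def dN_def)
  thus ?thesis by (auto simp: vec_eq_iff) (simp add: \<Phi>_def \<Psi>_def)
qed

lemma \<Psi>_\<Phi>:
  assumes "rest (\<Phi> w) \<noteq> 0" shows "\<Psi> (\<Phi> w) = w"
proof -
  have "mom (\<Phi> w) = (\<Sum>c\<in>- K. w $ Inr c * (w $ Inl (Some c) - \<theta>0))"
    unfolding mom_def by (rule sum.cong) (auto simp: \<Phi>_def P_cluster wt_def)
  hence "dN (\<Phi> w) = w $ Inl None - \<theta>0"
    using assms by (simp add: dN_def rest_\<Phi>) (simp add: \<Phi>_def)
  thus ?thesis by (auto simp: vec_eq_iff \<Psi>_def) (simp add: \<Phi>_def)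
qed

lemma \<Phi>_P: "\<Phi> P = 0"
proof -
  have "(\<Sum>c\<in>- K. P $ Inr c * (P $ Inl (Some c) - \<theta>0)) = 0" by (rule sum.neutral) (auto simp: P_cluster)
  moreover have "P $ Inl None = \<theta>0" by (simp add: P_def)
  ultimately show ?thesis by (auto simp: vec_eq_iff \<Phi>_def)
qed

lemma rest_0: "rest 0 = t0" by (simp add: rest_def)

lemma \<Psi>_0: "\<Psi> 0 = P" using \<Psi>_\<Phi>[of P] t0_pos by (simp add: \<Phi>_P rest_0)

lemma analytic_aux:
  "real_analytic_at rest v" "real_analytic_at (\<lambda>v. wt v c) v" "real_analytic_at mom v"
proof -
  show r: "real_analytic_at rest v" unfolding rest_def[abs_def] by (intro real_analytic_intros)
  show w: "real_analytic_at (\<lambda>v. wt v c) v" for c unfolding wt_def by (intro real_analytic_intros)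
  show "real_analytic_at mom v" unfolding mom_def[abs_def] by (intro real_analytic_intros w)
qed

lemma analytic_dN: "rest v \<noteq> 0 \<Longrightarrow> real_analytic_at dN v"
  unfolding dN_def[abs_def] by (intro real_analytic_intros analytic_aux)

lemma analytic_\<Psi>: "rest v \<noteq> 0 \<Longrightarrow> real_analytic_at (\<lambda>v. \<Psi> v $ z) v"
  unfolding \<Psi>_def vec_lambda_beta
  by (cases "z = Inl None") (simp_all, (intro real_analytic_intros analytic_dN; assumption?)+)

lemma analytic_\<Phi>: "real_analytic_at (\<lambda>w. \<Phi> w $ z) w"
  unfolding \<Phi>_def vec_lambda_beta
  by (cases "z = Inl None") (simp_all, (intro real_analytic_intros)+)

text \<open>Up to a translation only the coordinate \<open>Inl None\<close> is changed. All other
  rows of the Jacobian matrix are unit rows, which leaves the derivative of \<open>dN\<close> in its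
  own moment coordinate.\<close>

lemma \<Psi>_derivative:
  assumes "rest v \<noteq> 0"
  shows "\<exists>\<Psi>'. (\<Psi> has_derivative \<Psi>') (at v) \<and> det (matrix \<Psi>') = 1 / rest v"
proof -
  note nth = bounded_linear_imp_has_derivative[OF bounded_linear_vec_nth]
  define mom' where "mom' h = (\<Sum>c\<in>- K. wt v c * h $ Inl (Some c) + h $ Inr c * v $ Inl (Some c))" for h :: "'i param"
  define rest' where "rest' h = - (\<Sum>c\<in>UNIV. h $ Inr c)" for h :: "'i param"
  have mom': "(mom has_derivative mom') (at v)"
    unfolding mom_def[abs_def] mom'_def[abs_def] wt_def
    by (auto intro!: derivative_eq_intros nth sum.cong)
  have rest': "(rest has_derivative rest') (at v)"
    unfolding rest_def[abs_def] rest'_def[abs_def]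
    by (auto intro!: derivative_eq_intros nth)
  define dN' where "dN' h = ((h $ Inl None - mom' h) * rest v - (v $ Inl None - mom v) * rest' h) / (rest v * rest v)" for h
  have dN': "(dN has_derivative dN') (at v)"
    unfolding dN_def[abs_def] dN'_def[abs_def]
    by (rule has_derivative_divide') (use assms in \<open>auto intro!: derivative_eq_intros nth mom' rest'\<close>)
  define \<Psi>' where "\<Psi>' h = (\<chi> z. if z = Inl None then dN' h else h $ z)" for h :: "'i param"
  have "(\<Psi> has_derivative \<Psi>') (at v)"
  proof (rule has_derivative_vecI)
    fix z show "((\<lambda>v. \<Psi> v $ z) has_derivative (\<lambda>h. \<Psi>' h $ z)) (at v)"
      unfolding \<Psi>_def \<Psi>'_def vec_lambda_beta
      by (cases "z = Inl None") (auto intro!: derivative_eq_intros nth dN')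
  qed
  moreover have "det (matrix \<Psi>') = 1 / rest v"
  proof -
    have m: "matrix \<Psi>' $ z $ z' = (if z = Inl None then dN' (axis z' 1) else if z' = z then 1 else 0)" for z z'
      by (auto simp: matrix_def \<Psi>'_def axis_def)
    have "mom' (axis (Inl None) 1) = 0" "rest' (axis (Inl None) 1) = 0"
      by (auto simp: mom'_def rest'_def axis_def)
    hence d: "dN' (axis (Inl None) 1) = 1 / rest v"
      using assms by (simp add: dN'_def)
    have "det (matrix \<Psi>') = (\<Prod>z\<in>UNIV. matrix \<Psi>' $ z $ z)"
    proof (rule det_unique_permutation)
      fix p assume p: "p permutes (UNIV :: ('i option + 'i) set)" and nz: "\<And>z. matrix \<Psi>' $ z $ p z \<noteq> 0"
      have pz: "p z = z" if "z \<noteq> Inl None" for z using nz[of z] that by (auto simp: m split: if_splits)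
      hence "p (Inl None) = Inl None"
        using permutes_surj[OF p] by (metis surjD)
      thus "p = id" using pz by (metis ext id_apply)
    qed
    also have "\<dots> = (\<Prod>z\<in>(UNIV :: ('i option + 'i) set). if z = Inl None then 1 / rest v else 1)"
      by (rule prod.cong) (auto simp: m d)
    finally show ?thesis by simp
  qed
  ultimately show ?thesis by blast
qed

section \<open>Expansion of the mixture in the moment coordinates\<close>

abbreviation bp :: "nat \<Rightarrow> real poly" where "bp x \<equiv> binom_poly M x"

abbreviation R2 :: "nat \<Rightarrow> real \<Rightarrow> real" where "R2 x d \<equiv> poly (trem 2 \<theta>0 (bp x)) d"

fun cidx :: "'i option + 'i \<Rightarrow> 'i" where
  "cidx (Inl (Some c)) = c" | "cidx (Inr c) = c" | "cidx (Inl None) = undefined"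

text \<open>What is left after one \<open>X\<close> coordinate is split off. A change of the
  proportion of \<open>c\<close> takes mass from the atom \<open>\<theta>0\<close>, hence the
  difference for \<open>Inr c\<close>; it is taken at the displaced atom to include the product with
  \<open>v $ Inl (Some c)\<close>. The second summand for \<open>Inl None\<close> is the part of
  \<open>rest v * (dN v)\<^sup>2\<close> divisible by the moment.\<close>

fun Acoef :: "nat \<Rightarrow> ('i option + 'i) \<Rightarrow> 'i param \<Rightarrow> real" where
  "Acoef x (Inl None) v = tcoeff 1 \<theta>0 (bp x) + (dN v - mom v / rest v) * R2 x (dN v)"
| "Acoef x (Inl (Some c)) v = \<tau> c * poly (trem 1 (\<theta> c) (bp x)) (v $ Inl (Some c))"
| "Acoef x (Inr c) v = poly (bp x) (\<theta> c + v $ Inl (Some c)) - poly (bp x) \<theta>0"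

text \<open>The first summand is \<open>(mom v)\<^sup>2 / rest v\<close> as a quadratic form,
  contributed by \<open>None\<close>; the second collects the squared displacements of the other
  cluster components.\<close>

definition Bcoef :: "nat \<Rightarrow> ('i option + 'i) \<Rightarrow> ('i option + 'i) \<Rightarrow> 'i param \<Rightarrow> real" where
  "Bcoef x z z' v = wt v (cidx z) * wt v (cidx z') / rest v * R2 x (dN v)
     + (if z = z' then wt v (cidx z) * R2 x (v $ z) else 0)"

text \<open>An exact identity: atoms in \<open>K\<close> are expanded to first order and the cluster
  to second order, with the remainders kept as factors. The first-order terms of the cluster add up
  to the moment coordinate, so \<open>D\<close> enters only quadratically.\<close>

lemma mixture_\<Psi>:
  assumes r: "rest v \<noteq> 0"
  shows "mixture M (\<Psi> v) x - q x =
    (\<Sum>z\<in>X. v $ z * Acoef x z v) + (\<Sum>z\<in>D. \<Sum>z'\<in>D. v $ z * v $ z' * Bcoef x z z' v)"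
proof -
  let ?p = "\<lambda>t. poly (bp x) t"
  have S: "(\<Sum>c\<in>UNIV. f c) = (\<Sum>c\<in>K. f c) + (\<Sum>c\<in>- K. f c)" for f :: "'i \<Rightarrow> real"
    by (subst sum.union_disjoint[symmetric]) auto
  have single: "(\<Sum>c\<in>K. \<Psi> v $ Inr c * ?p (\<Psi> v $ Inl (Some c))) =
     (\<Sum>c\<in>K. \<tau> c * ?p (\<theta> c)) + (\<Sum>c\<in>K. v $ Inl (Some c) * Acoef x (Inl (Some c)) v)
     + (\<Sum>c\<in>K. v $ Inr c * Acoef x (Inr c) v) + (\<Sum>c\<in>K. v $ Inr c) * ?p \<theta>0"
    unfolding sum_distrib_right sum.distrib[symmetric]
  proof (rule sum.cong[OF refl])
    fix c assume c: "c \<in> K"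
    have "\<Psi> v $ Inr c * ?p (\<Psi> v $ Inl (Some c)) = \<tau> c * ?p (\<theta> c + v $ Inl (Some c)) + v $ Inr c * ?p (\<theta> c + v $ Inl (Some c))"
      using c by (simp add: \<Psi>_def P_def distrib_right)
    also have "\<tau> c * ?p (\<theta> c + v $ Inl (Some c)) = \<tau> c * ?p (\<theta> c) + v $ Inl (Some c) * Acoef x (Inl (Some c)) v"
      by (simp add: poly_taylor1 algebra_simps)
    also have "v $ Inr c * ?p (\<theta> c + v $ Inl (Some c)) = v $ Inr c * Acoef x (Inr c) v + v $ Inr c * ?p \<theta>0"
      by (simp add: algebra_simps)
    finally show "\<Psi> v $ Inr c * ?p (\<Psi> v $ Inl (Some c)) = \<tau> c * ?p (\<theta> c) + v $ Inl (Some c) * Acoef x (Inl (Some c)) v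
      + v $ Inr c * Acoef x (Inr c) v + v $ Inr c * ?p \<theta>0" by (simp add: add.assoc)
  qed
  have cluster: "(\<Sum>c\<in>- K. \<Psi> v $ Inr c * ?p (\<Psi> v $ Inl (Some c))) =
     (\<Sum>c\<in>- K. wt v c) * ?p \<theta>0 + mom v * tcoeff 1 \<theta>0 (bp x)
     + (\<Sum>c\<in>- K. wt v c * (v $ Inl (Some c))\<^sup>2 * R2 x (v $ Inl (Some c)))"
    unfolding sum_distrib_right mom_def sum.distrib[symmetric]
    by (rule sum.cong[OF refl]) (simp add: \<Psi>_def P_cluster wt_def poly_taylor2 distrib_left distrib_right mult_ac)
  have last: "rest v * ?p (\<theta>0 + dN v) = rest v * ?p \<theta>0 + (v $ Inl None - mom v) * tcoeff 1 \<theta>0 (bp x)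
     + (v $ Inl None * (dN v - mom v / rest v) + (mom v)\<^sup>2 / rest v) * R2 x (dN v)"
  proof -
    have d: "rest v * dN v = v $ Inl None - mom v" using r by (simp add: dN_def)
    have "rest v * ?p (\<theta>0 + dN v) = rest v * ?p \<theta>0 + (rest v * dN v) * tcoeff 1 \<theta>0 (bp x)
       + (rest v * dN v) * dN v * R2 x (dN v)"
      by (simp add: poly_taylor2 algebra_simps power2_eq_square)
    \<comment> \<open>With \<open>m = v $ Inl None\<close> this splits
      \<open>(m - mom)^2 / rest\<close> into a multiple of \<open>m\<close>, which goes to
      \<open>Acoef\<close>, and \<open>mom^2 / rest\<close>, which goes to
      \<open>Bcoef\<close>.\<close>
    also have "(rest v * dN v) * dN v = v $ Inl None * (dN v - mom v / rest v) + (mom v)\<^sup>2 / rest v"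
      unfolding d using r by (simp add: dN_def field_simps power2_eq_square)
    finally show ?thesis unfolding d .
  qed
  have wsum: "(\<Sum>c\<in>- K. wt v c) + rest v = 1 - (\<Sum>c\<in>K. \<tau> c) - (\<Sum>c\<in>K. v $ Inr c)"
    using t0 by (simp add: wt_def rest_def S sum.distrib algebra_simps)
  have quad: "(\<Sum>z\<in>D. \<Sum>z'\<in>D. v $ z * v $ z' * Bcoef x z z' v) =
     (mom v)\<^sup>2 / rest v * R2 x (dN v) + (\<Sum>c\<in>- K. wt v c * (v $ Inl (Some c))\<^sup>2 * R2 x (v $ Inl (Some c)))"
  proof -
    have "(\<Sum>z\<in>D. \<Sum>z'\<in>D. v $ z * v $ z' * Bcoef x z z' v) =
       (\<Sum>c\<in>- K. \<Sum>c'\<in>- K. (wt v c * v $ Inl (Some c)) * (wt v c' * v $ Inl (Some c')) * (R2 x (dN v) / rest v)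
         + (if c = c' then wt v c * (v $ Inl (Some c))\<^sup>2 * R2 x (v $ Inl (Some c)) else 0))"
      unfolding sum_D Bcoef_def
      by (intro sum.cong refl) (simp add: distrib_left power2_eq_square mult_ac)
    also have "\<dots> = (\<Sum>c\<in>- K. \<Sum>c'\<in>- K. (wt v c * v $ Inl (Some c)) * (wt v c' * v $ Inl (Some c')) * (R2 x (dN v) / rest v))
         + (\<Sum>c\<in>- K. wt v c * (v $ Inl (Some c))\<^sup>2 * R2 x (v $ Inl (Some c)))"
      unfolding sum.distrib by (simp add: sum.delta')
    also have "(\<Sum>c\<in>- K. \<Sum>c'\<in>- K. (wt v c * v $ Inl (Some c)) * (wt v c' * v $ Inl (Some c')) * (R2 x (dN v) / rest v))
       = (mom v)\<^sup>2 / rest v * R2 x (dN v)"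
      unfolding sum_distrib_right[symmetric] power2_eq_square mom_def
      by (simp add: sum_product)
    finally show ?thesis .
  qed
  have "mixture M (\<Psi> v) x = (\<Sum>c\<in>UNIV. \<Psi> v $ Inr c * ?p (\<Psi> v $ Inl (Some c))) + rest v * ?p (\<theta>0 + dN v)"
    unfolding mixture_def rest_\<Psi> by (simp add: poly_binom_poly) (simp add: \<Psi>_def)
  also have "\<dots> = (\<Sum>c\<in>K. \<tau> c * ?p (\<theta> c)) + (\<Sum>c\<in>K. v $ Inl (Some c) * Acoef x (Inl (Some c)) v)
     + (\<Sum>c\<in>K. v $ Inr c * Acoef x (Inr c) v) + ((\<Sum>c\<in>- K. wt v c) + rest v + (\<Sum>c\<in>K. v $ Inr c)) * ?p \<theta>0
     + v $ Inl None * tcoeff 1 \<theta>0 (bp x) + v $ Inl None * (dN v - mom v / rest v) * R2 x (dN v)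
     + ((mom v)\<^sup>2 / rest v * R2 x (dN v) + (\<Sum>c\<in>- K. wt v c * (v $ Inl (Some c))\<^sup>2 * R2 x (v $ Inl (Some c))))"
    unfolding S single cluster last by (simp only: distrib_right left_diff_distrib)
  also have "(\<Sum>c\<in>- K. wt v c) + rest v + (\<Sum>c\<in>K. v $ Inr c) = 1 - (\<Sum>c\<in>K. \<tau> c)" using wsum by simp
  finally show ?thesis
    unfolding quad[symmetric] sum_X q_def
    by (simp add: poly_binom_poly[symmetric] distrib_left mult.assoc)
qed

section \<open>Linear independence at the merged point\<close>

lemma at_0: "mom 0 = 0" "dN 0 = 0" "wt 0 c = t0"
  by (simp_all add: mom_def dN_def wt_def)

lemma Acoef_0:
  "Acoef x (Inl None) 0 = tcoeff 1 \<theta>0 (bp x)"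
  "Acoef x (Inl (Some c)) 0 = \<tau> c * tcoeff 1 (\<theta> c) (bp x)"
  "Acoef x (Inr c) 0 = tcoeff 0 (\<theta> c) (bp x) - tcoeff 0 \<theta>0 (bp x)"
  by (simp_all add: at_0 poly_trem_0 tcoeff_0)

text \<open>All cluster proportions equal \<open>t0\<close> here, so the matrix is \<open>t0\<close>
  times the sum of the all-ones matrix and the identity, hence positive definite, and
  \<open>x\<close> enters only through one scalar factor.\<close>

lemma Bcoef_0: "Bcoef x z z' 0 = (t0 + (if z = z' then t0 else 0)) * tcoeff 2 \<theta>0 (bp x)"
  using t0_pos by (simp add: Bcoef_def at_0 rest_0 poly_trem_0 distrib_right)

text \<open>The double roots annihilate value and first derivative at the atoms in
  \<open>S\<close>.\<close>

definition sqs :: "'i set \<Rightarrow> real poly" where "sqs S = (\<Prod>c\<in>S. [:- \<theta> c, 1:] ^ 2)"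

lemma degree_sqs: "degree (sqs S) \<le> 2 * card S"
  using degree_prod_sum_le[of S "\<lambda>c. [:- \<theta> c, 1:] ^ 2"] by (simp add: sqs_def degree_linear_power)

lemma tcoeff_sqs: "c \<in> S \<Longrightarrow> n < 2 \<Longrightarrow> tcoeff n (\<theta> c) (f * sqs S) = 0"
proof -
  assume c: "c \<in> S" and n: "n < 2"
  have "f * sqs S = [:- \<theta> c, 1:] ^ 2 * (f * sqs (S - {c}))"
    unfolding sqs_def by (subst prod.remove[OF finite c]) (simp only: mult_ac)
  thus ?thesis using n by (simp only: tcoeff_root_power) simp
qed

lemma poly_sqs_nz: "(\<And>c. c \<in> S \<Longrightarrow> \<theta> c \<noteq> t) \<Longrightarrow> poly (sqs S) t \<noteq> 0"
  by (auto simp: sqs_def poly_prod poly_power)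

text \<open>The functions \<open>p'(\<theta>0)\<close>, \<open>p'(\<theta>\<^sub>c)\<close>, \<open>p(\<theta>\<^sub>c) - p(\<theta>0)\<close>, \<open>p''(\<theta>0)\<close> on \<open>{0..M}\<close> are linearly independent:
  a linear relation between them holds for the Taylor coefficients of every polynomial of degree at
  most \<open>M\<close>, and Hermite interpolation separates them.\<close>

lemma nondegenerate_0:
  assumes eq: "\<And>x. x \<le> M \<Longrightarrow>
      (\<Sum>z\<in>X. (c :: 'i param) $ z * Acoef x z 0) + (\<Sum>z\<in>D. \<Sum>z'\<in>D. c $ z * c $ z' * Bcoef x z z' 0) = 0"
    and l: "l \<in> X \<union> D"
  shows "c $ l = 0"
proof -
  \<comment> \<open>The quadratic part enters the relation only through this number, because the
    matrix in \<open>Bcoef_0\<close> does not depend on \<open>x\<close>.\<close>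
  define \<kappa> where "\<kappa> = (\<Sum>z\<in>D. \<Sum>z'\<in>D. c $ z * c $ z' * (t0 + (if z = z' then t0 else 0)))"
  define L where "L f = c $ Inl None * tcoeff 1 \<theta>0 f
     + (\<Sum>b\<in>K. c $ Inl (Some b) * \<tau> b * tcoeff 1 (\<theta> b) f)
     + (\<Sum>b\<in>K. c $ Inr b * (tcoeff 0 (\<theta> b) f - tcoeff 0 \<theta>0 f)) + \<kappa> * tcoeff 2 \<theta>0 f" for f
  have lin: "tcoeff n a (smult k f + g) = k * tcoeff n a f + tcoeff n a g" for n a k f g
    by (simp add: tcoeff_def pcompose_add pcompose_smult)
  have L_lin: "L (smult k f + g) = k * L f + L g" for k f g
    unfolding L_def lin by (simp add: algebra_simps sum.distrib sum_distrib_left sum_subtractf)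
  have L0: "L 0 = 0" by (simp add: L_def tcoeff_def)
  have L_sum: "L (\<Sum>x\<in>I. smult (a x) (g x)) = (\<Sum>x\<in>I. a x * L (g x))" if "finite I" for I :: "nat set" and a g
    using that by (induction I) (simp_all add: L0 L_lin)
  have L_bp: "L (bp x) = 0" if "x \<le> M" for x
    using eq[OF that] unfolding sum_X Acoef_0 Bcoef_0 L_def \<kappa>_def
    by (simp add: sum_distrib_right mult.assoc)
  have L_zero: "L f = 0" if deg: "degree f \<le> M" for f
  proof (rule binom_poly_span[OF deg])
    fix a assume f: "f = (\<Sum>x\<le>M. smult (a x) (bp x))"
    show "L f = 0" unfolding f by (simp add: L_sum L_bp)
  qed
  have nz0: "poly (sqs S) \<theta>0 \<noteq> 0" if "S \<subseteq> K" for S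
    by (rule poly_sqs_nz) (use that \<theta>_ne in auto)
  have deg: "degree ([:- a, 1:] ^ k * sqs S) \<le> k + 2 * card S" for a k S
    using degree_mult_le[of "[:- a, 1:] ^ k" "sqs S"] degree_sqs[of S] by (simp add: degree_linear_power)
  have z: "tcoeff n (\<theta> b) (f * sqs K) = 0" if "b \<in> K" "n < 2" for b n f
    using tcoeff_sqs that by blast
  have zp: "poly (sqs K) (\<theta> b) = 0" if "b \<in> K" for b
    using z[OF that, of 0 1] by (simp add: tcoeff_0)
  \<comment> \<open>With double roots at all atoms, only the second coefficient at
    \<open>\<theta>0\<close> survives. The degree bound \<open>2 * card K + 2\<close> is the largest
    one used and is what \<open>M\<close> has to accommodate.\<close>
  have \<kappa>: "\<kappa> = 0"
  proof -
    have "L ([:- \<theta>0, 1:] ^ 2 * sqs K) = 0" by (rule L_zero) (use deg[of \<theta>0 2 K] M in linarith)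
    thus ?thesis using nz0[OF order_refl] by (simp add: L_def z zp tcoeff_root_power tcoeff_0)
  qed
  \<comment> \<open>Now that \<open>\<kappa>\<close> is gone, a simple root at
    \<open>\<theta>0\<close> isolates the first derivative there.\<close>
  have cN: "c $ Inl None = 0"
  proof -
    define p where "p = [:- \<theta>0, 1:] ^ 1"
    have "L (p * sqs K) = 0" unfolding p_def by (rule L_zero) (use deg[of \<theta>0 1 K] M in linarith)
    moreover have "tcoeff 1 \<theta>0 (p * sqs K) = poly (sqs K) \<theta>0" "tcoeff 0 \<theta>0 (p * sqs K) = 0"
      unfolding p_def tcoeff_root_power by (simp_all add: tcoeff_0)
    moreover have "(\<Sum>b\<in>K. c $ Inl (Some b) * \<tau> b * tcoeff 1 (\<theta> b) (p * sqs K)) = 0"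
      by (rule sum.neutral) (use z[of _ 1 p] in simp)
    moreover have "(\<Sum>b\<in>K. c $ Inr b * (tcoeff 0 (\<theta> b) (p * sqs K) - 0)) = 0"
      by (rule sum.neutral) (use z[of _ 0 p] in simp)
    ultimately have "c $ Inl None * poly (sqs K) \<theta>0 = 0"
      unfolding L_def \<kappa> by (simp only: add_0_right mult_zero_left)
    thus ?thesis using nz0[OF order_refl] by simp
  qed
  have single: "c $ Inl (Some b) = 0 \<and> c $ Inr b = 0" if b: "b \<in> K" for b
  proof -
    let ?S = "K - {b}"
    \<comment> \<open>Double roots at all atoms except \<open>\<theta> b\<close>: multiplying by
      \<open>t - \<theta> b\<close> isolates the derivative at \<open>\<theta> b\<close>, after
      which \<open>?g\<close> itself isolates the value.\<close>
    let ?g = "[:- \<theta>0, 1:] ^ 2 * sqs ?S"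
    have cS: "2 * card ?S + 2 = 2 * card K" using b card_gt_0_iff[of K] by auto
    have z': "tcoeff n (\<theta> b') (f * sqs ?S) = 0" if "b' \<in> ?S" "n < 2" for b' n f
      using tcoeff_sqs that by blast
    have gb: "poly ?g (\<theta> b) \<noteq> 0"
    proof -
      have "poly (sqs ?S) (\<theta> b) \<noteq> 0"
        by (rule poly_sqs_nz) (use \<theta>_inj b in \<open>auto dest: inj_onD\<close>)
      thus ?thesis using \<theta>_ne[OF b] by (simp add: poly_power)
    qed
    have sb: "(\<Sum>b'\<in>K. h b') = h b" if "\<And>b'. b' \<in> ?S \<Longrightarrow> h b' = 0" for h :: "'i \<Rightarrow> real"
      using that by (subst sum.remove[OF finite b]) (simp add: sum.neutral)
    have dg: "degree ?g \<le> 2 * card K" using deg[of \<theta>0 2 ?S] cS by linarith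
    have z0: "tcoeff n \<theta>0 (f * ?g) = 0" if "n < 2" for n f
    proof -
      have "f * ?g = [:- \<theta>0, 1:] ^ 2 * (f * sqs ?S)" by (simp only: mult_ac)
      thus ?thesis using that by (simp only: tcoeff_root_power) simp
    qed
    have z'': "tcoeff n (\<theta> b') (f * ?g) = 0" if "b' \<in> ?S" "n < 2" for b' n f
      using z'[OF that, of "f * [:- \<theta>0, 1:] ^ 2"] by (simp only: mult.assoc)
    have lt: "(1 :: nat) < 2" "(0 :: nat) < 2" by simp_all
    have form: "L (f * ?g) = c $ Inl (Some b) * \<tau> b * tcoeff 1 (\<theta> b) (f * ?g) + c $ Inr b * tcoeff 0 (\<theta> b) (f * ?g)" for f
    proof -
      have "(\<Sum>b'\<in>K. c $ Inl (Some b') * \<tau> b' * tcoeff 1 (\<theta> b') (f * ?g)) = c $ Inl (Some b) * \<tau> b * tcoeff 1 (\<theta> b) (f * ?g)"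
        by (rule sb) (simp only: z'' lt mult_zero_right)
      moreover have "(\<Sum>b'\<in>K. c $ Inr b' * (tcoeff 0 (\<theta> b') (f * ?g) - tcoeff 0 \<theta>0 (f * ?g))) = c $ Inr b * (tcoeff 0 (\<theta> b) (f * ?g) - tcoeff 0 \<theta>0 (f * ?g))"
        by (rule sb) (simp only: z'' z0 lt diff_self mult_zero_right)
      ultimately show ?thesis
        unfolding L_def \<kappa> cN by (simp only: z0 lt diff_zero mult_zero_left mult_zero_right add_0 add_0_right)
    qed
    have th: "c $ Inl (Some b) = 0"
    proof -
      have "degree ([:- \<theta> b, 1:] ^ 1 * ?g) \<le> M"
        using degree_mult_le[of "[:- \<theta> b, 1:] ^ 1" ?g] dg M by (simp add: degree_linear_power)
      hence "L ([:- \<theta> b, 1:] ^ 1 * ?g) = 0" by (rule L_zero)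
      hence "c $ Inl (Some b) * \<tau> b * poly ?g (\<theta> b) = 0"
        unfolding form tcoeff_root_power by (simp add: tcoeff_0)
      thus ?thesis using gb \<tau>_pos[OF b] by simp
    qed
    have "L (1 * ?g) = 0" by (rule L_zero) (use dg M in simp)
    hence "c $ Inr b = 0" unfolding form th tcoeff_0 using gb by simp
    thus ?thesis using th by simp
  qed
  have "(\<Sum>z\<in>D. c $ z)\<^sup>2 + (\<Sum>z\<in>D. (c $ z)\<^sup>2) = 0"
  proof -
    have "\<kappa> = (\<Sum>z\<in>D. \<Sum>z'\<in>D. t0 * (c $ z * c $ z') + (if z = z' then t0 * (c $ z)\<^sup>2 else 0))"
      unfolding \<kappa>_def by (intro sum.cong refl) (simp add: algebra_simps power2_eq_square)
    also have "\<dots> = (\<Sum>z\<in>D. \<Sum>z'\<in>D. t0 * (c $ z * c $ z')) + (\<Sum>z\<in>D. t0 * (c $ z)\<^sup>2)"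
      unfolding sum.distrib by simp
    also have "\<dots> = t0 * ((\<Sum>z\<in>D. c $ z)\<^sup>2 + (\<Sum>z\<in>D. (c $ z)\<^sup>2))"
      unfolding power2_eq_square[of "\<Sum>z\<in>D. c $ z"] sum_product by (simp only: sum_distrib_left distrib_left)
    finally show ?thesis using \<kappa> t0_pos by simp
  qed
  hence "(\<Sum>z\<in>D. (c $ z)\<^sup>2) = 0"
    by (metis add_nonneg_eq_0_iff sum_nonneg zero_le_power2)
  hence "\<forall>z\<in>D. c $ z = 0" by (subst (asm) sum_nonneg_eq_0_iff) auto
  thus ?thesis using l cN single by (auto simp: X_def)
qed

lemma analytic_Acoef: "rest v \<noteq> 0 \<Longrightarrow> real_analytic_at (Acoef x z) v"
proof (cases "(x, z, v)" rule: Acoef.cases)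
  case (1 x' v')
  assume "rest v \<noteq> 0"
  thus ?thesis using 1
    by (simp add: Acoef.simps(1)[abs_def]) (intro real_analytic_intros analytic_dN analytic_aux)
qed (simp_all add: Acoef.simps(2,3)[abs_def], (intro real_analytic_intros)+)

lemma analytic_Bcoef: "rest v \<noteq> 0 \<Longrightarrow> real_analytic_at (Bcoef x z z') v"
  unfolding Bcoef_def[abs_def]
  by (cases "z = z'") (simp_all, (intro real_analytic_intros analytic_dN analytic_aux; assumption?)+)

section \<open>The divergence as a weighted form and its threshold at the merged point\<close>

lemma sum_mixture: "(\<Sum>x\<le>M. mixture M (w :: 'i param) x) = 1"
proof -
  have "(\<Sum>x\<le>M. mixture M w x) = (\<Sum>i\<in>UNIV. tau w i * (\<Sum>x\<le>M. binom_prob M (theta w (Some i)) x))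
     + (1 - (\<Sum>i\<in>UNIV. tau w i)) * (\<Sum>x\<le>M. binom_prob M (theta w None) x)"
    unfolding mixture_def sum.distrib sum_distrib_left by (subst sum.swap) simp
  thus ?thesis by (simp add: sum_binom_prob)
qed

lemma mixture_P: "mixture M P x = q x"
  using mixture_\<Psi>[of 0 x] t0_pos by (simp add: \<Psi>_0 rest_0)

lemma sum_q: "(\<Sum>x\<le>M. q x) = 1"
  using sum_mixture[of P] by (simp add: mixture_P)

lemma KL_form:
  assumes q': "\<And>x. x \<le> M \<Longrightarrow> q' x = q x \<and> 0 < q x"
    and r: "\<And>x. x \<le> M \<Longrightarrow> \<bar>(mixture M w x - q x) / q x\<bar> < 1"
  shows "KL M q' (w :: 'i param) = (\<Sum>x\<le>M. log_defect ((mixture M w x - q x) / q x) / q x * (mixture M w x - q x)\<^sup>2)"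
proof -
  have "q' x * loglik_ratio M q' x w =
    log_defect ((mixture M w x - q x) / q x) / q x * (mixture M w x - q x)\<^sup>2 - (mixture M w x - q x)"
    if x: "x \<le> M" for x
  proof -
    define s where "s = (mixture M w x - q x) / q x"
    have qx: "0 < q x" "q' x = q x" using q'[OF x] by auto
    have m: "mixture M w x = q x * (1 + s)" using qx by (simp add: s_def field_simps)
    have s1: "0 < 1 + s" using r[OF x] by (simp add: s_def[symmetric] abs_less_iff)
    have "ln (q x / mixture M w x) = - ln (1 + s)"
      using qx s1 by (simp add: m ln_div ln_mult)
    hence "q' x * loglik_ratio M q' x w = q x * (s - ln (1 + s)) - q x * s"
      using qx by (simp add: loglik_ratio_def algebra_simps)
    also have "\<dots> = q x * (log_defect s * s\<^sup>2) - q x * s" by (simp only: log_defect)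
    also have "\<dots> = log_defect s / q x * (q x * s)\<^sup>2 - q x * s"
      using qx by (simp add: power2_eq_square)
    also have "q x * s = mixture M w x - q x" using qx by (simp add: s_def)
    finally show ?thesis by (simp add: s_def)
  qed
  hence "KL M q' w = (\<Sum>x\<le>M. log_defect ((mixture M w x - q x) / q x) / q x * (mixture M w x - q x)\<^sup>2
      - (mixture M w x - q x))"
    unfolding KL_def by (intro sum.cong) auto
  thus ?thesis by (simp add: sum_subtractf sum_mixture sum_q)
qed

theorem has_rlct_P:
  assumes W1: "open W1" "P \<in> W1" "real_analytic_on (KL M q') W1"
    and q': "\<And>x. x \<le> M \<Longrightarrow> q' x = q x \<and> 0 < q x"
  shows "has_rlct (KL M q') P (ereal ((4 * real (card K) + real (card (- K)) + 2) / 4)) 1"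
proof -
  define Rs where "Rs = {v :: 'i param. 0 < rest v}"
  have rest_nz: "rest v \<noteq> 0" if "v \<in> Rs" for v using that by (simp add: Rs_def)
  have cont_rest: "continuous_on S rest" for S
    by (rule real_analytic_at_imp_continuous_on) (rule analytic_aux)
  have oRs: "open Rs" unfolding Rs_def by (intro open_Collect_less continuous_on_const cont_rest)
  have cont_\<Psi>: "continuous_on Rs \<Psi>"
    unfolding continuous_on_componentwise[of Rs \<Psi>]
  proof
    fix b :: "'i param" assume "b \<in> Basis"
    then obtain z where b: "b = axis z 1" by (auto simp: Basis_vec_def)
    show "continuous_on Rs (\<lambda>v. \<Psi> v \<bullet> b)"
      unfolding b inner_axis by (simp, rule real_analytic_at_imp_continuous_on) (rule analytic_\<Psi>[OF rest_nz])
  qed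
  have cont_\<Phi>: "continuous_on S \<Phi>" for S
    unfolding continuous_on_componentwise[of S \<Phi>]
  proof
    fix b :: "'i param" assume "b \<in> Basis"
    then obtain z where b: "b = axis z 1" by (auto simp: Basis_vec_def)
    show "continuous_on S (\<lambda>v. \<Phi> v \<bullet> b)"
      unfolding b inner_axis by (simp, rule real_analytic_at_imp_continuous_on) (rule analytic_\<Phi>)
  qed
  define \<Delta> where "\<Delta> x v = (\<Sum>z\<in>X. v $ z * Acoef x z v) + (\<Sum>z\<in>D. \<Sum>z'\<in>D. v $ z * v $ z' * Bcoef x z z' v)" for x v
  have \<Delta>: "mixture M (\<Psi> v) x - q x = \<Delta> x v" if "v \<in> Rs" for v x
    unfolding \<Delta>_def by (rule mixture_\<Psi>[OF rest_nz[OF that]])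
  have an_\<Delta>: "real_analytic_at (\<Delta> x) v" if "v \<in> Rs" for x v
    unfolding \<Delta>_def[abs_def] by (intro real_analytic_intros analytic_Acoef analytic_Bcoef rest_nz that)
  have cont_\<Delta>: "continuous_on Rs (\<Delta> x)" for x
    by (rule real_analytic_at_imp_continuous_on) (rule an_\<Delta>)
  \<comment> \<open>On this set \<open>rest\<close> is positive, so \<open>\<Phi>\<close> inverts
    \<open>\<Psi>\<close>; the image stays where \<open>KL\<close> is analytic; and the relative
    deviation is below 1, where \<open>log_defect\<close> is analytic and positive.\<close>
  define U1 where "U1 = (Rs \<inter> \<Psi> -` W1) \<inter> (\<Inter>x\<in>{..M}. Rs \<inter> (\<lambda>v. \<Delta> x v / q x) -` {-1<..<1})"
  have U1_Rs: "U1 \<subseteq> Rs" by (auto simp: U1_def)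
  have oU1: "open U1"
    unfolding U1_def
    by (intro open_Int open_INT ballI continuous_open_preimage cont_\<Psi> oRs W1(1) finite_atMost
        continuous_on_divide cont_\<Delta> continuous_on_const open_greaterThanLessThan)
      (use q' in fastforce)
  have zero_U1: "0 \<in> U1"
    using t0_pos W1(2) by (auto simp: U1_def Rs_def rest_0 \<Psi>_0 \<Delta>_def)
  obtain U0 where U0: "open U0" "0 \<in> U0" "U0 \<subseteq> U1"
    "\<And>v c l. v \<in> U0 \<Longrightarrow> (\<And>x. x \<in> {..M} \<Longrightarrow>
       (\<Sum>z\<in>X. (c :: 'i param) $ z * Acoef x z v) + (\<Sum>z\<in>D. \<Sum>z'\<in>D. c $ z * c $ z' * Bcoef x z z' v) = 0)
       \<Longrightarrow> l \<in> X \<union> D \<Longrightarrow> c $ l = 0"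
  proof (rule nondegenerate_nhd[of X D "{..M}" U1 0 Acoef Bcoef])
    show "X \<inter> D = {}" by (rule X_D_disj)
    show "continuous_on U1 (Acoef x z)" for x z
      by (rule real_analytic_at_imp_continuous_on, rule analytic_Acoef, rule rest_nz) (use U1_Rs in auto)
    show "continuous_on U1 (Bcoef x z z')" for x z z'
      by (rule real_analytic_at_imp_continuous_on, rule analytic_Bcoef, rule rest_nz) (use U1_Rs in auto)
    show "c $ l = 0"
      if "\<And>x. x \<in> {..M} \<Longrightarrow> (\<Sum>z\<in>X. c $ z * Acoef x z 0) + (\<Sum>z\<in>D. \<Sum>z'\<in>D. c $ z * c $ z' * Bcoef x z z' 0) = 0"
        and "l \<in> X \<union> D" for c l
      by (rule nondegenerate_0[OF that(1) that(2)]) simp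
    show "open U1" "0 \<in> U1" by (rule oU1, rule zero_U1)
  qed (use finite_atMost in blast)+
  have U0_Rs: "U0 \<subseteq> Rs" using U0 U1_Rs by auto
  have nz: "rest v \<noteq> 0" if "v \<in> U0" for v using that U0_Rs rest_nz by auto
  define W where "W = \<Phi> -` U0"
  have oW: "open W" unfolding W_def
    using continuous_open_preimage[OF cont_\<Phi> open_UNIV U0(1)] by simp
  have small: "\<bar>\<Delta> x v / q x\<bar> < 1" if "v \<in> U0" "x \<le> M" for x v
  proof -
    have "v \<in> U1" using that U0(3) by auto
    hence "- 1 < \<Delta> x v / q x" "\<Delta> x v / q x < 1" using that(2) by (auto simp: U1_def)
    thus ?thesis unfolding abs_less_iff by linarith
  qed
  \<comment> \<open>The weights of the squares in \<open>KL_form\<close>, in the coordinates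
    \<open>v\<close>.\<close>
  define e where "e x v = log_defect (\<Delta> x v / q x) / q x" for x v
  interpret B: weighted_form X D U0 W \<Psi> \<Phi> "KL M q'" "{..M}" e Acoef Bcoef "\<lambda>v. 1 / rest v"
  proof (unfold_locales, goal_cases)
    case 1 show ?case by (rule X_D_disj)
  next
    case 2 show ?case by (simp add: X_def)
  next
    case 3 show ?case by (rule U0)
  next
    case 4 show ?case by (rule oW)
  next
    case 5 show ?case by (rule continuous_on_subset[OF cont_\<Psi> U0_Rs])
  next
    case 6 show ?case by (rule cont_\<Phi>)
  next
    case (7 v) thus ?case using \<Phi>_\<Psi>[OF nz] by (simp add: W_def)
  next
    case (8 w) thus ?case by (simp add: W_def)
  next
    case (9 v) thus ?case by (rule \<Phi>_\<Psi>[OF nz])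
  next
    case (10 w) thus ?case by (intro \<Psi>_\<Phi> nz) (simp add: W_def)
  next
    case (11 v l) thus ?case by (rule analytic_\<Psi>[OF nz])
  next
    case (12 w l) show ?case by (rule analytic_\<Phi>)
  next
    case 13
    have "W \<subseteq> W1"
    proof
      fix w assume w: "w \<in> W"
      hence "\<Psi> (\<Phi> w) \<in> W1" using U0(3) by (auto simp: W_def U1_def)
      thus "w \<in> W1" using \<Psi>_\<Phi>[OF nz] w by (simp add: W_def)
    qed
    thus ?case using W1(3) by (auto simp: real_analytic_on_def)
  next
    case 14 show ?case by simp
  next
    case (15 v)
    have v: "v \<in> Rs" using 15 U0_Rs by auto
    have "KL M q' (\<Psi> v) = (\<Sum>x\<le>M. log_defect ((mixture M (\<Psi> v) x - q x) / q x) / q x * (mixture M (\<Psi> v) x - q x)\<^sup>2)"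
      by (rule KL_form[OF q']) (use small[OF 15] in \<open>simp_all add: \<Delta>[OF v]\<close>)
    thus ?case by (simp add: \<Delta>[OF v] e_def) (simp add: \<Delta>_def)
  next
    case (16 x v) thus ?case using log_defect_pos[OF small] q' by (simp add: e_def)
  next
    case (17 x v)
    have "real_analytic_at (\<lambda>v. log_defect (\<Delta> x v / q x) / q x) v"
      using 17 U0_Rs q'[of x]
      by (intro real_analytic_at_divide real_analytic_at_log_defect an_\<Delta> real_analytic_at_const small) auto
    thus ?case by (simp add: e_def[abs_def])
  next
    case (18 x i v) thus ?case by (intro analytic_Acoef nz)
  next
    case (19 x i j v) thus ?case by (intro analytic_Bcoef nz)
  next
    case (20 v c l) thus ?case using U0(4) by blast
  next
    case (21 v) thus ?case by (intro real_analytic_intros analytic_aux nz)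
  next
    case (22 v) thus ?case using nz by simp
  next
    case (23 v) thus ?case by (rule \<Psi>_derivative[OF nz])
  qed
  have "has_rlct (KL M q') P B.thr 1"
    by (rule B.has_rlct_thr) (simp_all add: W_def \<Phi>_P U0)
  moreover have "B.thr = ereal ((4 * real (card K) + real (card (- K)) + 2) / 4)"
    unfolding B.thr_def card_X card_D by (simp add: algebra_simps)
  ultimately show ?thesis by simp
qed

end

section \<open>A realizable parameter with the required threshold\<close>

lemma ex_realizable_rlct:
  fixes M H H0 :: nat and q :: "nat \<Rightarrow> real"
  assumes "2 \<le> H" and card_i: "CARD('i::finite) = H - 1"
    and "true_mixture M H0 q"
    and H0: "real H0 \<le> min (real H) (real M / 2)"
    and an: "analytic_around_realizable M q (realizable M q :: 'i param set)"
  shows "\<exists>P\<in>(realizable M q :: 'i param set).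
            has_rlct (KL M q) P (ereal ((3 * real H0 + real H - 2) / 4)) 1"
proof -
  from \<open>true_mixture M H0 q\<close> obtain \<theta> \<tau> :: "nat \<Rightarrow> real" where H0_1: "1 \<le> H0" and
    inj: "inj_on \<theta> {1..H0}" and \<theta>01: "\<And>i. i \<in> {1..H0} \<Longrightarrow> \<theta> i \<in> {0..1}" and
    \<tau>0: "\<And>i. i \<in> {1..<H0} \<Longrightarrow> 0 < \<tau> i" and \<tau>1: "(\<Sum>i\<in>{1..<H0}. \<tau> i) < 1" and
    q: "\<And>x. x \<le> M \<Longrightarrow> q x = (\<Sum>i\<in>{1..<H0}. \<tau> i * binom_prob M (\<theta> i) x)
           + (1 - (\<Sum>i\<in>{1..<H0}. \<tau> i)) * binom_prob M (\<theta> H0) x"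
    unfolding true_mixture_def by blast
  have le: "H0 \<le> H" "2 * H0 \<le> M" using H0 by simp_all
  have "card {1..<H0} \<le> card (UNIV :: 'i set)" using card_i le by simp
  then obtain f :: "nat \<Rightarrow> 'i" where f: "inj_on f {1..<H0}"
    using card_le_inj[of "{1..<H0}" "UNIV :: 'i set"] by auto
  define K where "K = f ` {1..<H0}"
  define g where "g = inv_into {1..<H0} f"
  have gf: "g (f i) = i" if "i \<in> {1..<H0}" for i unfolding g_def by (rule inv_into_f_f[OF f that])
  have gK: "g c \<in> {1..<H0}" if "c \<in> K" for c using that gf by (auto simp: K_def)
  have fg: "f (g c) = c" if "c \<in> K" for c using that gf by (auto simp: K_def)
  have sum_K: "(\<Sum>c\<in>K. h (g c)) = (\<Sum>i\<in>{1..<H0}. h i)" for h :: "nat \<Rightarrow> real"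
    unfolding K_def by (subst sum.reindex[OF f]) (simp add: gf)
  have card_K: "card K = H0 - 1" unfolding K_def using card_image[OF f] by simp
  have card_cK: "card (- K) = H - H0"
    using card_K card_i H0_1 le by (simp add: Compl_eq_Diff_UNIV card_Diff_subset)
  \<comment> \<open>The mass of the last true component, shared equally by the
    \<open>H - H0 + 1\<close> components merged there.\<close>
  define t0 where "t0 = (1 - (\<Sum>i\<in>{1..<H0}. \<tau> i)) / (real (card (- K)) + 1)"
  interpret B: merged_mixture M K "\<lambda>c. \<theta> (g c)" "\<lambda>c. \<tau> (g c)" "\<theta> H0" t0
  proof
    show "inj_on (\<lambda>c. \<theta> (g c)) K"
    proof (rule inj_onI)
      fix b c assume bc: "b \<in> K" "c \<in> K" "\<theta> (g b) = \<theta> (g c)"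
      have "g b = g c" by (rule inj_onD[OF inj bc(3)]) (use gK[OF bc(1)] gK[OF bc(2)] in auto)
      thus "b = c" using fg bc by metis
    qed
    show "\<theta> (g c) \<noteq> \<theta> H0" if "c \<in> K" for c
    proof
      assume "\<theta> (g c) = \<theta> H0"
      from inj_onD[OF inj this] gK[OF that] H0_1 show False by auto
    qed
    show "0 < \<tau> (g c)" if "c \<in> K" for c by (rule \<tau>0[OF gK[OF that]])
    show "0 < t0" unfolding t0_def using \<tau>1 by (intro divide_pos_pos) auto
    show "(\<Sum>c\<in>K. \<tau> (g c)) + (real (card (- K)) + 1) * t0 = 1"
      unfolding sum_K t0_def by (simp add: add_nonneg_eq_0_iff)
    show "2 * card K + 2 \<le> M" using card_K le H0_1 by simp
  qed
  have Bq: "B.q x = q x" if "x \<le> M" for x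
    unfolding B.q_def q[OF that] using sum_K[of \<tau>] sum_K[of "\<lambda>i. \<tau> i * binom_prob M (\<theta> i) x"] by simp
  have tau_nonneg: "0 \<le> B.P $ Inr c" for c
    using B.\<tau>_pos[of c] B.t0_pos by (auto simp: B.P_def)
  have "B.P $ Inr c \<le> 1" for c
    using member_le_sum[of c UNIV "\<lambda>c. B.P $ Inr c"] tau_nonneg B.sum_P B.t0_pos by simp
  moreover have "B.P $ Inl j \<in> {0..1}" for j
    using gK \<theta>01 H0_1 by (cases j) (force simp: B.P_def)+
  ultimately have Ps: "B.P \<in> param_space"
    unfolding param_space_def using tau_nonneg B.sum_P B.t0_pos by auto
  have "q x * loglik_ratio M q x B.P = 0" if "x \<le> M" for x
    using Bq[OF that] by (simp add: loglik_ratio_def B.mixture_P)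
  hence KL0: "KL M q B.P = 0" unfolding KL_def by (intro sum.neutral) auto
  have P: "B.P \<in> realizable M q"
    unfolding realizable_def using Ps KL0 Bq by (auto simp: B.mixture_P)
  have "\<exists>W. open W \<and> B.P \<in> W \<and>
        (\<forall>x\<le>M. (\<forall>w\<in>W. 0 < q x \<and> 0 < mixture M w x) \<and> real_analytic_on (loglik_ratio M q x) W) \<and>
        real_analytic_on (KL M q) W"
    by (rule bspec[OF an[unfolded analytic_around_realizable_def] P])
  then obtain W where W: "open W" "B.P \<in> W" "real_analytic_on (KL M q) W"
    and Wq: "\<forall>x\<le>M. (\<forall>w\<in>W. 0 < q x \<and> 0 < mixture M w x) \<and> real_analytic_on (loglik_ratio M q x) W"
    by (elim exE conjE)
  \<comment> \<open>The analyticity assumption yields positivity of \<open>q\<close> as soon as one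
    realizable parameter is known.\<close>
  have q_pos: "0 < q x" if "x \<le> M" for x using Wq W(2) that by simp
  have "has_rlct (KL M q) B.P (ereal ((4 * real (card K) + real (card (- K)) + 2) / 4)) 1"
    by (rule B.has_rlct_P[OF W(1-3)]) (simp add: Bq q_pos)
  \<comment> \<open>With \<open>card K = H0 - 1\<close> this is
    \<open>4 (H0 - 1) + (H - H0) + 2 = 3 H0 + H - 2\<close>.\<close>
  moreover have "(4 * real (card K) + real (card (- K)) + 2) / 4 = (3 * real H0 + real H - 2) / 4"
    unfolding card_K card_cK using H0_1 le by (simp add: of_nat_diff)
  ultimately show ?thesis using P by metis
qed

theorem mainTheorem3:
  fixes M H H0 :: nat
    and q :: "nat \<Rightarrow> real"
    and prior :: "'i::finite param \<Rightarrow> real"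
  assumes "2 \<le> M" and "2 \<le> H" and "CARD('i) = H - 1"
    and "true_mixture M H0 q"
    and "real H0 \<le> min (real H) (real M / 2)"
    and "analytic_around_realizable M q (realizable M q :: 'i param set)"
    and "prior_density prior" and "\<forall>w\<in>realizable M q. 0 < prior w"
  shows "learning_coefficient (KL M q) (realizable M q :: 'i param set)
           \<le> ereal ((3 * real H0 + real H - 2) / 4) \<and>
         (\<exists>P\<in>(realizable M q :: 'i param set).
            has_rlct (KL M q) P (ereal ((3 * real H0 + real H - 2) / 4)) 1)"
proof -
  from ex_realizable_rlct[OF assms(2-6)] obtain P :: "'i param"
    where P: "P \<in> realizable M q" "has_rlct (KL M q) P (ereal ((3 * real H0 + real H - 2) / 4)) 1"
    by blast
  hence "learning_coefficient (KL M q) (realizable M q :: 'i param set) \<le> ereal ((3 * real H0 + real H - 2) / 4)"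
    unfolding learning_coefficient_def by (intro Inf_lower) blast
  with P show ?thesis by blast
qed

end
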